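(* Let $\lambda\in\mathbb{R}^n$ be weakly decreasing with at least three distinct entries, and let $N\in\mathfrak{u}_n$. Then the gradient flow of the function $L\mapsto\mathrm{tr}(LN)$ on $\mathcal{O}_\lambda$ in the Kähler metric strictly preserves positivity if and only if $\mathrm{i}N$ is a real tridiagonal matrix whose entries immediately above and below the diagonal are positive.
   Context: Here $\mathrm{i}=\sqrt{-1}$; $\mathrm{U}_n$ is the unitary group and $\mathfrak{u}_n$ the Lie algebra of skew-Hermitian $n\times n$ matrices. For weakly decreasing $\lambda\in\mathbb{R}^n$, $\mathcal{O}_\lambda=\{g(\mathrm{i}\,\mathrm{Diag}(\lambda))g^{-1}:g\in\mathrm{U}_n\}$. $\mathrm{U}_n^{>0}$ (resp. $\mathrm{U}_n^{\ge 0}$) is the set of $g\in\mathrm{U}_n$ all of whose left-justified minors (row set $I$, column set $\{1,\dots,|I|\}$) are positive (resp. nonnegative) real numbers; $\mathcal{O}_\lambda^{>0}=\{g(\mathrm{i}\,\mathrm{Diag}(\lambda))g^{-1}:g\in\mathrm{U}_n^{>0}\}$, and $\mathcal{O}_\lambda^{\ge 0}$ is its closure, equal to $\{g(\mathrm{i}\,\mathrm{Diag}(\lambda))g^{-1}:g\in\mathrm{U}_n^{\ge 0}\}$. Let $\kappa(L,M)=2n\,\mathrm{tr}(LM)-2\,\mathrm{tr}(L)\mathrm{tr}(M)$ and $\mathrm{ad}_L(X)=[L,X]=LX-XL$. The tangent space of $\mathcal{O}_\lambda$ at $L$ is $\{[L,X]:X\in\mathfrak{u}_n\}$. For $X\in\mathfrak{u}_n$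 write $X=X^L+X_L$ with $X^L\in\mathrm{im}(\mathrm{ad}_L)$, $X_L\in\ker(\mathrm{ad}_L)$ (uniquely). The normal metric is $\langle[L,X],[L,Y]\rangle_{\mathrm{normal}}=-\kappa(X^L,Y^L)$, and the Kähler metric is $\langle[L,X],[L,Y]\rangle_{\mathrm{K\ddot ahler}}=\langle\sqrt{-\mathrm{ad}_L^2}\,([L,X]),[L,Y]\rangle_{\mathrm{normal}}$, with $\sqrt{-\mathrm{ad}_L^2}$ the positive square root of the positive semidefinite operator $-\mathrm{ad}_L^2$. The gradient flow of a function $H$ is the solution of $\dot L(t)=\mathrm{grad}(H)(L(t))$ (steepest ascent), defined for all $t\in\mathbb{R}$. A flow on $\mathcal{O}_\lambda$ strictly preserves positivity if $L(t)\in\mathcal{O}_\lambda^{>0}$ for every initial point $L(0)\in\mathcal{O}_\lambda^{\ge 0}$ and all $t>0$. *)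

theory Defs
  imports "Jordan_Normal_Form.Determinant" "HOL-Analysis.Analysis"
begin

no_notation vec_index (infixl "$" 100)
no_notation scalar_prod (infix "\<bullet>" 70)

text \<open>
  Matrices of size \<open>n\<close> have type \<open>'n cmat\<close>. Wherever the order of rows and columns matters, \<open>'n\<close> is
  a finite linearly ordered type, whose increasing enumeration plays the role of \<open>1, \<dots>, n\<close>.
\<close>

type_synonym 'n cmat = "complex^'n^'n"

definition ctranspose :: "complex^'n^'m \<Rightarrow> complex^'m^'n" where
  "ctranspose A = (\<chi> i j. cnj (A $ j $ i))"

definition unitary_group :: "'n::finite cmat set" where
  "unitary_group = {g. g ** ctranspose g = mat 1 \<and> ctranspose g ** g = mat 1}"

definition skew_hermitian :: "'n::finite cmat set" where
  "skew_hermitian = {X. ctranspose X = - X}"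

definition i_diag :: "real^'n \<Rightarrow> 'n cmat" where
  "i_diag lam = (\<chi> j k. if j = k then \<i> * complex_of_real (lam $ j) else 0)"

definition orbit_point :: "real^'n \<Rightarrow> 'n cmat \<Rightarrow> 'n cmat" where
  "orbit_point lam g = g ** i_diag lam ** matrix_inv g"

definition orbit :: "real^'n \<Rightarrow> 'n cmat set" where
  "orbit lam = orbit_point lam ` unitary_group"


subsection \<open>Positivity\<close>

text \<open>
  The minor with row set \<open>I\<close> and column set the first \<open>card I\<close> indices, rows and columns taken in
  increasing order.
\<close>

definition left_minor :: "'n::{finite,linorder} cmat \<Rightarrow> 'n set \<Rightarrow> complex" where
  "left_minor A I = Determinant.det (Matrix.mat (card I) (card I)
     (\<lambda>(a, b). A $ (sorted_list_of_set I ! a) $ (sorted_list_of_set (UNIV :: 'n set) ! b)))"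

definition unitary_pos :: "'n::{finite,linorder} cmat set" where
  "unitary_pos = {g \<in> unitary_group. \<forall>I. left_minor g I \<in> \<real> \<and> 0 < Re (left_minor g I)}"

definition orbit_pos :: "real^'n::{finite,linorder} \<Rightarrow> 'n cmat set" where
  "orbit_pos lam = orbit_point lam ` unitary_pos"

definition orbit_nonneg :: "real^'n::{finite,linorder} \<Rightarrow> 'n cmat set" where
  "orbit_nonneg lam = closure (orbit_pos lam)"


subsection \<open>The Kaehler metric on an orbit\<close>

definition ad :: "'n::finite cmat \<Rightarrow> 'n cmat \<Rightarrow> 'n cmat" where
  "ad L X = L ** X - X ** L"

definition tangent_space :: "'n::finite cmat \<Rightarrow> 'n cmat set" where
  "tangent_space L = ad L ` skew_hermitian"

definition kappa :: "'n::finite cmat \<Rightarrow> 'n cmat \<Rightarrow> complex" where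
  "kappa X Y = 2 * of_nat CARD('n) * trace (X ** Y) - 2 * trace X * trace Y"

text \<open>The component \<open>X\<^sup>L\<close> of \<open>X = X\<^sup>L + X\<^sub>L\<close> in the image of \<open>ad L\<close> on skew-Hermitian matrices.\<close>

definition im_part :: "'n::finite cmat \<Rightarrow> 'n cmat \<Rightarrow> 'n cmat" where
  "im_part L X = (THE Y. Y \<in> ad L ` skew_hermitian \<and>
                         X - Y \<in> {Z \<in> skew_hermitian. ad L Z = 0})"

text \<open>
  Tangent vectors \<open>V\<close>, \<open>W\<close> at \<open>L\<close> are written as \<open>[L, X]\<close>, \<open>[L, Y]\<close>; the value does not depend on the
  choice of \<open>X\<close>, \<open>Y\<close>. On skew-Hermitian matrices \<open>kappa\<close> is real, so \<open>Re\<close> only changes the type.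
\<close>

definition normal_metric :: "'n::finite cmat \<Rightarrow> 'n cmat \<Rightarrow> 'n cmat \<Rightarrow> real" where
  "normal_metric L V W =
     (THE r. \<exists>X\<in>skew_hermitian. \<exists>Y\<in>skew_hermitian.
        V = ad L X \<and> W = ad L Y \<and> r = - Re (kappa (im_part L X) (im_part L Y)))"

text \<open>
  The positive semidefinite square root of an operator \<open>T\<close> on a subspace \<open>U\<close>, evaluated at
  \<open>x \<in> U\<close>. It is determined by \<open>T\<close> on \<open>U\<close>, but a linear extension \<open>S\<close> of it to the ambient space is not,
  hence the description by values.
\<close>

definition psd_sqrt_on :: "'a::real_inner set \<Rightarrow> ('a \<Rightarrow> 'a) \<Rightarrow> 'a \<Rightarrow> 'a" where
  "psd_sqrt_on U T x = (THE y. \<exists>S. linear S \<and> S ` U \<subseteq> U \<and> (\<forall>u\<in>U. S (S u) = T u) \<and>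
     (\<forall>u\<in>U. \<forall>v\<in>U. S u \<bullet> v = u \<bullet> S v) \<and> (\<forall>u\<in>U. 0 \<le> u \<bullet> S u) \<and> y = S x)"

text \<open>
  The inner product of \<open>'n cmat\<close> restricts to \<open>- trace (X ** Y)\<close> on skew-Hermitian matrices. It
  is used for the square root because \<open>- kappa\<close> is degenerate there (on scalar matrices); on the image
  of \<open>ad L\<close>, which is traceless, the two are proportional.
\<close>

definition kahler_metric :: "'n::finite cmat \<Rightarrow> 'n cmat \<Rightarrow> 'n cmat \<Rightarrow> real" where
  "kahler_metric L V W =
     normal_metric L (psd_sqrt_on skew_hermitian (\<lambda>X. - ad L (ad L X)) V) W"


subsection \<open>Gradient flow\<close>

text \<open>
  Functions on an orbit are given by smooth functions \<open>H\<close> on the ambient space, so that the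
  differential of the restriction is the restriction of the ambient derivative to tangent vectors.
\<close>

definition kahler_grad :: "('n::finite cmat \<Rightarrow> real) \<Rightarrow> 'n cmat \<Rightarrow> 'n cmat" where
  "kahler_grad H L = (THE G. G \<in> tangent_space L \<and>
     (\<forall>V\<in>tangent_space L. kahler_metric L G V = frechet_derivative H (at L) V))"

definition kahler_gradient_curve ::
    "real^'n \<Rightarrow> ('n cmat \<Rightarrow> real) \<Rightarrow> (real \<Rightarrow> 'n cmat) \<Rightarrow> bool" where
  "kahler_gradient_curve lam H L \<longleftrightarrow>
     (\<forall>t. L t \<in> orbit lam \<and> (L has_vector_derivative kahler_grad H (L t)) (at t))"

definition kahler_flow_strictly_preserves_positivity ::
    "real^'n::{finite,linorder} \<Rightarrow> ('n cmat \<Rightarrow> real) \<Rightarrow> bool" where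
  "kahler_flow_strictly_preserves_positivity lam H \<longleftrightarrow>
     (\<forall>L. kahler_gradient_curve lam H L \<and> L 0 \<in> orbit_nonneg lam \<longrightarrow> (\<forall>t>0. L t \<in> orbit_pos lam))"


subsection \<open>Tridiagonal matrices\<close>

definition adjacent :: "'n::linorder \<Rightarrow> 'n \<Rightarrow> bool" where
  "adjacent i j \<longleftrightarrow> (i < j \<and> {i<..<j} = {}) \<or> (j < i \<and> {j<..<i} = {})"

definition real_tridiagonal :: "'n::{finite,linorder} cmat \<Rightarrow> bool" where
  "real_tridiagonal A \<longleftrightarrow>
     (\<forall>i j. A $ i $ j \<in> \<real>) \<and> (\<forall>i j. i \<noteq> j \<and> \<not> adjacent i j \<longrightarrow> A $ i $ j = 0)"

end

theory Submission
  imports Defs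
begin

text \<open>
  Put \<open>A = \<i> N\<close>. In a frame where \<open>L = \<i> diag(lam)\<close>, the Kaehler metric is
  \<open>2 n \<Sum> Re (V\<^sub>j\<^sub>k cnj W\<^sub>j\<^sub>k) / \<bar>lam\<^sub>j - lam\<^sub>k\<bar>\<close>, so the gradient is a multiple of \<open>\<bar>lam\<^sub>j - lam\<^sub>k\<bar> \<i> A\<^sub>j\<^sub>k\<close>, and
  the gradient flow moves the eigenflag of \<open>L\<close> by \<open>exp (t A)\<close>, with \<open>t\<close> rescaled.

  If \<open>A\<close> is tridiagonal with positive off-diagonal entries, the left-justified minors of
  \<open>exp (t A) w\<close> of each size solve a linear system whose matrix is nonnegative off the diagonal and
  irreducible. Nonnegative initial minors, which do not all vanish, thus become positive at once; a
  QR decomposition turns \<open>exp (t A) w\<close> into a positive unitary representative.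

  Conversely, start at a coordinate flag, where \<open>L\<close> is diagonal, and let \<open>g(t)\<close> be positive
  representatives of \<open>L(t)\<close> that converge to \<open>g\<close> as \<open>t\<close> tends to 0. To first order in \<open>t\<close>, the minor
  of \<open>g(t)\<close> with rows \<open>S - {i} \<union> {j}\<close> is \<open>t (- 1)\<^sup>b A\<^sub>j\<^sub>i\<close> times the minor of \<open>g\<close> with rows \<open>S\<close>, where
  \<open>b\<close> counts the elements of \<open>S\<close> between \<open>i\<close> and \<open>j\<close>. Three distinct eigenvalues provide two proper
  subspaces of the flag, with coordinate sets \<open>K \<subset> K'\<close>, and a chain of sets \<open>S\<close> with nonzero minor
  from \<open>K'\<close> down to \<open>K\<close>. If some \<open>m\<close> between \<open>i\<close> and \<open>j\<close> lies in \<open>K' - K\<close>, the parity of \<open>b\<close> changes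
  along the chain, which forces \<open>A\<^sub>j\<^sub>i = 0\<close>.
\<close>

subsection \<open>Matrices and unitary frames\<close>

text \<open>Preserving positivity is a statement about every solution of the gradient equation. The
  sufficient direction therefore needs uniqueness of solutions, and the converse needs their
  existence. A differentiable QR decomposition of the exponential flow gives existence. Uniqueness
  is only needed for the flag of eigenspaces, since the flag determines the point of the orbit. The
  obstacle in the converse is that \<open>L(t)\<close> fixes its unitary representative only up to
  the stabiliser of \<open>i_diag lam\<close>, so minors whose size lies strictly between dimensions
  of the flag depend on the choice. Compactness supplies a limit of unknown positive
  representatives, and all sign information is drawn from this one matrix. With only two eigenvalues
  there is a single proper subspace, and no room for a chain of row sets. Since
  \<open>orbit_nonneg\<close> is a closure, the converse also has to show that coordinate flags
  belong to it. Positivity of a tridiagonal flow does this, so part of the sufficient direction is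
  used again.\<close>

lemma bounded_bilinear_matrix_mult:
  "bounded_bilinear ((**) :: complex^'m^'k \<Rightarrow> complex^'n^'m \<Rightarrow> complex^'n^'k)"
proof -
  have "bilinear ((**) :: complex^'m^'k \<Rightarrow> complex^'n^'m \<Rightarrow> complex^'n^'k)"
    unfolding bilinear_def
    by (auto intro!: linearI
        simp: matrix_matrix_mult_def vec_eq_iff sum.distrib algebra_simps scaleR_right.sum)
  then show ?thesis
    by (simp add: bilinear_conv_bounded_bilinear)
qed

lemmas has_vector_derivative_matrix_mult =
  bounded_bilinear.has_vector_derivative[OF bounded_bilinear_matrix_mult]

lemmas matrix_mult_add_right = bounded_bilinear.add_right[OF bounded_bilinear_matrix_mult]
lemmas matrix_mult_add_left = bounded_bilinear.add_left[OF bounded_bilinear_matrix_mult]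
lemmas matrix_diff_ldistrib = bounded_bilinear.diff_right[OF bounded_bilinear_matrix_mult]
lemmas matrix_diff_rdistrib = bounded_bilinear.diff_left[OF bounded_bilinear_matrix_mult]
lemmas matrix_minus_right = bounded_bilinear.minus_right[OF bounded_bilinear_matrix_mult]
lemmas matrix_minus_left = bounded_bilinear.minus_left[OF bounded_bilinear_matrix_mult]
lemmas matrix_scaleR_right = bounded_bilinear.scaleR_right[OF bounded_bilinear_matrix_mult]
lemmas matrix_scaleR_left = bounded_bilinear.scaleR_left[OF bounded_bilinear_matrix_mult]
lemmas matrix_zero_right = bounded_bilinear.zero_right[OF bounded_bilinear_matrix_mult]
lemmas matrix_zero_left = bounded_bilinear.zero_left[OF bounded_bilinear_matrix_mult]
lemmas matrix_algebra = matrix_mult_add_right matrix_mult_add_left matrix_diff_ldistrib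
  matrix_diff_rdistrib matrix_minus_right matrix_minus_left matrix_scaleR_right matrix_scaleR_left
  matrix_zero_right matrix_zero_left matrix_mul_assoc[symmetric]

lemma continuous_on_matrix_mult [continuous_intros]:
  fixes f :: "'a::topological_space \<Rightarrow> complex^'m^'k" and g :: "'a \<Rightarrow> complex^'n^'m"
  assumes "continuous_on S f" "continuous_on S g"
  shows "continuous_on S (\<lambda>x. f x ** g x)"
  by (rule bounded_bilinear.continuous_on[OF bounded_bilinear_matrix_mult assms])

lemma tendsto_matrix_mult:
  fixes f :: "'a \<Rightarrow> complex^'m^'k" and g :: "'a \<Rightarrow> complex^'n^'m"
  assumes "(f \<longlongrightarrow> a) F" "(g \<longlongrightarrow> b) F"
  shows "((\<lambda>x. f x ** g x) \<longlongrightarrow> a ** b) F"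
  by (rule bounded_bilinear.tendsto[OF bounded_bilinear_matrix_mult assms])

lemma matrix_mult_nth: "(A ** B) $ i $ j = (\<Sum>k\<in>UNIV. A $ i $ k * B $ k $ j)"
  by (simp add: matrix_matrix_mult_def)

lemma ctranspose_nth [simp]: "ctranspose A $ i $ j = cnj (A $ j $ i)"
  by (simp add: ctranspose_def)

lemma ctranspose_mult: "ctranspose (A ** B) = ctranspose B ** ctranspose A"
  by (simp add: vec_eq_iff matrix_mult_nth mult.commute)

lemma ctranspose_ctranspose [simp]: "ctranspose (ctranspose A) = A"
  by (simp add: vec_eq_iff)

lemma bounded_linear_ctranspose: "bounded_linear (ctranspose :: complex^'n^'m \<Rightarrow> complex^'m^'n)"
  by (intro linear_conv_bounded_linear[THEN iffD1] linearI) (simp_all add: vec_eq_iff)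

text \<open>The last four facts cancel \<open>g\<close> against its inverse inside longer products,
  in left-nested and in right-nested form.\<close>

lemma unitary_groupD:
  assumes "g \<in> unitary_group"
  shows "g ** ctranspose g = mat 1" "ctranspose g ** g = mat 1"
    "X ** g ** ctranspose g = X" "X ** ctranspose g ** g = X"
    "ctranspose g ** (g ** Y) = Y" "g ** (ctranspose g ** Y) = Y"
proof -
  show *: "g ** ctranspose g = mat 1" "ctranspose g ** g = mat 1"
    using assms by (auto simp: unitary_group_def)
  show "X ** g ** ctranspose g = X" "X ** ctranspose g ** g = X"
    by (simp_all add: matrix_mul_assoc[symmetric] *)
  show "ctranspose g ** (g ** Y) = Y" "g ** (ctranspose g ** Y) = Y"
    by (simp_all add: matrix_mul_assoc *)
qed

lemma unitary_groupI:
  fixes g :: "'n::finite cmat"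
  assumes "ctranspose g ** g = mat 1"
  shows "g \<in> unitary_group"
  using assms matrix_left_right_inverse[of g "ctranspose g"] by (simp add: unitary_group_def)

lemma unitary_group_ctranspose: "g \<in> unitary_group \<Longrightarrow> ctranspose g \<in> unitary_group"
  by (simp add: unitary_group_def)

lemma unitary_group_mult:
  assumes "g \<in> unitary_group" "h \<in> unitary_group" shows "g ** h \<in> unitary_group"
  by (rule unitary_groupI)
    (simp add: ctranspose_mult matrix_mul_assoc[symmetric] unitary_groupD[OF assms(1)]
      unitary_groupD[OF assms(2)])

lemma matrix_inv_unique:
  fixes A B :: "'n::finite cmat"
  assumes "A ** B = mat 1"
  shows "matrix_inv A = B"
proof -
  have "B ** A = mat 1"
    using assms matrix_left_right_inverse by blast
  with assms have "invertible A"
    unfolding invertible_def by blast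
  then have "A ** matrix_inv A = mat 1" "matrix_inv A ** A = mat 1"
    by (auto simp: invertible_def matrix_inv_def intro: someI2_ex)
  then have "B ** (A ** matrix_inv A) = B"
    by simp
  then show ?thesis
    using \<open>B ** A = mat 1\<close> by (simp add: matrix_mul_assoc)
qed

lemma matrix_inv_unitary: "g \<in> unitary_group \<Longrightarrow> matrix_inv g = ctranspose g"
  by (rule matrix_inv_unique) (simp add: unitary_groupD)

lemma orbit_point_unitary:
  "g \<in> unitary_group \<Longrightarrow> orbit_point lam g = g ** i_diag lam ** ctranspose g"
  by (simp add: orbit_point_def matrix_inv_unitary)

section \<open>Change of unitary frame\<close>

definition conj_by :: "'n::finite cmat \<Rightarrow> 'n cmat \<Rightarrow> 'n cmat" where
  "conj_by g X = g ** X ** ctranspose g"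

lemma conj_by_inverse:
  assumes "g \<in> unitary_group"
  shows "conj_by (ctranspose g) (conj_by g X) = X" "conj_by g (conj_by (ctranspose g) X) = X"
  by (simp_all add: conj_by_def matrix_mul_assoc[symmetric] unitary_groupD[OF assms])

lemma conj_by_eq_iff:
  assumes "g \<in> unitary_group"
  shows "conj_by g X = conj_by g Y \<longleftrightarrow> X = Y"
  by (metis assms conj_by_inverse(1))

lemma conj_by_mult:
  assumes "g \<in> unitary_group"
  shows "conj_by g X ** conj_by g Y = conj_by g (X ** Y)"
  by (simp add: conj_by_def matrix_mul_assoc[symmetric] unitary_groupD[OF assms])

lemma bounded_linear_conj_by: "bounded_linear (conj_by g)"
  unfolding conj_by_def
  by (rule bounded_linear_compose[OF
        bounded_bilinear.bounded_linear_left[OF bounded_bilinear_matrix_mult]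
        bounded_bilinear.bounded_linear_right[OF bounded_bilinear_matrix_mult]])

lemmas linear_conj_by = bounded_linear.linear[OF bounded_linear_conj_by]
lemmas conj_by_diff = linear_diff[OF linear_conj_by]
lemmas conj_by_add = linear_add[OF linear_conj_by]
lemmas conj_by_scaleR = linear_cmul[OF linear_conj_by]
lemmas conj_by_minus = linear_neg[OF linear_conj_by]

lemma ad_conj_by:
  assumes "g \<in> unitary_group"
  shows "ad (conj_by g X) (conj_by g Y) = conj_by g (ad X Y)"
  by (simp add: ad_def conj_by_mult[OF assms] conj_by_diff)

lemma ctranspose_conj_by: "ctranspose (conj_by g X) = conj_by g (ctranspose X)"
  by (simp add: conj_by_def ctranspose_mult matrix_mul_assoc)

lemma conj_by_skew_hermitian:
  assumes "X \<in> skew_hermitian"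
  shows "conj_by g X \<in> skew_hermitian"
  using assms by (simp add: skew_hermitian_def ctranspose_conj_by conj_by_minus)

lemma skew_hermitian_conj_by_cases:
  assumes "g \<in> unitary_group" "X \<in> skew_hermitian"
  obtains Y where "Y \<in> skew_hermitian" "X = conj_by g Y"
  using conj_by_inverse(2)[OF assms(1)] conj_by_skew_hermitian[OF assms(2)] by metis

lemma trace_conj_by:
  assumes "g \<in> unitary_group" shows "trace (conj_by g X) = trace X"
proof -
  have "trace (conj_by g X) = trace (ctranspose g ** (g ** X))"
    unfolding conj_by_def by (rule trace_mul_sym)
  then show ?thesis by (simp add: unitary_groupD[OF assms])
qed

lemma inner_cmat: "(X :: 'n::finite cmat) \<bullet> Y = (\<Sum>j\<in>UNIV. \<Sum>k\<in>UNIV. Re (X $ j $ k * cnj (Y $ j $ k)))"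
  by (simp add: inner_vec_def inner_complex_def)

lemma inner_cmat_trace: "(X :: 'n::finite cmat) \<bullet> Y = Re (trace (X ** ctranspose Y))"
  by (simp add: inner_cmat trace_def matrix_mult_nth)

lemma inner_conj_by:
  assumes "g \<in> unitary_group" shows "conj_by g X \<bullet> conj_by g Y = X \<bullet> Y"
  by (simp add: inner_cmat_trace ctranspose_conj_by conj_by_mult[OF assms] trace_conj_by[OF assms])

lemma orbit_point_conj_by: "g \<in> unitary_group \<Longrightarrow> orbit_point lam g = conj_by g (i_diag lam)"
  by (simp add: orbit_point_unitary conj_by_def)

lemma i_diag_nth: "i_diag lam $ j $ k = (if j = k then \<i> * complex_of_real (lam $ j) else 0)"
  by (simp add: i_diag_def)

lemma matrix_mult_i_diag: "(X ** i_diag lam) $ j $ k = \<i> * lam $ k * X $ j $ k"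
  by (simp add: matrix_mult_nth i_diag_nth if_distrib cong: if_cong)

lemma i_diag_matrix_mult: "(i_diag lam ** X) $ j $ k = \<i> * lam $ j * X $ j $ k"
  by (simp add: matrix_mult_nth i_diag_nth if_distrib if_distribR cong: if_cong)

lemma ad_i_diag: "ad (i_diag lam) X $ j $ k = \<i> * (lam $ j - lam $ k) * X $ j $ k"
  by (simp add: ad_def matrix_mult_i_diag i_diag_matrix_mult algebra_simps)

lemma skew_hermitian_iff: "X \<in> skew_hermitian \<longleftrightarrow> (\<forall>j k. cnj (X $ k $ j) = - X $ j $ k)"
  by (simp add: skew_hermitian_def vec_eq_iff)

lemma subspace_skew_hermitian: "subspace (skew_hermitian :: 'n::finite cmat set)"
  by (simp add: subspace_def skew_hermitian_iff)

lemma compact_unitary_group: "compact (unitary_group :: 'n::finite cmat set)"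
proof (rule compact_eq_bounded_closed[THEN iffD2], intro conjI)
  \<comment> \<open>The squared norm is the trace of \<open>g ** ctranspose g\<close>, which is the
    size of the matrix.\<close>
  have "norm g = sqrt (real CARD('n))" if "g \<in> unitary_group" for g :: "'n cmat"
    using unitary_groupD(1)[OF that]
    by (simp add: norm_eq_sqrt_inner inner_cmat_trace trace_def mat_def)
  then show "bounded (unitary_group :: 'n cmat set)"
    unfolding bounded_iff by (intro exI[of _ "sqrt (real CARD('n))"]) simp
next
  have "closed {g :: 'n cmat. g ** ctranspose g = mat 1 \<and> ctranspose g ** g = mat 1}"
    by (intro closed_Collect_conj closed_Collect_eq continuous_intros
        bounded_linear.continuous_on[OF bounded_linear_ctranspose])
  then show "closed (unitary_group :: 'n cmat set)"
    by (simp add: unitary_group_def)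
qed

subsection \<open>The matrix exponential\<close>

text \<open>The ring structure of the type \<open>'n cmat\<close> is componentwise, so \<open>exp\<close> is not the matrix
  exponential.\<close>

primrec matpow :: "'n::finite cmat \<Rightarrow> nat \<Rightarrow> 'n cmat" where
  "matpow A 0 = mat 1"
| "matpow A (Suc m) = A ** matpow A m"

lemma matpow_commute: "matpow A m ** A = A ** matpow A m"
  by (induction m) (simp_all add: matrix_mul_assoc[symmetric])

text \<open>The sum of the absolute values of all entries dominates every row sum, so each further
  factor \<open>A\<close> costs at most one factor \<open>C\<close>.\<close>

lemma matpow_bound:
  fixes A :: "'n::finite cmat"
  obtains C where "\<And>m i j. norm (matpow A m $ i $ j) \<le> C ^ m"
proof
  define C where "C = (\<Sum>i\<in>UNIV. \<Sum>k\<in>UNIV. norm (A $ i $ k))"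
  have row: "(\<Sum>k\<in>UNIV. norm (A $ i $ k)) \<le> C" for i
    unfolding C_def by (rule member_le_sum) (auto intro: sum_nonneg)
  have C0: "C \<ge> 0"
    unfolding C_def by (intro sum_nonneg) auto
  show "norm (matpow A m $ i $ j) \<le> C ^ m" for m i j
  proof (induction m arbitrary: i)
    case 0
    then show ?case by (simp add: mat_def)
  next
    case (Suc m)
    have "norm (matpow A (Suc m) $ i $ j) \<le> (\<Sum>k\<in>UNIV. norm (A $ i $ k * matpow A m $ k $ j))"
      by (simp add: matrix_mult_nth norm_sum)
    also have "\<dots> \<le> (\<Sum>k\<in>UNIV. norm (A $ i $ k) * C ^ m)"
      by (intro sum_mono) (simp add: norm_mult mult_left_mono Suc)
    also have "\<dots> = (\<Sum>k\<in>UNIV. norm (A $ i $ k)) * C ^ m"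
      by (simp add: sum_distrib_right)
    also have "\<dots> \<le> C ^ Suc m"
      using row C0 by (simp add: mult_right_mono)
    finally show ?case .
  qed
qed

definition exp_coeff :: "'n::finite cmat \<Rightarrow> nat \<Rightarrow> 'n cmat" where
  "exp_coeff A m = (1 / fact m) *\<^sub>R matpow A m"

lemma exp_coeff_commute: "exp_coeff A m ** A = A ** exp_coeff A m"
  by (simp add: exp_coeff_def matrix_scaleR_left matrix_scaleR_right matpow_commute)

text \<open>This recursion turns termwise differentiation of the series into left multiplication by
  \<open>A\<close>.\<close>

lemma exp_coeff_Suc: "of_nat (Suc m) * exp_coeff A (Suc m) $ i $ j = (A ** exp_coeff A m) $ i $ j"
  by (simp add: exp_coeff_def matrix_scaleR_right scaleR_conv_of_real[where 'a=complex] field_simps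
      del: of_nat_Suc)

text \<open>Each entry is a complex power series evaluated at a real point, so the termwise
  differentiation theorem for scalar series applies entry by entry.\<close>

definition matexp :: "'n::finite cmat \<Rightarrow> real \<Rightarrow> 'n cmat" where
  "matexp A t = (\<chi> i j. \<Sum>m. exp_coeff A m $ i $ j * of_real t ^ m)"

lemma matexp_nth: "matexp A t $ i $ j = (\<Sum>m. exp_coeff A m $ i $ j * of_real t ^ m)"
  by (simp add: matexp_def)

lemma summable_matexp: "summable (\<lambda>m. exp_coeff A m $ i $ j * (z :: complex) ^ m)"
proof -
  obtain C where C: "\<And>m i j. norm (matpow A m $ i $ j) \<le> C ^ m"
    using matpow_bound[of A] by blast
  have "norm (exp_coeff A m $ i $ j * z ^ m) \<le> inverse (fact m) * (C * norm z) ^ m" for m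
    using mult_right_mono[OF C[of m i j], of "norm z ^ m / fact m"]
    by (simp add: exp_coeff_def norm_mult norm_divide norm_power power_mult_distrib field_simps)
  then show ?thesis
    by (intro summable_comparison_test'[OF summable_exp[of "C * norm z"], of 0]) auto
qed

lemma matexp_0 [simp]: "matexp A 0 = mat 1"
  by (simp only: vec_eq_iff matexp_nth of_real_0 powser_zero) (simp add: exp_coeff_def)

lemma matexp_mult_left:
  "(A ** matexp A t) $ i $ j = (\<Sum>m. (A ** exp_coeff A m) $ i $ j * of_real t ^ m)"
proof -
  have "(A ** matexp A t) $ i $ j =
      (\<Sum>k\<in>UNIV. \<Sum>m. A $ i $ k * (exp_coeff A m $ k $ j * of_real t ^ m))"
    by (simp only: matrix_mult_nth matexp_nth suminf_mult[OF summable_matexp])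
  also have "\<dots> = (\<Sum>m. \<Sum>k\<in>UNIV. A $ i $ k * (exp_coeff A m $ k $ j * of_real t ^ m))"
    by (rule suminf_sum[symmetric]) (intro summable_mult summable_matexp)
  finally show ?thesis
    by (simp only: matrix_mult_nth sum_distrib_right mult.assoc)
qed

lemma matexp_mult_right:
  "(matexp A t ** A) $ i $ j = (\<Sum>m. (exp_coeff A m ** A) $ i $ j * of_real t ^ m)"
proof -
  have "(matexp A t ** A) $ i $ j =
      (\<Sum>k\<in>UNIV. \<Sum>m. exp_coeff A m $ i $ k * of_real t ^ m * A $ k $ j)"
    by (simp only: matrix_mult_nth matexp_nth suminf_mult2[OF summable_matexp])
  also have "\<dots> = (\<Sum>m. \<Sum>k\<in>UNIV. exp_coeff A m $ i $ k * of_real t ^ m * A $ k $ j)"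
    by (rule suminf_sum[symmetric]) (intro summable_mult2 summable_matexp)
  finally show ?thesis
    by (simp add: matrix_mult_nth sum_distrib_right mult_ac sum_distrib_left)
qed

lemma matexp_commute: "matexp A t ** A = A ** matexp A t"
  by (simp only: vec_eq_iff matexp_mult_left matexp_mult_right exp_coeff_commute) simp

lemma has_vector_derivative_vecI:
  fixes f :: "real \<Rightarrow> 'a::real_normed_vector^'n"
  assumes "\<And>i. ((\<lambda>t. f t $ i) has_vector_derivative f' $ i) (at t within S)"
  shows "(f has_vector_derivative f') (at t within S)"
  unfolding has_vector_derivative_def has_derivative_within
proof (intro conjI bounded_linear_scaleR_left vec_tendstoI)
  fix i
  show "((\<lambda>y. ((1 / norm (y - t)) *\<^sub>R (f y - (f t + (y - t) *\<^sub>R f'))) $ i) \<longlongrightarrow> 0 $ i) (at t within S)"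
    using assms[of i] by (simp add: has_vector_derivative_def has_derivative_within)
qed

lemma has_vector_derivative_vec_nth:
  fixes f :: "real \<Rightarrow> 'a::real_normed_vector^'n"
  assumes "(f has_vector_derivative f') (at t within S)"
  shows "((\<lambda>t. f t $ i) has_vector_derivative f' $ i) (at t within S)"
  by (rule bounded_linear.has_vector_derivative[OF bounded_linear_vec_nth assms])

lemma matexp_deriv: "(matexp A has_vector_derivative A ** matexp A t) (at t)"
proof (intro has_vector_derivative_vecI)
  fix i j
  have *: "((\<lambda>z. \<Sum>m. exp_coeff A m $ i $ j * z ^ m) has_field_derivative
      (\<Sum>m. diffs (\<lambda>m. exp_coeff A m $ i $ j) m * of_real t ^ m)) (at (of_real t))"
    by (rule termdiffs_strong_converges_everywhere[OF summable_matexp])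
  have "(\<Sum>m. diffs (\<lambda>m. exp_coeff A m $ i $ j) m * of_real t ^ m) = (A ** matexp A t) $ i $ j"
    by (simp only: diffs_def exp_coeff_Suc matexp_mult_left)
  from has_vector_derivative_real_field[OF *[unfolded this]]
  show "((\<lambda>t. matexp A t $ i $ j) has_vector_derivative (A ** matexp A t) $ i $ j) (at t)"
    unfolding matexp_nth .
qed

lemma matexp_deriv_scaled:
  "((\<lambda>t. matexp A (c * t)) has_vector_derivative c *\<^sub>R (A ** matexp A (c * t))) (at t)"
proof -
  have "((\<lambda>t. c * t) has_vector_derivative c) (at t)"
    unfolding has_real_derivative_iff_has_vector_derivative[symmetric]
    by (auto intro!: derivative_eq_intros)
  from vector_diff_chain_at[OF this matexp_deriv[of A "c * t"]] show ?thesis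
    by (simp add: o_def)
qed

text \<open>The product has derivative zero because \<open>A\<close> commutes with its exponential,
  and at time 0 it is the identity. No addition formula is involved.\<close>

lemma matexp_minus: "matexp A (- t) ** matexp A t = mat 1"
proof -
  have "((\<lambda>t. matexp A ((-1) * t) ** matexp A t) has_vector_derivative 0) (at t within UNIV)" for t
  proof -
    have "matexp A (- 1 * t) ** (A ** matexp A t) + (- 1) *\<^sub>R (A ** matexp A (- 1 * t)) ** matexp A t = 0"
      unfolding matrix_mul_assoc matexp_commute matrix_scaleR_left by simp
    with has_vector_derivative_matrix_mult[OF matexp_deriv_scaled[of A "-1" t] matexp_deriv[of A t]]
    show ?thesis by (simp only:)
  qed
  then have "\<And>t. t \<in> UNIV \<Longrightarrow>
      ((\<lambda>t. matexp A ((-1) * t) ** matexp A t) has_vector_derivative 0) (at t within UNIV)"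
    by simp
  from has_vector_derivative_zero_constant[OF convex_UNIV this]
  obtain c where c: "\<And>t. matexp A ((-1) * t) ** matexp A t = c"
    by (metis UNIV_I)
  from c[of t] c[of 0] show ?thesis
    by simp
qed

lemma continuous_on_matexp: "continuous_on S (matexp A)"
  by (intro continuous_at_imp_continuous_on ballI
      has_derivative_continuous[OF matexp_deriv[unfolded has_vector_derivative_def]])

subsection \<open>Left-justified minors\<close>

definition col_of :: "nat \<Rightarrow> 'n::{finite,linorder}" where
  "col_of b = sorted_list_of_set (UNIV :: 'n set) ! b"

lemma col_of_bij: "bij_betw (col_of :: nat \<Rightarrow> 'n) {..<CARD('n)} (UNIV :: 'n::{finite,linorder} set)"
  unfolding col_of_def by (rule bij_betw_nth) auto

lemma col_of_less: "a < b \<Longrightarrow> b < CARD('n) \<Longrightarrow> (col_of a :: 'n::{finite,linorder}) < col_of b"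
  unfolding col_of_def by (rule sorted_wrt_nth_less[OF strict_sorted_list_of_set]) auto

lemma col_of_less_iff:
  assumes "a < CARD('n)" "b < CARD('n)"
  shows "(col_of a :: 'n::{finite,linorder}) < col_of b \<longleftrightarrow> a < b"
  using col_of_less[where 'n='n, of a b] col_of_less[where 'n='n, of b a] assms
  by (metis less_asym' linorder_neqE_nat)

lemma col_of_eq_iff:
  assumes "a < CARD('n)" "b < CARD('n)"
  shows "(col_of a :: 'n::{finite,linorder}) = col_of b \<longleftrightarrow> a = b"
  using bij_betw_imp_inj_on[OF col_of_bij[where 'n='n]] assms by (auto simp: inj_on_def)

lemma sum_col_of: "(\<Sum>j\<in>(UNIV :: 'n::{finite,linorder} set). f j) = (\<Sum>b<CARD('n). f (col_of b))"
  using sum.reindex_bij_betw[OF col_of_bij[where 'n='n], of f] by simp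

text \<open>Rows are a list, not a set, so that replacing one row, which may break the order or
  repeat a row, still yields a minor with a definite sign.\<close>

definition row_minor :: "'n::{finite,linorder} cmat \<Rightarrow> 'n list \<Rightarrow> complex" where
  "row_minor A xs = Determinant.det (Matrix.mat (length xs) (length xs)
     (\<lambda>(a, b). A $ (xs ! a) $ col_of b))"

lemma left_minor_row_minor: "left_minor A I = row_minor A (sorted_list_of_set I)"
  by (simp add: left_minor_def row_minor_def col_of_def)

lemma row_minor_leibniz:
  "row_minor A xs = (\<Sum>p | p permutes {0..<length xs}.
     signof p * (\<Prod>i = 0..<length xs. A $ (xs ! i) $ col_of (p i)))"
  unfolding row_minor_def
  by (subst det_def'[OF mat_carrier])
    (auto intro!: sum.cong prod.cong dest: permutes_in_image)

lemma continuous_on_row_minor: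
  assumes "continuous_on S f" shows "continuous_on S (\<lambda>x. row_minor (f x) xs)"
  unfolding row_minor_leibniz by (intro continuous_intros assms)

lemma continuous_on_left_minor: "continuous_on S (\<lambda>A. left_minor A I)"
  unfolding left_minor_row_minor by (intro continuous_on_row_minor continuous_on_id)

lemma row_minor_Reals:
  assumes "\<And>i j. A $ i $ j \<in> \<real>" shows "row_minor A xs \<in> \<real>"
  unfolding row_minor_leibniz
  by (intro sum_in_Reals Reals_mult prod_in_Reals assms) (auto simp: sign_def)

text \<open>The product rule differentiates one row at a time, and the derivative of a row of
  \<open>M\<close> is a combination of rows of \<open>M\<close> with coefficients from
  \<open>A\<close>.\<close>

lemma row_minor_deriv:
  assumes "(M has_vector_derivative A ** M t) (at t)"
  shows "((\<lambda>t. row_minor (M t) xs) has_vector_derivative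
    (\<Sum>a<length xs. \<Sum>y\<in>UNIV. A $ (xs ! a) $ y * row_minor (M t) (xs[a := y]))) (at t)"
proof -
  define k where "k = length xs"
  define P where "P = {p. p permutes {0..<k}}"
  have entry: "((\<lambda>t. M t $ x $ j) has_derivative (\<lambda>h. h *\<^sub>R (\<Sum>y\<in>UNIV. A $ x $ y * M t $ y $ j)))
      (at t)" for x j
    using has_vector_derivative_vec_nth[OF has_vector_derivative_vec_nth[OF assms], of x j]
    by (simp add: matrix_mult_nth has_vector_derivative_def)
  have "((\<lambda>t. row_minor (M t) xs) has_derivative
     (\<lambda>h. \<Sum>p\<in>P. signof p * (\<Sum>a=0..<k. h *\<^sub>R (\<Sum>y\<in>UNIV. A $ (xs ! a) $ y * M t $ y $ col_of (p a)) *
        (\<Prod>i\<in>{0..<k} - {a}. M t $ (xs ! i) $ col_of (p i))))) (at t)"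
    unfolding row_minor_leibniz k_def P_def
    by (intro has_derivative_sum has_derivative_mult_right has_derivative_prod entry)
  moreover have "(\<Sum>p\<in>P. signof p * (\<Sum>a=0..<k. h *\<^sub>R (\<Sum>y\<in>UNIV. A $ (xs ! a) $ y * M t $ y $ col_of (p a)) *
        (\<Prod>i\<in>{0..<k} - {a}. M t $ (xs ! i) $ col_of (p i)))) =
     h *\<^sub>R (\<Sum>a<k. \<Sum>y\<in>UNIV. A $ (xs ! a) $ y * row_minor (M t) (xs[a := y]))" for h
  proof -
    have upd: "row_minor (M t) (xs[a := y]) = (\<Sum>p\<in>P. signof p * (M t $ y $ col_of (p a) *
        (\<Prod>i\<in>{0..<k} - {a}. M t $ (xs ! i) $ col_of (p i))))" if "a < k" for a y
    proof -
      have "(\<Prod>i = 0..<k. M t $ (xs[a := y] ! i) $ col_of (p i)) = M t $ y $ col_of (p a) *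
        (\<Prod>i\<in>{0..<k} - {a}. M t $ (xs ! i) $ col_of (p i))" for p
        using that by (subst prod.remove[of _ a]) (auto simp: k_def intro!: prod.cong)
      then show ?thesis
        by (simp add: row_minor_leibniz P_def k_def)
    qed
    have "(\<Sum>a<k. \<Sum>y\<in>UNIV. A $ (xs ! a) $ y * row_minor (M t) (xs[a := y])) =
      (\<Sum>a<k. \<Sum>y\<in>UNIV. A $ (xs ! a) $ y * (\<Sum>p\<in>P. signof p * (M t $ y $ col_of (p a) *
        (\<Prod>i\<in>{0..<k} - {a}. M t $ (xs ! i) $ col_of (p i)))))"
      by (intro sum.cong refl) (simp add: upd)
    also have "\<dots> = (\<Sum>a<k. \<Sum>p\<in>P. \<Sum>y\<in>UNIV. A $ (xs ! a) $ y * (signof p * (M t $ y $ col_of (p a) *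
        (\<Prod>i\<in>{0..<k} - {a}. M t $ (xs ! i) $ col_of (p i)))))"
      unfolding sum_distrib_left by (intro sum.cong refl, subst sum.swap, rule refl)
    also have "\<dots> = (\<Sum>p\<in>P. \<Sum>a<k. \<Sum>y\<in>UNIV. A $ (xs ! a) $ y * (signof p * (M t $ y $ col_of (p a) *
        (\<Prod>i\<in>{0..<k} - {a}. M t $ (xs ! i) $ col_of (p i)))))"
      by (rule sum.swap)
    finally show ?thesis
      by (simp only: scaleR_conv_of_real sum_distrib_left sum_distrib_right lessThan_atLeast0 mult_ac)
  qed
  ultimately show ?thesis
    by (simp add: has_vector_derivative_def k_def)
qed

lemma row_minor_swap:
  assumes "Suc a < length xs"
  shows "row_minor A (xs[a := xs ! Suc a, Suc a := xs ! a]) = - row_minor A xs"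
proof -
  let ?k = "length xs"
  let ?B = "Matrix.mat ?k ?k (\<lambda>(a, b). A $ (xs ! a) $ col_of b)"
  have "Matrix.mat ?k ?k (\<lambda>(i, b). A $ (xs[a := xs ! Suc a, Suc a := xs ! a] ! i) $ col_of b) =
      swaprows a (Suc a) ?B"
    using assms by (intro eq_matI) (auto simp: nth_list_update)
  moreover have "Determinant.det (swaprows a (Suc a) ?B) = - Determinant.det ?B"
    by (rule det_swaprows[OF _ _ _ mat_carrier]) (use assms in auto)
  ultimately show ?thesis
    by (simp add: row_minor_def)
qed

text \<open>Row \<open>i\<close> passes the rows of \<open>ys\<close> one by one, each time by an
  adjacent transposition. This is the source of the sign (-1)^b in the converse.\<close>

lemma row_minor_move:
  "row_minor A (xs @ ys @ i # zs) = (- 1) ^ length ys * row_minor A (xs @ i # ys @ zs)"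
proof (induction ys arbitrary: xs)
  case (Cons y ys)
  have "row_minor A (xs @ (y # ys) @ i # zs) = (- 1) ^ length ys * row_minor A ((xs @ [y]) @ i # ys @ zs)"
    using Cons[of "xs @ [y]"] by simp
  also have "row_minor A ((xs @ [y]) @ i # ys @ zs) = - row_minor A (xs @ i # (y # ys) @ zs)"
    using row_minor_swap[of "length xs" "xs @ i # (y # ys) @ zs" A]
    by (simp add: nth_append list_update_append)
  finally show ?case by simp
qed simp

lemma row_minor_not_distinct:
  assumes "\<not> distinct xs" shows "row_minor A xs = 0"
proof -
  obtain a b where ab: "a < length xs" "b < length xs" "a \<noteq> b" "xs ! a = xs ! b"
    using assms by (auto simp: distinct_conv_nth)
  show ?thesis
    unfolding row_minor_def
    by (rule Determinant.det_identical_rows[OF mat_carrier ab(3) ab(1,2)]) (use ab in \<open>auto intro!: eq_vecI\<close>)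
qed

lemma row_minor_eq_0I:
  assumes "\<And>p. p permutes {0..<length xs} \<Longrightarrow> \<exists>a<length xs. A $ (xs ! a) $ col_of (p a) = 0"
  shows "row_minor A xs = 0"
proof -
  have "signof p * (\<Prod>i = 0..<length xs. A $ (xs ! i) $ col_of (p i)) = 0"
    if "p permutes {0..<length xs}" for p
    using assms[OF that] by (auto intro!: prod_zero)
  then show ?thesis
    unfolding row_minor_leibniz by (intro sum.neutral) auto
qed

lemma row_minor_eq_0_row:
  assumes "x \<in> set xs" "\<And>b. b < length xs \<Longrightarrow> A $ x $ col_of b = 0"
  shows "row_minor A xs = 0"
proof (rule row_minor_eq_0I)
  fix p assume p: "p permutes {0..<length xs}"
  obtain a where a: "a < length xs" "xs ! a = x"
    using assms(1) by (metis in_set_conv_nth)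
  moreover have "p a < length xs"
    using permutes_in_image[OF p, of a] a by simp
  ultimately show "\<exists>a<length xs. A $ (xs ! a) $ col_of (p a) = 0"
    using assms(2) by blast
qed

text \<open>The first \<open>k\<close> columns are supported on the rows in \<open>K\<close>, and
  fewer than \<open>k\<close> of these are listed. In each Leibniz term these columns use
  \<open>k\<close> distinct rows, so one of them lies outside \<open>K\<close>; \<open>pi\<close>
  sends a column to its row.\<close>

lemma row_minor_eq_0_cols:
  assumes dist: "distinct xs" and k: "k \<le> length xs" "card (K \<inter> set xs) < k"
    and A: "\<And>x b. x \<in> set xs - K \<Longrightarrow> b < k \<Longrightarrow> A $ x $ col_of b = 0"
  shows "row_minor A xs = 0"
proof (rule row_minor_eq_0I)
  fix p assume p: "p permutes {0..<length xs}"
  define pi where "pi = Hilbert_Choice.inv p"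
  define f where "f b = xs ! pi b" for b
  have pi_less: "pi b < length xs" if "b < k" for b
    using permutes_in_image[OF permutes_inv[OF p], of b] k(1) that by (simp add: pi_def)
  have "inj_on f {..<k}"
  proof (rule inj_onI)
    fix b c assume bc: "b \<in> {..<k}" "c \<in> {..<k}" "f b = f c"
    then have "pi b = pi c"
      using pi_less[of b] pi_less[of c] nth_eq_iff_index_eq[OF dist, of "pi b" "pi c"]
      by (simp add: f_def)
    then show "b = c"
      unfolding pi_def using permutes_inv_eq[OF p] by metis
  qed
  moreover have f_in: "f b \<in> set xs" if "b < k" for b
    using pi_less[OF that] by (simp add: f_def)
  ultimately have "\<not> (\<forall>b<k. f b \<in> K)"
    using card_inj_on_le[of f "{..<k}" "K \<inter> set xs"] k(2) by fastforce
  then obtain b where b: "b < k" "f b \<notin> K" by blast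
  have "A $ (xs ! pi b) $ col_of (p (pi b)) = 0"
    using A[of "f b" b] b f_in permutes_inverses(1)[OF p, of b] by (simp add: f_def pi_def)
  then show "\<exists>a<length xs. A $ (xs ! a) $ col_of (p a) = 0"
    using pi_less b(1) by blast
qed

definition upper_tri :: "'n::{finite,linorder} cmat \<Rightarrow> bool" where
  "upper_tri c \<longleftrightarrow> (\<forall>i j. j < i \<longrightarrow> c $ i $ j = 0)"

text \<open>The leading columns of \<open>A ** c\<close> combine only leading columns of
  \<open>A\<close>, so the square submatrix factors and the determinant is multiplicative.\<close>

lemma row_minor_mult_upper_tri:
  fixes A c :: "'n::{finite,linorder} cmat"
  assumes c: "upper_tri c" and k: "length xs \<le> CARD('n)"
  shows "row_minor (A ** c) xs = row_minor A xs * (\<Prod>b<length xs. c $ col_of b $ col_of b)"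
proof -
  let ?k = "length xs"
  let ?A = "Matrix.mat ?k ?k (\<lambda>(a, b). A $ (xs ! a) $ col_of b)"
  let ?C = "Matrix.mat ?k ?k (\<lambda>(a, b). c $ col_of a $ col_of b)"
  have "(A ** c) $ x $ col_of b = (\<Sum>j = 0..<?k. A $ x $ col_of j * c $ col_of j $ col_of b)"
    if "b < ?k" for x b
    unfolding matrix_mult_nth sum_col_of
    using that k c by (intro sum.mono_neutral_right) (auto simp: upper_tri_def col_of_less_iff)
  then have "Matrix.mat ?k ?k (\<lambda>(a, b). (A ** c) $ (xs ! a) $ col_of b) = ?A * ?C"
    by (intro eq_matI) (auto simp: Matrix.scalar_prod_def)
  moreover have "Determinant.det (?A * ?C) = Determinant.det ?A * Determinant.det ?C"
    by (rule det_mult) auto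
  moreover have "Determinant.det ?C = (\<Prod>b<?k. c $ col_of b $ col_of b)"
  proof -
    have "upper_triangular ?C"
      using k c by (auto simp: upper_triangular_def upper_tri_def col_of_less_iff)
    then have "Determinant.det ?C = prod_list (diag_mat ?C)"
      by (rule det_upper_triangular) auto
    also have "\<dots> = (\<Prod>b<?k. c $ col_of b $ col_of b)"
      by (simp add: diag_mat_def prod.distinct_set_conv_list[symmetric] lessThan_atLeast0 cong: map_cong)
    finally show ?thesis .
  qed
  ultimately show ?thesis
    by (simp add: row_minor_def)
qed

lemma left_minor_mult_upper_tri:
  fixes A c :: "'n::{finite,linorder} cmat"
  assumes "upper_tri c"
  shows "left_minor (A ** c) I = left_minor A I * (\<Prod>b<card I. c $ col_of b $ col_of b)"
  using row_minor_mult_upper_tri[OF assms, of "sorted_list_of_set I" A] card_mono[of UNIV I]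
  by (simp add: left_minor_row_minor)

lemma left_minor_UNIV_nonzero:
  fixes A :: "'n::{finite,linorder} cmat"
  assumes "A ** B = mat 1"
  shows "left_minor A UNIV \<noteq> 0"
proof -
  let ?n = "CARD('n)"
  let ?m = "\<lambda>X :: 'n cmat. Matrix.mat ?n ?n (\<lambda>(a, b). X $ col_of a $ col_of b)"
  have "?m A * ?m B = ?m (A ** B)"
    by (intro eq_matI) (auto simp: Matrix.scalar_prod_def matrix_mult_nth sum_col_of lessThan_atLeast0)
  also have "\<dots> = 1\<^sub>m ?n"
    by (intro eq_matI) (auto simp: assms mat_def col_of_eq_iff)
  finally have "Determinant.det (?m A) * Determinant.det (?m B) = 1"
    using det_mult[of "?m A" ?n "?m B"] by simp
  then show ?thesis
    by (auto simp: left_minor_def col_of_def)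
qed

lemma sorted_list_of_set_eqI:
  assumes "sorted_wrt (<) xs" "set xs = I" shows "sorted_list_of_set I = xs"
  using sorted_list_of_set.idem_if_sorted_distinct[of xs] assms strict_sorted_iff by blast

text \<open>In the Laplace expansion along the last column, the cofactors are, up to sign,
  left-justified minors with one row fewer. They cannot all vanish.\<close>

lemma left_minor_remove:
  fixes A :: "'n::{finite,linorder} cmat"
  assumes "left_minor A S \<noteq> 0" "S \<noteq> {}"
  obtains p where "p \<in> S" "left_minor A (S - {p}) \<noteq> 0"
proof -
  let ?xs = "sorted_list_of_set S"
  let ?k = "length ?xs"
  let ?B = "Matrix.mat ?k ?k (\<lambda>(a, b). A $ (?xs ! a) $ col_of b)"
  have k: "?k - 1 < ?k"
    using assms(2) by (simp add: card_gt_0_iff)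
  have "Determinant.det ?B \<noteq> 0"
    using assms(1) by (simp add: left_minor_row_minor row_minor_def)
  then have "(\<Sum>i<?k. ?B $$ (i, ?k - 1) * cofactor ?B i (?k - 1)) \<noteq> 0"
    using laplace_expansion_column[OF mat_carrier k, of "\<lambda>(a, b). A $ (?xs ! a) $ col_of b"] by simp
  then obtain a where a: "a < ?k" "cofactor ?B a (?k - 1) \<noteq> 0"
    by (metis (no_types, lifting) lessThan_iff mult_zero_right sum.neutral)
  let ?p = "?xs ! a"
  let ?ys = "take a ?xs @ drop (Suc a) ?xs"
  have xs: "take a ?xs @ ?p # drop (Suc a) ?xs = ?xs"
    using a(1) by (rule id_take_nth_drop[symmetric])
  have ys: "?ys = sorted_list_of_set (S - {?p})"
  proof -
    have "sorted_wrt (<) (take a ?xs @ ?p # drop (Suc a) ?xs)"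
      unfolding xs by (rule strict_sorted_list_of_set)
    then have "sorted_wrt (<) ?ys" and notin: "?p \<notin> set ?ys"
      by (auto simp: sorted_wrt_append)
    moreover have "insert ?p (set ?ys) = S"
      using arg_cong[OF xs, of set] by simp
    then have "set ?ys = S - {?p}"
      using notin by blast
    ultimately show ?thesis
      by (intro sorted_list_of_set_eqI[symmetric]) simp_all
  qed
  have len: "length ?ys = ?k - 1"
    using a(1) by simp
  have "mat_delete ?B a (?k - 1) = Matrix.mat (?k - 1) (?k - 1) (\<lambda>(i, b). A $ (?ys ! i) $ col_of b)"
    unfolding mat_delete_def using a(1) by (intro eq_matI) (auto simp: nth_append)
  then have "Determinant.det (mat_delete ?B a (?k - 1)) = row_minor A ?ys"
    unfolding row_minor_def len by simp
  then have "left_minor A (S - {?p}) \<noteq> 0"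
    using a(2) by (simp add: cofactor_def left_minor_row_minor ys)
  moreover have "?p \<in> S"
    using a(1) nth_mem[of a ?xs] by simp
  ultimately show ?thesis
    using that by blast
qed

text \<open>Downward induction from the full minor, which is nonzero by invertibility, removing one
  row at a time.\<close>

lemma left_minor_nonzero_exists:
  fixes A :: "'n::{finite,linorder} cmat"
  assumes "A ** B = mat 1" "k \<le> CARD('n)"
  obtains S where "card S = k" "left_minor A S \<noteq> 0"
proof -
  have "\<exists>S. card S = k \<and> left_minor A S \<noteq> 0"
    using assms(2)
  proof (induction rule: inc_induct)
    case base
    then show ?case using left_minor_UNIV_nonzero[OF assms(1)] by blast
  next
    case (step m)
    then obtain S where S: "card S = Suc m" "left_minor A S \<noteq> 0" by blast
    then obtain p where "p \<in> S" "left_minor A (S - {p}) \<noteq> 0"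
      using left_minor_remove[of A S] by (metis card.empty nat.distinct(1))
    then show ?case using S by (intro exI[of _ "S - {p}"]) simp
  qed
  then show ?thesis using that by blast
qed

subsection \<open>Positivity of linear systems\<close>

primrec matvec_iter :: "('k::finite \<Rightarrow> 'k \<Rightarrow> real) \<Rightarrow> nat \<Rightarrow> ('k \<Rightarrow> real) \<Rightarrow> 'k \<Rightarrow> real" where
  "matvec_iter B 0 v = v"
| "matvec_iter B (Suc m) v = (\<lambda>i. \<Sum>j\<in>UNIV. B i j * matvec_iter B m v j)"

text \<open>Every solution is the sum of its Taylor series, whose coefficients are the iterates of
  \<open>B\<close> on the initial value. The Lagrange remainder is at most (C |t|)^n R' / n!.
  Uniqueness for linear systems is thereby included.\<close>

lemma linear_ode_sums:
  fixes B :: "'k::finite \<Rightarrow> 'k \<Rightarrow> real" and z :: "real \<Rightarrow> 'k \<Rightarrow> real"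
  assumes deriv: "\<And>t i. ((\<lambda>t. z t i) has_real_derivative (\<Sum>j\<in>UNIV. B i j * z t j)) (at t)"
  shows "(\<lambda>m. matvec_iter B m (z 0) i / fact m * t ^ m) sums z t i"
proof -
  define C where "C = (\<Sum>i\<in>UNIV. \<Sum>j\<in>UNIV. \<bar>B i j\<bar>)"
  have row: "(\<Sum>j\<in>UNIV. \<bar>B i j\<bar>) \<le> C" for i
    unfolding C_def by (rule member_le_sum) (auto intro: sum_nonneg)
  have C0: "C \<ge> 0"
    unfolding C_def by (intro sum_nonneg) auto
  have bound: "\<bar>matvec_iter B m v i\<bar> \<le> C ^ m * R" if R: "\<And>j. \<bar>v j\<bar> \<le> R" for v R m i
  proof (induction m arbitrary: i)
    case 0
    then show ?case using R by simp
  next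
    case (Suc m)
    have R0: "R \<ge> 0" using R[of i] by linarith
    have "\<bar>matvec_iter B (Suc m) v i\<bar> \<le> (\<Sum>j\<in>UNIV. \<bar>B i j * matvec_iter B m v j\<bar>)"
      unfolding matvec_iter.simps by (rule sum_abs)
    also have "\<dots> \<le> (\<Sum>j\<in>UNIV. \<bar>B i j\<bar> * (C ^ m * R))"
      by (intro sum_mono) (simp add: abs_mult mult_left_mono Suc)
    also have "\<dots> = (\<Sum>j\<in>UNIV. \<bar>B i j\<bar>) * (C ^ m * R)"
      by (simp add: sum_distrib_right)
    also have "\<dots> \<le> C * (C ^ m * R)"
      using row C0 R0 by (intro mult_right_mono) auto
    finally show ?case by (simp add: mult.assoc)
  qed
  have diff: "((\<lambda>s. matvec_iter B m (z s) i) has_real_derivative matvec_iter B (Suc m) (z s) i) (at s)"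
    for m s i
  proof (induction m arbitrary: i)
    case 0
    then show ?case using deriv by simp
  next
    case (Suc m)
    have "((\<lambda>s. \<Sum>j\<in>UNIV. B i j * matvec_iter B m (z s) j) has_real_derivative
        (\<Sum>j\<in>UNIV. B i j * matvec_iter B (Suc m) (z s) j)) (at s)"
      by (intro DERIV_sum DERIV_cmult Suc)
    then show ?case by (simp only: matvec_iter.simps)
  qed
  have "\<exists>R. \<forall>s\<in>{-\<bar>t\<bar>..\<bar>t\<bar>}. \<bar>z s j\<bar> \<le> R" for j
  proof -
    have "compact ((\<lambda>s. z s j) ` {-\<bar>t\<bar>..\<bar>t\<bar>})"
      by (intro compact_continuous_image compact_Icc continuous_at_imp_continuous_on ballI
          DERIV_isCont[OF deriv])
    then have "bounded ((\<lambda>s. z s j) ` {-\<bar>t\<bar>..\<bar>t\<bar>})"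
      by (rule compact_imp_bounded)
    then show ?thesis
      by (auto simp: bounded_iff)
  qed
  then obtain R where R: "\<And>j s. s \<in> {-\<bar>t\<bar>..\<bar>t\<bar>} \<Longrightarrow> \<bar>z s j\<bar> \<le> R j"
    by metis
  \<comment> \<open>The point in the Lagrange remainder is unknown, so one bound has to hold for all
    components on the whole interval between -|t| and |t|.\<close>
  define R' where "R' = (\<Sum>j\<in>UNIV. \<bar>R j\<bar>)"
  have R': "\<bar>z s j\<bar> \<le> R'" if "\<bar>s\<bar> \<le> \<bar>t\<bar>" for s j
  proof -
    have "\<bar>z s j\<bar> \<le> \<bar>R j\<bar>" using R[of s j] that by (auto simp: abs_le_iff)
    also have "\<dots> \<le> R'" unfolding R'_def by (rule member_le_sum) auto
    finally show ?thesis .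
  qed
  define f where "f n = (\<Sum>m<n. matvec_iter B m (z 0) i / fact m * t ^ m)" for n
  have rem: "\<bar>f n - z t i\<bar> \<le> inverse (fact n) * (C * \<bar>t\<bar>) ^ n * R'" for n
  proof -
    obtain s where s: "\<bar>s\<bar> \<le> \<bar>t\<bar>"
      "z t i = f n + matvec_iter B n (z s) i / fact n * t ^ n"
      using Maclaurin_all_le[of "\<lambda>m s. matvec_iter B m (z s) i" "\<lambda>s. z s i" t n] diff
      unfolding f_def by auto
    have "\<bar>f n - z t i\<bar> = \<bar>matvec_iter B n (z s) i\<bar> * (inverse (fact n) * \<bar>t\<bar> ^ n)"
      using s(2) by (simp add: abs_mult power_abs divide_inverse mult_ac)
    also have "\<dots> \<le> (C ^ n * R') * (inverse (fact n) * \<bar>t\<bar> ^ n)"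
      by (intro mult_right_mono bound R' s(1)) auto
    finally show ?thesis by (simp add: power_mult_distrib mult_ac)
  qed
  have "(\<lambda>n. inverse (fact n) * (C * \<bar>t\<bar>) ^ n) \<longlonglongrightarrow> 0"
    by (rule summable_LIMSEQ_zero[OF summable_exp])
  then have "(\<lambda>n. inverse (fact n) * (C * \<bar>t\<bar>) ^ n * R') \<longlonglongrightarrow> 0"
    by (rule tendsto_mult_left_zero)
  then have "(\<lambda>n. f n - z t i) \<longlonglongrightarrow> 0"
    by (rule Lim_null_comparison[rotated]) (simp add: rem)
  then show ?thesis
    unfolding sums_def f_def by (rule LIM_zero_cancel)
qed

text \<open>All Taylor coefficients are nonnegative, and a path of length \<open>m\<close> from
  \<open>i\<close> to \<open>j\<close> makes the coefficient of order \<open>m\<close>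
  positive.\<close>

lemma nonneg_linear_ode:
  fixes B :: "'k::finite \<Rightarrow> 'k \<Rightarrow> real" and z :: "real \<Rightarrow> 'k \<Rightarrow> real"
  assumes deriv: "\<And>t i. ((\<lambda>t. z t i) has_real_derivative (\<Sum>j\<in>UNIV. B i j * z t j)) (at t)"
    and B: "\<And>i j. 0 \<le> B i j" and z0: "\<And>i. 0 \<le> z 0 i" and t: "0 < t"
    and j: "0 < z 0 j" and ij: "(i, j) \<in> {(i, j). 0 < B i j}\<^sup>*"
  shows "0 < z t i"
proof -
  have it: "0 \<le> matvec_iter B m (z 0) i" for m i
    by (induction m arbitrary: i) (auto intro!: sum_nonneg mult_nonneg_nonneg B z0)
  have sums: "(\<lambda>m. matvec_iter B m (z 0) i / fact m * t ^ m) sums z t i" for i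
    by (rule linear_ode_sums[OF deriv])
  have pos: "0 < z t i" if "0 < matvec_iter B m (z 0) i" for m i
  proof -
    have "0 < matvec_iter B m (z 0) i / fact m * t ^ m"
      using that t by simp
    also have "\<dots> = (\<Sum>k\<in>{m}. matvec_iter B k (z 0) i / fact k * t ^ k)"
      by simp
    also have "\<dots> \<le> z t i"
      by (rule sum_le_suminf[OF sums_summable[OF sums], of "{m}" i, folded sums_unique[OF sums]])
        (use it t in auto)
    finally show ?thesis .
  qed
  from ij have "\<exists>m. 0 < matvec_iter B m (z 0) i"
  proof (induction rule: converse_rtrancl_induct)
    case base
    then show ?case using j by (intro exI[of _ 0]) simp
  next
    case (step i k)
    then obtain m where "0 < matvec_iter B m (z 0) k" by blast
    then have "0 < B i k * matvec_iter B m (z 0) k"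
      using step by simp
    also have "\<dots> \<le> matvec_iter B (Suc m) (z 0) i"
      unfolding matvec_iter.simps
      by (rule member_le_sum[of k UNIV "\<lambda>k. B i k * matvec_iter B m (z 0) k"]) (auto intro!: mult_nonneg_nonneg B it)
    finally show ?case by blast
  qed
  then show "0 < z t i" using pos by blast
qed

text \<open>The components in \<open>S\<close> form a closed subsystem, so all their Taylor
  coefficients vanish. With \<open>S\<close> the whole index set this shows that minors stay real;
  with a proper subset it confines the flow of a decoupled matrix.\<close>

lemma zero_linear_ode:
  fixes B :: "'k::finite \<Rightarrow> 'k \<Rightarrow> real" and z :: "real \<Rightarrow> 'k \<Rightarrow> real"
  assumes deriv: "\<And>t i. ((\<lambda>t. z t i) has_real_derivative (\<Sum>j\<in>UNIV. B i j * z t j)) (at t)"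
    and S: "\<And>i j. i \<in> S \<Longrightarrow> j \<notin> S \<Longrightarrow> B i j = 0" and z0: "\<And>i. i \<in> S \<Longrightarrow> z 0 i = 0"
    and i: "i \<in> S"
  shows "z t i = 0"
proof -
  have "matvec_iter B m (z 0) i = 0" if "i \<in> S" for m i
    using that
  proof (induction m arbitrary: i)
    case (Suc m)
    have "B i j * matvec_iter B m (z 0) j = 0" for j
      using Suc.IH[of j] S[OF Suc.prems, of j] by (cases "j \<in> S") auto
    then show ?case unfolding matvec_iter.simps by (intro sum.neutral ballI)
  qed (simp add: z0)
  then show ?thesis
    using sums_unique2[OF linear_ode_sums[OF deriv, of i t]] i by simp
qed

text \<open>Off-diagonal nonnegativity suffices: the factor \<open>exp (c * t)\<close> shifts the diagonal by \<open>c\<close>.\<close>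

lemma metzler_linear_ode:
  fixes G :: "'k::finite \<Rightarrow> 'k \<Rightarrow> real" and z :: "real \<Rightarrow> 'k \<Rightarrow> real"
  assumes deriv: "\<And>t i. ((\<lambda>t. z t i) has_real_derivative (\<Sum>j\<in>UNIV. G i j * z t j)) (at t)"
    and G: "\<And>i j. i \<noteq> j \<Longrightarrow> 0 \<le> G i j" and z0: "\<And>i. 0 \<le> z 0 i" and t: "0 < t"
    and j: "0 < z 0 j" and ij: "(i, j) \<in> {(i, j). i \<noteq> j \<and> 0 < G i j}\<^sup>*"
  shows "0 < z t i"
proof -
  define c where "c = (\<Sum>i\<in>UNIV. \<bar>G i i\<bar>)"
  define B where "B i j = G i j + (if i = j then c else 0)" for i j
  have c: "\<bar>G i i\<bar> \<le> c" for i
    unfolding c_def by (rule member_le_sum) auto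
  have B0: "0 \<le> B i j" for i j
    using G[of i j] c[of i] by (auto simp: B_def abs_le_iff)
  have "((\<lambda>t. exp (c * t) * z t i) has_real_derivative (\<Sum>j\<in>UNIV. B i j * (exp (c * t) * z t j))) (at t)"
    for t i
  proof -
    have "B i j * w = G i j * w + (if i = j then c * w else 0)" for j w
      by (simp add: B_def distrib_right)
    then have "(\<Sum>j\<in>UNIV. B i j * (exp (c * t) * z t j)) =
        exp (c * t) * (\<Sum>j\<in>UNIV. G i j * z t j) + exp (c * t) * c * z t i"
      by (simp only: sum.distrib) (simp add: sum_distrib_left mult_ac)
    then show ?thesis
      by (auto intro!: derivative_eq_intros deriv)
  qed
  moreover have "(i, j) \<in> {(i, j). 0 < B i j}\<^sup>*"
    by (rule rtrancl_mono[THEN subsetD, OF _ ij]) (auto simp: B_def)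
  ultimately have "0 < exp (c * t) * z t i"
    using nonneg_linear_ode[of "\<lambda>t i. exp (c * t) * z t i" B t j i] B0 z0 t j by simp
  then show ?thesis by (simp add: zero_less_mult_iff)
qed

subsection \<open>Minors along the flow of a tridiagonal matrix\<close>

lemma adjacent_commute: "adjacent x y \<longleftrightarrow> adjacent y x"
  by (auto simp: adjacent_def)

lemma adjacent_order:
  assumes "adjacent x y" "z \<noteq> x" "z \<noteq> y" shows "z < x \<longleftrightarrow> z < y" "x < z \<longleftrightarrow> y < z"
proof -
  have "\<not> (x < z \<and> z < y)" "\<not> (y < z \<and> z < x)"
    using assms(1) by (auto simp: adjacent_def)
  then show "z < x \<longleftrightarrow> z < y" "x < z \<longleftrightarrow> y < z"
    using assms(2,3) by (auto simp: neq_iff dest: order.strict_trans)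
qed

text \<open>No index lies between adjacent ones, so the replacement keeps the list sorted and
  produces no sign. This is where tridiagonality yields nonnegative coefficients.\<close>

lemma left_minor_replace_adjacent:
  fixes I :: "'n::{finite,linorder} set"
  assumes "a < length (sorted_list_of_set I)" "adjacent (sorted_list_of_set I ! a) y" "y \<notin> I"
  shows "row_minor M ((sorted_list_of_set I)[a := y]) = left_minor M (insert y (I - {sorted_list_of_set I ! a}))"
proof -
  let ?xs = "sorted_list_of_set I"
  have "sorted_wrt (<) (?xs[a := y])"
    unfolding sorted_wrt_iff_nth_less
  proof (intro allI impI)
    fix i j assume ij: "i < j" "j < length (?xs[a := y])"
    have lt: "?xs ! i < ?xs ! j"
      using ij by (intro sorted_wrt_nth_less[OF strict_sorted_list_of_set]) auto
    have "?xs ! i \<in> I" "?xs ! j \<in> I"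
      using ij nth_mem[of i ?xs] nth_mem[of j ?xs] by auto
    then have "?xs ! i \<noteq> y" "?xs ! j \<noteq> y"
      using assms(3) by auto
    consider "i = a" | "j = a" | "i \<noteq> a" "j \<noteq> a" by blast
    then show "?xs[a := y] ! i < ?xs[a := y] ! j"
    proof cases
      case 1
      then show ?thesis
        using lt ij assms(1) adjacent_order(2)[OF assms(2), of "?xs ! j"] \<open>?xs ! j \<noteq> y\<close> by simp
    next
      case 2
      then show ?thesis
        using lt ij assms(1) adjacent_order(1)[OF assms(2), of "?xs ! i"] \<open>?xs ! i \<noteq> y\<close> by simp
    qed (use lt in simp)
  qed
  moreover have "set (?xs[a := y]) = insert y (I - {?xs ! a})"
    using assms(1) by (simp add: set_update_distinct)
  ultimately have "sorted_list_of_set (insert y (I - {?xs ! a})) = ?xs[a := y]"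
    by (rule sorted_list_of_set_eqI)
  then show ?thesis
    by (simp only: left_minor_row_minor)
qed

text \<open>The additive compound of \<open>A\<close>, which generates the induced flow on left-justified minors.\<close>

definition compound_gen :: "'n::{finite,linorder} cmat \<Rightarrow> 'n set \<Rightarrow> 'n set \<Rightarrow> real" where
  "compound_gen A I J = (\<Sum>x\<in>I. \<Sum>y\<in>- (I - {x}). if J = insert y (I - {x}) then Re (A $ x $ y) else 0)"

text \<open>Among the row replacements, one by a row already present gives a repeated row and one by
  a nonadjacent new row has coefficient zero. The remaining ones keep the list sorted.\<close>

lemma left_minor_deriv:
  fixes M :: "real \<Rightarrow> 'n::{finite,linorder} cmat"
  assumes M: "(M has_vector_derivative A ** M t) (at t)" and A: "real_tridiagonal A"
  shows "((\<lambda>t. left_minor (M t) I) has_vector_derivative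
    (\<Sum>J\<in>UNIV. of_real (compound_gen A I J) * left_minor (M t) J)) (at t)"
proof -
  let ?xs = "sorted_list_of_set I"
  have row_sum: "(\<Sum>y\<in>UNIV. A $ x $ y * row_minor (M t) (?xs[a := y])) =
     (\<Sum>y\<in>- (I - {x}). of_real (Re (A $ x $ y)) * left_minor (M t) (insert y (I - {x})))"
    if a: "a < length ?xs" "x = ?xs ! a" for a x
  proof -
    have x: "x \<in> I" using nth_mem[OF a(1)] a(2) by simp
    have "(\<Sum>y\<in>UNIV. A $ x $ y * row_minor (M t) (?xs[a := y])) =
       (\<Sum>y\<in>- (I - {x}). A $ x $ y * row_minor (M t) (?xs[a := y]))"
    proof (rule sum.mono_neutral_right)
      show "\<forall>y\<in>UNIV - - (I - {x}). A $ x $ y * row_minor (M t) (?xs[a := y]) = 0"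
      proof
        fix y assume "y \<in> UNIV - - (I - {x})"
        then have y: "y \<in> I" "y \<noteq> x" by auto
        then obtain b where b: "b < length ?xs" "?xs ! b = y"
          by (metis finite set_sorted_list_of_set in_set_conv_nth)
        then have "a \<noteq> b" "?xs[a := y] ! a = ?xs[a := y] ! b"
          using a y b by (auto simp: nth_list_update)
        then have "\<not> distinct (?xs[a := y])"
          using nth_eq_iff_index_eq[of "?xs[a := y]" a b] a(1) b(1) by auto
        then show "A $ x $ y * row_minor (M t) (?xs[a := y]) = 0"
          by (simp add: row_minor_not_distinct)
      qed
    qed auto
    also have "\<dots> = (\<Sum>y\<in>- (I - {x}). of_real (Re (A $ x $ y)) * left_minor (M t) (insert y (I - {x})))"
    proof (rule sum.cong[OF refl])
      fix y assume y: "y \<in> - (I - {x})"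
      have real: "of_real (Re (A $ x $ y)) = A $ x $ y"
        using A by (simp add: real_tridiagonal_def)
      consider "y = x" | "y \<noteq> x" "adjacent x y" | "y \<noteq> x" "\<not> adjacent x y" by blast
      then show "A $ x $ y * row_minor (M t) (?xs[a := y]) =
          of_real (Re (A $ x $ y)) * left_minor (M t) (insert y (I - {x}))"
      proof cases
        case 1
        then show ?thesis unfolding real using a x by (simp add: left_minor_row_minor insert_absorb)
      next
        case 2
        then show ?thesis using left_minor_replace_adjacent[OF a(1), of y "M t"] a y real by auto
      next
        case 3
        then show ?thesis using A by (simp add: real_tridiagonal_def)
      qed
    qed
    finally show ?thesis .
  qed
  have "(\<Sum>a<length ?xs. \<Sum>y\<in>UNIV. A $ (?xs ! a) $ y * row_minor (M t) (?xs[a := y])) =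
      (\<Sum>a<length ?xs. \<Sum>y\<in>- (I - {?xs ! a}).
        of_real (Re (A $ (?xs ! a) $ y)) * left_minor (M t) (insert y (I - {?xs ! a})))"
    by (intro sum.cong refl row_sum) auto
  also have "\<dots> = (\<Sum>x\<in>I. \<Sum>y\<in>- (I - {x}). of_real (Re (A $ x $ y)) * left_minor (M t) (insert y (I - {x})))"
  proof (rule sum.reindex_bij_betw)
    show "bij_betw ((!) ?xs) {..<length ?xs} I"
      by (rule bij_betw_nth) auto
  qed
  \<comment> \<open>An artificial sum over all \<open>J\<close> with a single nonzero term;
    exchanging the sums collects the coefficient of each minor.\<close>
  also have "\<dots> = (\<Sum>x\<in>I. \<Sum>y\<in>- (I - {x}). \<Sum>J\<in>UNIV.
      (if J = insert y (I - {x}) then of_real (Re (A $ x $ y)) * left_minor (M t) J else 0))"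
    by simp
  also have "\<dots> = (\<Sum>x\<in>I. \<Sum>J\<in>UNIV. \<Sum>y\<in>- (I - {x}).
      (if J = insert y (I - {x}) then of_real (Re (A $ x $ y)) * left_minor (M t) J else 0))"
    by (intro sum.cong refl sum.swap)
  also have "\<dots> = (\<Sum>J\<in>UNIV. \<Sum>x\<in>I. \<Sum>y\<in>- (I - {x}).
      (if J = insert y (I - {x}) then of_real (Re (A $ x $ y)) * left_minor (M t) J else 0))"
    by (rule sum.swap)
  also have "\<dots> = (\<Sum>J\<in>UNIV. of_real (compound_gen A I J) * left_minor (M t) J)"
    unfolding compound_gen_def of_real_sum sum_distrib_right by (intro sum.cong refl) simp
  finally show ?thesis
    using row_minor_deriv[OF M, of ?xs] by (simp add: left_minor_row_minor)
qed

lemma left_minor_deriv_Re_Im: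
  fixes M :: "real \<Rightarrow> 'n::{finite,linorder} cmat"
  assumes M: "(M has_vector_derivative A ** M t) (at t)" and A: "real_tridiagonal A"
  shows "((\<lambda>t. Re (left_minor (M t) I)) has_real_derivative
      (\<Sum>J\<in>UNIV. compound_gen A I J * Re (left_minor (M t) J))) (at t)"
    and "((\<lambda>t. Im (left_minor (M t) I)) has_real_derivative
      (\<Sum>J\<in>UNIV. compound_gen A I J * Im (left_minor (M t) J))) (at t)"
  using bounded_linear.has_vector_derivative[OF bounded_linear_Re left_minor_deriv[OF assms, of I]]
    bounded_linear.has_vector_derivative[OF bounded_linear_Im left_minor_deriv[OF assms, of I]]
  by (simp_all add: has_real_derivative_iff_has_vector_derivative)

text \<open>The condition that \<open>I\<close> and \<open>J\<close> differ removes the terms with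
  \<open>y = x\<close>, which carry diagonal entries of arbitrary sign.\<close>

lemma compound_gen_nonneg:
  assumes "\<And>x y. x \<noteq> y \<Longrightarrow> 0 \<le> Re (A $ x $ y)" "I \<noteq> J"
  shows "0 \<le> compound_gen A I J"
  unfolding compound_gen_def using assms(2)
  by (intro sum_nonneg) (auto intro!: assms(1) simp: insert_absorb)

lemma compound_gen_pos:
  assumes A: "\<And>x y. x \<noteq> y \<Longrightarrow> 0 \<le> Re (A $ x $ y)"
    and "x \<in> I" "y \<notin> I" "0 < Re (A $ x $ y)"
  shows "0 < compound_gen A I (insert y (I - {x}))"
proof -
  let ?J = "insert y (I - {x})"
  have IJ: "I \<noteq> ?J" using assms(3) by blast
  have nn: "0 \<le> (if ?J = insert v (I - {u}) then Re (A $ u $ v) else 0)" if "u \<in> I" for u v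
    using that IJ A[of u v] by (cases "u = v") (auto simp: insert_absorb)
  have "0 < (\<Sum>v\<in>- (I - {x}). if ?J = insert v (I - {x}) then Re (A $ x $ v) else 0)"
  proof (rule sum_pos2[of _ y])
    show "0 < (if ?J = insert y (I - {x}) then Re (A $ x $ y) else 0)"
      using assms(4) by simp
    show "y \<in> - (I - {x})" using assms(3) by blast
  qed (simp, rule nn[OF assms(2)])
  then show ?thesis
    unfolding compound_gen_def
    by (intro sum_pos2[OF finite assms(2)] sum_nonneg nn)
qed

section \<open>Connectivity of index sets of equal size under sliding moves\<close>

definition moves :: "('n::{finite,linorder} set \<times> 'n set) set" where
  "moves = {(I, insert y (I - {x})) | I x y. x \<in> I \<and> y \<notin> I \<and> adjacent x y}"

lemma moves_sym: "(I, J) \<in> moves \<Longrightarrow> (J, I) \<in> moves"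
proof -
  assume "(I, J) \<in> moves"
  then obtain x y where xy: "x \<in> I" "y \<notin> I" "adjacent x y" and J: "J = insert y (I - {x})"
    unfolding moves_def by blast
  have "adjacent y x" using xy(3) adjacent_commute by blast
  moreover have "y \<in> J" "x \<notin> J" "I = insert x (J - {y})" using xy J by auto
  ultimately show ?thesis
    unfolding moves_def by blast
qed

text \<open>Some element of \<open>I\<close> lies above a gap \<open>y\<close>. The least such
  element \<open>u\<close> has a free predecessor \<open>v\<close>, and sliding it down decreases
  the sum of positions.\<close>

lemma moves_to_down_closed:
  fixes I :: "'n::{finite,linorder} set"
  shows "\<exists>D. (I, D) \<in> moves\<^sup>* \<and> card D = card I \<and> (\<forall>x\<in>D. \<forall>y<x. y \<in> D)"
proof (induction "\<Sum>x\<in>I. card {..<x}" arbitrary: I rule: less_induct)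
  case less
  show ?case
  proof (cases "\<forall>x\<in>I. \<forall>y<x. y \<in> I")
    case False
    then obtain x y where xy: "x \<in> I" "y < x" "y \<notin> I" by blast
    define u where "u = Min {z \<in> I. y < z}"
    define v where "v = Max {..<u}"
    have "u \<in> {z \<in> I. y < z}"
      unfolding u_def by (rule Min_in) (use xy in auto)
    then have u: "u \<in> I" "y < u" by auto
    have umin: "u \<le> z" if "z \<in> I" "y < z" for z
      unfolding u_def using that by (intro Min_le) auto
    have "v \<in> {..<u}"
      unfolding v_def by (rule Max_in) (use u in auto)
    then have v: "v < u" by simp
    have vmax: "z \<le> v" if "z < u" for z
      unfolding v_def using that by (intro Max_ge) auto
    have "v \<notin> I"
      using umin[of v] v vmax[OF u(2)] xy(3) by (metis leD order_le_imp_less_or_eq)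
    have adj: "adjacent u v"
    proof -
      have "z \<notin> {v<..<u}" for z
        using vmax[of z] by auto
      then show ?thesis
        using v unfolding adjacent_def by blast
    qed
    let ?J = "insert v (I - {u})"
    have cJ: "card ?J = card I"
      using \<open>v \<notin> I\<close> card_Suc_Diff1[OF finite u(1)] by (subst card_insert_disjoint) auto
    have "card {..<v} < card {..<u}"
      using v by (intro psubset_card_mono) auto
    then have "(\<Sum>x\<in>?J. card {..<x}) < (\<Sum>x\<in>I. card {..<x})"
      using \<open>v \<notin> I\<close> sum.remove[OF finite u(1), of "\<lambda>x. card {..<x}"]
      by (subst sum.insert) auto
    from less[OF this] obtain D where
      "(?J, D) \<in> moves\<^sup>*" "card D = card ?J" "\<forall>x\<in>D. \<forall>y<x. y \<in> D" by blast
    moreover have "(I, ?J) \<in> moves"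
      unfolding moves_def using u(1) \<open>v \<notin> I\<close> adj by blast
    ultimately show ?thesis
      using cJ converse_rtrancl_into_rtrancl by (intro exI[of _ D] conjI) auto
  qed blast
qed

text \<open>Down-closed sets are nested, so their size determines them; both sets can be moved to
  the same one, and moves are reversible.\<close>

lemma moves_connected:
  fixes I J :: "'n::{finite,linorder} set"
  assumes "card I = card J"
  shows "(I, J) \<in> moves\<^sup>*"
proof -
  obtain D where D: "(I, D) \<in> moves\<^sup>*" "card D = card I" "\<forall>x\<in>D. \<forall>y<x. y \<in> D"
    using moves_to_down_closed by blast
  obtain E where E: "(J, E) \<in> moves\<^sup>*" "card E = card J" "\<forall>x\<in>E. \<forall>y<x. y \<in> E"
    using moves_to_down_closed by blast
  have "D \<subseteq> E \<or> E \<subseteq> D"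
  proof (rule ccontr)
    assume "\<not> (D \<subseteq> E \<or> E \<subseteq> D)"
    then obtain a b where ab: "a \<in> D" "a \<notin> E" "b \<in> E" "b \<notin> D" by blast
    then show False
      using D(3) E(3) by (cases a b rule: linorder_cases) auto
  qed
  then have "D = E"
    using card_subset_eq[of E D] card_subset_eq[of D E] D(2) E(2) assms by auto
  moreover have "sym (moves\<^sup>*)"
    by (rule sym_rtrancl) (auto simp: sym_def moves_sym)
  ultimately show ?thesis
    using D(1) E(1) rtrancl_trans[of I D moves J] symD[of "moves\<^sup>*" J D] by blast
qed

definition tri_positive :: "'n::{finite,linorder} cmat \<Rightarrow> bool" where
  "tri_positive A \<longleftrightarrow> real_tridiagonal A \<and> (\<forall>i j. adjacent i j \<longrightarrow> 0 < Re (A $ i $ j))"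

lemma left_minor_flow_positive:
  fixes M :: "real \<Rightarrow> 'n::{finite,linorder} cmat"
  assumes M: "\<And>t. (M has_vector_derivative A ** M t) (at t)" and A: "tri_positive A"
    and inv: "M 0 ** B = mat 1"
    and nn: "\<And>I. left_minor (M 0) I \<in> \<real> \<and> 0 \<le> Re (left_minor (M 0) I)" and t: "0 < t"
  shows "left_minor (M t) I \<in> \<real> \<and> 0 < Re (left_minor (M t) I)"
proof
  have tri: "real_tridiagonal A" and pos: "\<And>i j. adjacent i j \<Longrightarrow> 0 < Re (A $ i $ j)"
    using A by (auto simp: tri_positive_def)
  have A0: "0 \<le> Re (A $ x $ y)" if "x \<noteq> y" for x y
    using tri pos[of x y] that unfolding real_tridiagonal_def by (cases "adjacent x y") auto
  \<comment> \<open>The imaginary parts solve the same real linear system with zero initial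
    values.\<close>
  have "Im (left_minor (M t) I) = 0"
    by (rule zero_linear_ode[of "\<lambda>t I. Im (left_minor (M t) I)" "compound_gen A" UNIV])
      (use left_minor_deriv_Re_Im(2)[OF M tri] nn complex_is_Real_iff in auto)
  then show "left_minor (M t) I \<in> \<real>"
    by (simp add: complex_is_Real_iff)
  obtain S where S: "card S = card I" "left_minor (M 0) S \<noteq> 0"
    using left_minor_nonzero_exists[OF inv card_mono[OF finite subset_UNIV, of I]] by blast
  then have "0 < Re (left_minor (M 0) S)"
    using nn[of S] by (auto simp: complex_is_Real_iff complex_eq_iff)
  moreover have "(I, S) \<in> {(I, J). I \<noteq> J \<and> 0 < compound_gen A I J}\<^sup>*"
  proof (rule rtrancl_mono[THEN subsetD])
    show "moves \<subseteq> {(I, J). I \<noteq> J \<and> 0 < compound_gen A I J}"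
    proof
      fix p assume "p \<in> (moves :: ('n set \<times> 'n set) set)"
      then obtain I x y where xy: "x \<in> I" "y \<notin> I" "adjacent x y" and p: "p = (I, insert y (I - {x}))"
        unfolding moves_def by blast
      have "I \<noteq> insert y (I - {x})" using xy(2) by blast
      moreover have "0 < compound_gen A I (insert y (I - {x}))"
        by (rule compound_gen_pos[OF A0 xy(1,2) pos[OF xy(3)]])
      ultimately show "p \<in> {(I, J). I \<noteq> J \<and> 0 < compound_gen A I J}"
        by (simp only: p mem_Collect_eq prod.case simp_thms)
    qed
    show "(I, S) \<in> moves\<^sup>*"
      by (rule moves_connected) (use S in simp)
  qed
  ultimately show "0 < Re (left_minor (M t) I)"
    using metzler_linear_ode[of "\<lambda>t I. Re (left_minor (M t) I)", OF left_minor_deriv_Re_Im(1)[OF M tri]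
        compound_gen_nonneg[OF A0] conjunct2[OF nn] t]
    by blast
qed

subsection \<open>Block upper triangular matrices\<close>

text \<open>Equivalently, for every v the matrix preserves the span of the basis vectors e_j with f
  j >= v. For \<open>f\<close> given by \<open>lam\<close> this is the parabolic subalgebra of the
  eigenflag; no order on the indices is involved.\<close>

definition block_upper :: "('n \<Rightarrow> real) \<Rightarrow> 'n::finite cmat \<Rightarrow> bool" where
  "block_upper f b \<longleftrightarrow> (\<forall>i j. f i < f j \<longrightarrow> b $ i $ j = 0)"

lemma block_upper_mult:
  assumes "block_upper f a" "block_upper f b" shows "block_upper f (a ** b)"
  unfolding block_upper_def
proof (intro allI impI)
  fix i j assume ij: "f i < f j"
  have "a $ i $ k * b $ k $ j = 0" for k
  proof (cases "f i < f k")
    case True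
    then show ?thesis using assms(1) by (simp add: block_upper_def)
  next
    case False
    then have "f k < f j" using ij by linarith
    then show ?thesis using assms(2) by (simp add: block_upper_def)
  qed
  then show "(a ** b) $ i $ j = 0"
    unfolding matrix_mult_nth by (intro sum.neutral ballI)
qed

text \<open>Left multiplication by \<open>b\<close> is an injective endomorphism of the
  finite-dimensional space of block upper matrices, hence onto, and the identity is in its
  range.\<close>

lemma block_upper_inverse:
  fixes b :: "'n::finite cmat"
  assumes b: "block_upper f b" and inv: "y ** b = mat 1"
  shows "block_upper f y"
proof -
  let ?S = "{x :: 'n cmat. block_upper f x}"
  let ?T = "(**) b"
  have lin: "linear ?T"
    by (rule bounded_linear.linear[OF bounded_bilinear.bounded_linear_right[OF bounded_bilinear_matrix_mult]])
  have sub: "subspace ?S"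
    by (simp add: subspace_def block_upper_def)
  have "inj ?T"
  proof (rule injI)
    fix u v assume "b ** u = b ** v"
    then have "y ** b ** u = y ** b ** v"
      by (simp only: matrix_mul_assoc[symmetric])
    then show "u = v" by (simp add: inv)
  qed
  then have "dim (?T ` ?S) = dim ?S"
    by (intro dim_image_eq lin) (auto intro: inj_on_subset)
  moreover have "?T ` ?S \<subseteq> ?S"
    using block_upper_mult[OF b] by auto
  ultimately have "?T ` ?S = ?S"
    using subspace_dim_equal[OF linear_subspace_image[OF lin sub] sub] by simp
  moreover have "mat 1 \<in> ?S"
    by (auto simp: block_upper_def mat_def)
  ultimately obtain x where x: "block_upper f x" "b ** x = mat 1"
    by (metis (mono_tags, lifting) imageE mem_Collect_eq)
  have "y = y ** (b ** x)" by (simp add: x(2))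
  also have "\<dots> = x" by (simp add: matrix_mul_assoc inv)
  finally show ?thesis using x(1) by simp
qed

text \<open>With the negated position as weight all blocks have size one, so products and inverses
  of triangular matrices follow from the block case.\<close>

lemma upper_tri_block_upper:
  "upper_tri c \<longleftrightarrow> block_upper (\<lambda>i. - real (card {..<i})) c"
proof -
  have "card {..<j} < card {..<i} \<longleftrightarrow> j < i" for i j :: 'a
  proof
    assume "card {..<j} < card {..<i}"
    then have "\<not> {..<i} \<subseteq> {..<j}"
      using card_mono[of "{..<j}" "{..<i}"] by auto
    then show "j < i" by auto
  qed (auto intro!: psubset_card_mono)
  then show ?thesis
    by (simp add: upper_tri_def block_upper_def)
qed

lemma upper_tri_inverse:
  assumes "upper_tri c" "y ** c = mat 1" shows "upper_tri y"
  using assms block_upper_inverse unfolding upper_tri_block_upper by blast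

lemma upper_tri_mult:
  assumes "upper_tri a" "upper_tri b" shows "upper_tri (a ** b)"
  using assms block_upper_mult unfolding upper_tri_block_upper by blast

subsection \<open>Gram-Schmidt orthogonalisation along a curve\<close>

lemma differentiable_cnj:
  assumes "f differentiable (at t)" shows "(\<lambda>t. cnj (f t)) differentiable (at (t :: real))"
  using assms bounded_linear.has_derivative[OF bounded_linear_cnj]
  unfolding differentiable_def by blast

lemma differentiable_inverse_sqrt_Re:
  fixes f :: "real \<Rightarrow> complex"
  assumes "f differentiable (at t)" "0 < Re (f t)"
  shows "(\<lambda>t. complex_of_real (1 / sqrt (Re (f t)))) differentiable (at t)"
proof -
  obtain f' where f': "(f has_vector_derivative f') (at t)"
    using assms(1) vector_derivative_works by blast
  have "((\<lambda>t. Re (f t)) has_real_derivative Re f') (at t)"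
    unfolding has_real_derivative_iff_has_vector_derivative
    by (rule bounded_linear.has_vector_derivative[OF bounded_linear_Re f'])
  moreover have "\<exists>E. ((\<lambda>x. 1 / sqrt x) has_real_derivative E) (at (Re (f t)))"
    using assms(2) by (auto intro!: exI derivative_eq_intros)
  ultimately obtain D where "((\<lambda>t. 1 / sqrt (Re (f t))) has_real_derivative D) (at t)"
    using DERIV_chain2[of "\<lambda>x. 1 / sqrt x" _ "\<lambda>t. Re (f t)" t "Re f'" UNIV] by blast
  then have "((\<lambda>t. 1 / sqrt (Re (f t))) has_vector_derivative D) (at t)"
    unfolding has_real_derivative_iff_has_vector_derivative .
  from bounded_linear.has_vector_derivative[OF bounded_linear_of_real this]
  show ?thesis
    unfolding has_vector_derivative_def differentiable_def by blast
qed

lemma differentiable_cmat: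
  fixes M :: "real \<Rightarrow> 'n::finite cmat"
  assumes "\<And>i j. (\<lambda>t. M t $ i $ j) differentiable (at t)"
  shows "\<exists>M'. (M has_vector_derivative M') (at t)"
proof -
  have "\<forall>i j. \<exists>d. ((\<lambda>t. M t $ i $ j) has_vector_derivative d) (at t)"
    using assms vector_derivative_works by blast
  then obtain D where "\<And>i j. ((\<lambda>t. M t $ i $ j) has_vector_derivative D i j) (at t)"
    by metis
  then have "(M has_vector_derivative (\<chi> i j. D i j)) (at t)"
    by (intro has_vector_derivative_vecI) simp
  then show ?thesis by blast
qed

text \<open>Gram-Schmidt treats one column at a time, in increasing order, and each step uses only
  sums, products, conjugation and an inverse square root of a positive function, all of which
  preserve differentiability. Only the columns of \<open>c\<close> in \<open>S\<close> are
  constrained.\<close>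

lemma smooth_gram_schmidt_columns:
  fixes M :: "real \<Rightarrow> 'n::{finite,linorder} cmat" and S :: "'n set"
  assumes M: "\<And>t i j. (\<lambda>t. M t $ i $ j) differentiable (at t)" and inv: "\<And>t. N t ** M t = mat 1"
  shows "\<exists>c. (\<forall>t i j. (\<lambda>t. c t $ i $ j) differentiable (at t)) \<and>
    (\<forall>t. \<forall>j\<in>S. c t $ j $ j \<in> \<real> \<and> 0 < Re (c t $ j $ j)) \<and>
    (\<forall>t i. \<forall>j\<in>S. i \<notin> S \<or> j < i \<longrightarrow> c t $ i $ j = 0) \<and>
    (\<forall>t. \<forall>j\<in>S. \<forall>k\<in>S. (ctranspose (M t ** c t) ** (M t ** c t)) $ j $ k = (if j = k then 1 else 0))"
  using finite[of S]
proof (induction S rule: finite_linorder_max_induct)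
  case empty
  then show ?case by (intro exI[of _ "\<lambda>_. 0"]) simp
next
  case (insert b S)
  obtain c where c: "\<forall>t i j. (\<lambda>t. c t $ i $ j) differentiable (at t)"
    "\<forall>t. \<forall>j\<in>S. c t $ j $ j \<in> \<real> \<and> 0 < Re (c t $ j $ j)"
    "\<forall>t i. \<forall>j\<in>S. i \<notin> S \<or> j < i \<longrightarrow> c t $ i $ j = 0"
    "\<forall>t. \<forall>j\<in>S. \<forall>k\<in>S.
      (ctranspose (M t ** c t) ** (M t ** c t)) $ j $ k = (if j = k then 1 else 0)"
    using insert.IH by (elim exE conjE)
  have cdiff: "(\<lambda>t. c t $ i $ j) differentiable (at t)" for t i j
    using c(1) by blast
  have cpos: "c t $ j $ j \<in> \<real> \<and> 0 < Re (c t $ j $ j)" if "j \<in> S" for t j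
    using c(2) that by blast
  have c0: "c t $ i $ j = 0" if "j \<in> S" "i \<notin> S \<or> j < i" for t i j
    using c(3) that by blast
  have orth: "(ctranspose (M t ** c t) ** (M t ** c t)) $ j $ k = (if j = k then 1 else 0)"
    if "j \<in> S" "k \<in> S" for t j k
    using c(4) that by blast
  have b: "b \<notin> S" "\<And>a. a \<in> S \<Longrightarrow> a < b" using insert by auto
  \<comment> \<open>The columns of \<open>G\<close> in \<open>S\<close> are already orthonormal and
    \<open>H\<close> holds the coefficients of column \<open>b\<close> of \<open>M\<close> along
    them. \<open>v\<close> is the part of that column orthogonal to them, \<open>d\<close> its
    coordinates in the columns of \<open>M\<close>, \<open>r\<close> its squared norm, and
    \<open>s\<close> the normalising factor.\<close>
  define G where "G t = M t ** c t" for t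
  define H where "H t j = (ctranspose (G t) ** M t) $ j $ b" for t j
  define d where "d t i = (if i = b then 1 else 0) - (\<Sum>j\<in>S. c t $ i $ j * H t j)" for t i
  define v where "v t x = M t $ x $ b - (\<Sum>j\<in>S. G t $ x $ j * H t j)" for t x
  define r where "r t = (\<Sum>x\<in>UNIV. cnj (v t x) * v t x)" for t
  define s where "s t = complex_of_real (1 / sqrt (Re (r t)))" for t
  have v_d: "v t x = (\<Sum>i\<in>UNIV. M t $ x $ i * d t i)" for t x
  proof -
    have "M t $ x $ i * d t i = (if i = b then M t $ x $ i else 0) -
        (\<Sum>j\<in>S. M t $ x $ i * c t $ i $ j * H t j)" for i
      by (simp add: d_def right_diff_distrib sum_distrib_left mult.assoc)
    then have "(\<Sum>i\<in>UNIV. M t $ x $ i * d t i) =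
        M t $ x $ b - (\<Sum>i\<in>UNIV. \<Sum>j\<in>S. M t $ x $ i * c t $ i $ j * H t j)"
      by (simp add: sum_subtractf)
    also have "(\<Sum>i\<in>UNIV. \<Sum>j\<in>S. M t $ x $ i * c t $ i $ j * H t j) = (\<Sum>j\<in>S. G t $ x $ j * H t j)"
      unfolding G_def matrix_mult_nth sum_distrib_right by (rule sum.swap)
    finally show ?thesis by (simp add: v_def)
  qed
  have db: "d t b = 1" for t
    unfolding d_def using c0 b(1) by simp
  have d0: "d t i = 0" if "i \<notin> insert b S \<or> b < i" for t i
  proof -
    have "i \<noteq> b" "i \<notin> S" using that b(2) by (auto dest: order.asym)
    then show ?thesis unfolding d_def using c0 by simp
  qed
  have r_norm: "r t = of_real (\<Sum>x\<in>UNIV. (cmod (v t x))\<^sup>2)" for t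
    unfolding r_def of_real_sum by (intro sum.cong refl) (simp only: complex_norm_square mult.commute)
  have r_pos: "0 < Re (r t)" for t
  proof -
    \<comment> \<open>If \<open>v\<close> vanished, the left inverse \<open>N t\<close> would give
      \<open>d t = 0\<close>, but the coordinate of \<open>d\<close> at \<open>b\<close> is
      1.\<close>
    have "\<exists>x. v t x \<noteq> 0"
    proof (rule ccontr)
      assume "\<nexists>x. v t x \<noteq> 0"
      then have "M t *v (\<chi> i. d t i) = 0"
        by (simp add: vec_eq_iff matrix_vector_mult_def v_d[symmetric])
      then have "(N t ** M t) *v (\<chi> i. d t i) = 0"
        by (simp flip: matrix_vector_mul_assoc)
      then have "d t b = 0" by (simp add: inv vec_eq_iff)
      then show False by (simp add: db)
    qed
    then have "0 < (\<Sum>x\<in>UNIV. (cmod (v t x))\<^sup>2)"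
      by (auto intro!: sum_pos2)
    then show ?thesis by (simp add: r_norm)
  qed
  have s_pos: "s t \<in> \<real>" "0 < Re (s t)" "cnj (s t) = s t" for t
    using r_pos[of t] by (auto simp: s_def)
  have srs: "s t * s t * r t = 1" for t
  proof -
    have "r t = of_real (Re (r t))" unfolding r_norm by simp
    then have "s t * s t * r t = of_real ((1 / sqrt (Re (r t))) * (1 / sqrt (Re (r t))) * Re (r t))"
      unfolding s_def of_real_mult by (rule arg_cong)
    also have "(1 / sqrt (Re (r t))) * (1 / sqrt (Re (r t))) * Re (r t) = 1"
      using r_pos[of t] by (simp add: field_simps)
    finally show ?thesis by simp
  qed
  have Gdiff: "(\<lambda>t. G t $ i $ j) differentiable (at t)" for t i j
    unfolding G_def matrix_mult_nth
    by (intro ballI finite differentiable_sum differentiable_mult M cdiff)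
  have Hdiff: "(\<lambda>t. H t j) differentiable (at t)" for t j
    unfolding H_def matrix_mult_nth ctranspose_nth
    by (intro ballI finite differentiable_sum differentiable_mult M Gdiff differentiable_cnj)
  have ddiff: "(\<lambda>t. d t i) differentiable (at t)" for t i
    unfolding d_def
    by (intro ballI finite differentiable_sum differentiable_mult differentiable_diff Hdiff cdiff) auto
  have vdiff: "(\<lambda>t. v t x) differentiable (at t)" for t x
    unfolding v_def
    by (intro ballI finite differentiable_sum differentiable_mult differentiable_diff Hdiff M Gdiff)
  have rdiff: "r differentiable (at t)" for t
    unfolding r_def[abs_def]
    by (intro ballI finite differentiable_sum differentiable_mult vdiff differentiable_cnj)
  have sdiff: "s differentiable (at t)" for t
    unfolding s_def[abs_def] by (rule differentiable_inverse_sqrt_Re[OF rdiff r_pos])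
  have orth_v: "(\<Sum>x\<in>UNIV. cnj (G t $ x $ k) * v t x) = 0" if "k \<in> S" for t k
  proof -
    have "(\<Sum>x\<in>UNIV. cnj (G t $ x $ k) * v t x) =
        H t k - (\<Sum>x\<in>UNIV. \<Sum>j\<in>S. cnj (G t $ x $ k) * G t $ x $ j * H t j)"
      by (simp add: v_def H_def matrix_mult_nth right_diff_distrib sum_subtractf sum_distrib_left mult.assoc)
    also have "(\<Sum>x\<in>UNIV. \<Sum>j\<in>S. cnj (G t $ x $ k) * G t $ x $ j * H t j) =
        (\<Sum>j\<in>S. (ctranspose (G t) ** G t) $ k $ j * H t j)"
      unfolding matrix_mult_nth ctranspose_nth sum_distrib_right by (rule sum.swap)
    also have "\<dots> = (\<Sum>j\<in>S. if k = j then H t j else 0)"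
      by (intro sum.cong refl) (simp add: orth[OF that, folded G_def])
    also have "\<dots> = H t k" using that by simp
    finally show ?thesis by simp
  qed
  define c1 where "c1 t = (\<chi> i j. if j = b then s t * d t i else c t $ i $ j)" for t
  have G1: "(M t ** c1 t) $ x $ j = (if j = b then s t * v t x else G t $ x $ j)" for t x j
    unfolding c1_def G_def v_d by (simp add: matrix_mult_nth sum_distrib_left mult_ac)
  have orth1: "(ctranspose (M t ** c1 t) ** (M t ** c1 t)) $ j $ k = (if j = k then 1 else 0)"
    if jk: "j \<in> insert b S" "k \<in> insert b S" for t j k
  proof -
    have eq: "(ctranspose (M t ** c1 t) ** (M t ** c1 t)) $ j $ k =
      (\<Sum>x\<in>UNIV. cnj (if j = b then s t * v t x else G t $ x $ j) * (if k = b then s t * v t x else G t $ x $ k))"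
      by (simp only: matrix_mult_nth[of "ctranspose _"] ctranspose_nth G1)
    consider "j = b" "k = b" | "j = b" "k \<in> S" | "j \<in> S" "k = b" | "j \<in> S" "k \<in> S"
      using jk by blast
    then show ?thesis
    proof cases
      case 1
      then have "(ctranspose (M t ** c1 t) ** (M t ** c1 t)) $ j $ k = s t * s t * r t"
        unfolding eq r_def sum_distrib_left by (intro sum.cong refl) (simp add: s_pos)
      then show ?thesis using 1 srs by simp
    next
      case 2
      then have "k \<noteq> b" using b by auto
      then have "(ctranspose (M t ** c1 t) ** (M t ** c1 t)) $ j $ k =
          s t * cnj (\<Sum>x\<in>UNIV. cnj (G t $ x $ k) * v t x)"
        unfolding eq cnj_sum sum_distrib_left using 2 by (intro sum.cong refl) (simp add: s_pos)
      then show ?thesis using 2 \<open>k \<noteq> b\<close> orth_v by simp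
    next
      case 3
      then have "j \<noteq> b" using b by auto
      then have "(ctranspose (M t ** c1 t) ** (M t ** c1 t)) $ j $ k =
          s t * (\<Sum>x\<in>UNIV. cnj (G t $ x $ j) * v t x)"
        unfolding eq sum_distrib_left using 3 by (intro sum.cong refl) simp
      then show ?thesis using 3 \<open>j \<noteq> b\<close> orth_v by simp
    next
      case 4
      then have "j \<noteq> b" "k \<noteq> b" using b by auto
      then have "(ctranspose (M t ** c1 t) ** (M t ** c1 t)) $ j $ k = (ctranspose (G t) ** G t) $ j $ k"
        unfolding eq by (simp add: matrix_mult_nth[of "ctranspose (G t)"])
      then show ?thesis using orth[OF 4] by (simp add: G_def)
    qed
  qed
  show ?case
  proof (intro exI[of _ c1] conjI allI ballI impI)
    show "(\<lambda>t. c1 t $ i $ j) differentiable (at t)" for t i j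
      unfolding c1_def by (cases "j = b") (auto intro!: differentiable_mult sdiff ddiff cdiff)
    show "c1 t $ j $ j \<in> \<real>" "0 < Re (c1 t $ j $ j)" if "j \<in> insert b S" for t j
      using that cpos[of j t] s_pos[of t] by (auto simp: c1_def db)
    show "c1 t $ i $ j = 0" if "j \<in> insert b S" "i \<notin> insert b S \<or> j < i" for t i j
      using that c0[of j i t] d0[of i t] b by (auto simp: c1_def)
  qed (use orth1 in auto)
qed

text \<open>The triangular factor changes neither the flag nor the signs of the minors, since its
  diagonal is positive. Its differentiability is what makes the resulting curve on the orbit a
  candidate solution.\<close>

lemma smooth_qr:
  fixes M :: "real \<Rightarrow> 'n::{finite,linorder} cmat"
  assumes M: "\<And>t. (M has_vector_derivative M' t) (at t)" and inv: "\<And>t. N t ** M t = mat 1"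
  obtains c c' where "\<And>t. (c has_vector_derivative c' t) (at t)" "\<And>t. upper_tri (c t)"
    "\<And>t j. c t $ j $ j \<in> \<real> \<and> 0 < Re (c t $ j $ j)" "\<And>t. M t ** c t \<in> unitary_group"
proof -
  have "(\<lambda>t. M t $ i $ j) differentiable (at t)" for t i j
    using has_vector_derivative_vec_nth[OF has_vector_derivative_vec_nth[OF M]]
    unfolding has_vector_derivative_def differentiable_def by blast
  from smooth_gram_schmidt_columns[OF this inv, of UNIV]
  obtain c where c: "\<forall>t i j. (\<lambda>t. c t $ i $ j) differentiable (at t)"
    "\<forall>t. \<forall>j\<in>UNIV. c t $ j $ j \<in> \<real> \<and> 0 < Re (c t $ j $ j)"
    "\<forall>t i. \<forall>j\<in>UNIV. i \<notin> UNIV \<or> j < i \<longrightarrow> c t $ i $ j = 0"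
    "\<forall>t. \<forall>j\<in>UNIV. \<forall>k\<in>UNIV.
      (ctranspose (M t ** c t) ** (M t ** c t)) $ j $ k = (if j = k then 1 else 0)"
    by (elim exE conjE)
  have cdiff: "(\<lambda>t. c t $ i $ j) differentiable (at t)" for t i j
    using c(1) by blast
  have cpos: "c t $ j $ j \<in> \<real> \<and> 0 < Re (c t $ j $ j)" for t j
    using c(2) by blast
  have c0: "j < i \<Longrightarrow> c t $ i $ j = 0" for t i j
    using c(3) by blast
  have orth: "(ctranspose (M t ** c t) ** (M t ** c t)) $ j $ k = (if j = k then 1 else 0)" for t j k
    using c(4) by blast
  have "\<forall>t. \<exists>d. (c has_vector_derivative d) (at t)"
    by (intro allI differentiable_cmat cdiff)
  from choice[OF this] obtain c' where c': "\<forall>t. (c has_vector_derivative c' t) (at t)"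
    by (elim exE)
  have uni: "M t ** c t \<in> unitary_group" for t
    by (rule unitary_groupI) (simp add: vec_eq_iff orth mat_def)
  have tri: "upper_tri (c t)" for t
    using c0 by (simp add: upper_tri_def)
  show ?thesis
    by (rule that[OF spec[OF c'] tri cpos uni])
qed

subsection \<open>The gradient of a linear function\<close>

context
  fixes lam :: "real^'n::finite"
begin

text \<open>At the diagonal point, \<open>ad\<close>, its inverse on the image, its absolute value
  and the projection onto its image all act diagonally on matrix units, with a weight depending only
  on the eigenvalue gap. Identities between them become identities between scalar weights.\<close>

definition scale_gaps :: "(real \<Rightarrow> complex) \<Rightarrow> 'n cmat \<Rightarrow> 'n cmat" where
  "scale_gaps w X = (\<chi> j k. w (lam $ j - lam $ k) * X $ j $ k)"

lemma scale_gaps_nth: "scale_gaps w X $ j $ k = w (lam $ j - lam $ k) * X $ j $ k"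
  by (simp add: scale_gaps_def)

lemma linear_scale_gaps: "linear (scale_gaps w)"
  by (rule linearI) (simp_all add: scale_gaps_def vec_eq_iff algebra_simps)

lemma scale_gaps_skew_hermitian:
  assumes "\<And>x. cnj (w (- x)) = w x" "X \<in> skew_hermitian"
  shows "scale_gaps w X \<in> skew_hermitian"
  unfolding skew_hermitian_iff
proof (intro allI)
  fix j k
  have "cnj (w (lam $ k - lam $ j)) = w (lam $ j - lam $ k)"
    using assms(1)[of "lam $ j - lam $ k"] by simp
  then show "cnj (scale_gaps w X $ k $ j) = - scale_gaps w X $ j $ k"
    using assms(2) by (simp add: scale_gaps_nth skew_hermitian_iff)
qed

lemma scale_gaps_scale_gaps: "scale_gaps v (scale_gaps w X) = scale_gaps (\<lambda>x. v x * w x) X"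
  by (simp add: scale_gaps_def vec_eq_iff mult.assoc)

lemma scale_gaps_cong:
  assumes "\<And>x. w x = w' x"
  shows "scale_gaps w X = scale_gaps w' X"
  by (simp add: scale_gaps_def assms)

text \<open>The weights, in this order, of \<open>ad\<close> at the diagonal point, its
  pseudo-inverse, the square root of -ad^2, and the projection that kills the diagonal
  blocks.\<close>

abbreviation "gap \<equiv> \<lambda>x :: real. \<i> * complex_of_real x"
abbreviation "gap_inv \<equiv> \<lambda>x :: real. if x = 0 then 0 else - \<i> / complex_of_real x"
abbreviation "gap_abs \<equiv> \<lambda>x :: real. complex_of_real \<bar>x\<bar>"
abbreviation "gap_off \<equiv> \<lambda>x :: real. if x = 0 then 0 else (1 :: complex)"

lemma scale_gaps_skew:
  assumes "X \<in> skew_hermitian"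
  shows "scale_gaps gap X \<in> skew_hermitian" "scale_gaps gap_inv X \<in> skew_hermitian"
    "scale_gaps gap_abs X \<in> skew_hermitian" "scale_gaps gap_off X \<in> skew_hermitian"
  by (rule scale_gaps_skew_hermitian[OF _ assms]; simp)+

lemma ad_i_diag_gap: "ad (i_diag lam) X = scale_gaps gap X"
  by (simp add: vec_eq_iff ad_i_diag scale_gaps_nth)

text \<open>The outer weight is \<i> times the sign of the gap; off the diagonal blocks it inverts
  the operator through which the Kaehler metric sees its first argument.\<close>

lemma scale_gaps_sgn:
  "scale_gaps (\<lambda>x. gap x / gap_abs x) (scale_gaps gap_inv (scale_gaps gap_abs X)) = scale_gaps gap_off X"
  unfolding scale_gaps_scale_gaps by (rule scale_gaps_cong) simp

section \<open>Tangent space, metrics and gradient in the frame of \<open>g\<close>\<close>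

context
  fixes g :: "'n cmat"
  assumes g: "g \<in> unitary_group"
begin

abbreviation "base_pt \<equiv> conj_by g (i_diag lam)"

lemma ad_L: "ad base_pt (conj_by g X) = conj_by g (scale_gaps gap X)"
  by (simp add: ad_conj_by[OF g] ad_i_diag_gap)

definition tangent0 :: "'n cmat set" where
  "tangent0 = scale_gaps gap_off ` skew_hermitian"

lemma tangent0_skew: "X \<in> tangent0 \<Longrightarrow> X \<in> skew_hermitian"
  unfolding tangent0_def using scale_gaps_skew(4) by blast

lemma tangent0_off:
  assumes "X \<in> tangent0" shows "scale_gaps gap_off X = X"
proof -
  obtain Y where "X = scale_gaps gap_off Y"
    using assms by (auto simp: tangent0_def)
  moreover have "scale_gaps (\<lambda>x. gap_off x * gap_off x) Y = scale_gaps gap_off Y"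
    by (rule scale_gaps_cong) simp
  ultimately show ?thesis
    by (simp only: scale_gaps_scale_gaps)
qed

lemma gap_gap_inv: "scale_gaps gap (scale_gaps gap_inv X) = scale_gaps gap_off X"
  unfolding scale_gaps_scale_gaps by (rule scale_gaps_cong) simp

lemma gap_inv_gap: "scale_gaps gap_inv (scale_gaps gap X) = scale_gaps gap_off X"
  unfolding scale_gaps_scale_gaps by (rule scale_gaps_cong) simp

lemma tangent_space_L: "tangent_space base_pt = conj_by g ` tangent0"
proof (intro equalityI subsetI)
  fix V assume "V \<in> tangent_space base_pt"
  then obtain X where X: "X \<in> skew_hermitian" "V = ad base_pt X"
    by (auto simp: tangent_space_def)
  obtain Y where Y: "Y \<in> skew_hermitian" "X = conj_by g Y"
    using skew_hermitian_conj_by_cases[OF g X(1)] by blast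
  have "scale_gaps gap Y = scale_gaps gap_off (scale_gaps gap Y)"
    unfolding scale_gaps_scale_gaps by (rule scale_gaps_cong) simp
  then have "scale_gaps gap Y \<in> tangent0"
    unfolding tangent0_def using scale_gaps_skew(1)[OF Y(1)] by (metis imageI)
  then show "V \<in> conj_by g ` tangent0"
    unfolding X(2) Y(2) ad_L by (rule imageI)
next
  fix V assume "V \<in> conj_by g ` tangent0"
  then obtain Y where Y: "Y \<in> skew_hermitian" "V = conj_by g (scale_gaps gap_off Y)"
    by (auto simp: tangent0_def)
  have "V = ad base_pt (conj_by g (scale_gaps gap_inv Y))"
    by (simp only: Y(2) ad_L gap_gap_inv)
  then show "V \<in> tangent_space base_pt"
    unfolding tangent_space_def
    using conj_by_skew_hermitian[OF scale_gaps_skew(2)[OF Y(1)]] by (rule image_eqI)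
qed

text \<open>The diagonal blocks form the kernel of \<open>ad\<close> and the rest its image, on
  which \<open>gap_inv\<close> inverts \<open>gap\<close>; hence the decomposition is
  unique.\<close>

lemma im_part_L:
  assumes Y: "Y \<in> skew_hermitian"
  shows "im_part base_pt (conj_by g Y) = conj_by g (scale_gaps gap_off Y)"
  unfolding im_part_def
proof (rule the_equality)
  have "scale_gaps gap (Y - scale_gaps gap_off Y) = 0"
    by (auto simp: vec_eq_iff scale_gaps_nth)
  then have "ad base_pt (conj_by g Y - conj_by g (scale_gaps gap_off Y)) = 0"
    by (simp add: ad_L linear_0[OF linear_conj_by] flip: conj_by_diff)
  moreover have "conj_by g Y - conj_by g (scale_gaps gap_off Y) \<in> skew_hermitian"
    by (intro subspace_diff[OF subspace_skew_hermitian] conj_by_skew_hermitian Y scale_gaps_skew)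
  moreover have "conj_by g (scale_gaps gap_off Y) \<in> ad base_pt ` skew_hermitian"
    using tangent_space_L Y unfolding tangent0_def tangent_space_def by blast
  ultimately show "conj_by g (scale_gaps gap_off Y) \<in> ad base_pt ` skew_hermitian \<and>
      conj_by g Y - conj_by g (scale_gaps gap_off Y) \<in> {Z \<in> skew_hermitian. ad base_pt Z = 0}"
    by blast
next
  fix Z assume Z: "Z \<in> ad base_pt ` skew_hermitian \<and> conj_by g Y - Z \<in> {Z \<in> skew_hermitian. ad base_pt Z = 0}"
  then have "Z \<in> conj_by g ` tangent0"
    using tangent_space_L by (simp add: tangent_space_def)
  then obtain W where W: "W \<in> tangent0" "Z = conj_by g W" by blast
  have "ad base_pt (conj_by g (Y - W)) = 0"
    using Z W(2) by (simp add: conj_by_diff)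
  then have "conj_by g (scale_gaps gap (Y - W)) = conj_by g 0"
    by (simp add: ad_L linear_0[OF linear_conj_by])
  then have "scale_gaps gap (Y - W) = 0"
    using conj_by_eq_iff[OF g] by blast
  then have "scale_gaps gap_inv (scale_gaps gap (Y - W)) = 0"
    by (simp add: linear_0[OF linear_scale_gaps])
  then have "scale_gaps gap_off Y = W"
    unfolding gap_inv_gap linear_diff[OF linear_scale_gaps] tangent0_off[OF W(1)] by simp
  then show "Z = conj_by g (scale_gaps gap_off Y)"
    by (simp only: W(2))
qed

lemma kappa_conj_by:
  assumes "X \<in> skew_hermitian" "Y \<in> skew_hermitian" "trace X = 0"
  shows "- Re (kappa (conj_by g X) (conj_by g Y)) = 2 * real CARD('n) * (X \<bullet> Y)"
proof -
  have "trace (X ** ctranspose Y) = - trace (X ** Y)"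
    using assms(2) by (simp add: skew_hermitian_def matrix_minus_right trace_def sum_negf)
  then show ?thesis
    by (simp add: kappa_def conj_by_mult[OF g] trace_conj_by[OF g] assms(3) inner_cmat_trace)
qed

text \<open>A preimage of \<open>V\<close> under \<open>ad\<close> is determined up to the kernel,
  and passing to \<open>im_part\<close> leaves exactly the \<open>gap_inv\<close> multiple, whatever
  preimage is chosen.\<close>

lemma normal_metric_L:
  assumes V: "V \<in> tangent0" and W: "W \<in> tangent0"
  shows "normal_metric base_pt (conj_by g V) (conj_by g W) =
    2 * real CARD('n) * (scale_gaps gap_inv V \<bullet> scale_gaps gap_inv W)"
proof -
  have part: "im_part base_pt X = conj_by g (scale_gaps gap_inv V)"
    if X: "X \<in> skew_hermitian" "conj_by g V = ad base_pt X" for X V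
  proof -
    obtain Y where Y: "Y \<in> skew_hermitian" "X = conj_by g Y"
      using skew_hermitian_conj_by_cases[OF g X(1)] by blast
    have "V = scale_gaps gap Y"
      using X(2) by (simp add: Y(2) ad_L conj_by_eq_iff[OF g])
    then show ?thesis
      by (simp only: Y(2) im_part_L[OF Y(1)] gap_inv_gap)
  qed
  have ex: "\<exists>X\<in>skew_hermitian. conj_by g V = ad base_pt X" if "V \<in> tangent0" for V
    using that tangent_space_L by (auto simp: tangent_space_def)
  have tr: "trace (scale_gaps gap_inv V) = 0"
    by (simp add: trace_def scale_gaps_nth)
  have val: "- Re (kappa (conj_by g (scale_gaps gap_inv V)) (conj_by g (scale_gaps gap_inv W))) =
      2 * real CARD('n) * (scale_gaps gap_inv V \<bullet> scale_gaps gap_inv W)"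
    by (rule kappa_conj_by) (use tr V W tangent0_skew scale_gaps_skew(2) in auto)
  obtain X Y where XY: "X \<in> skew_hermitian" "conj_by g V = ad base_pt X"
    "Y \<in> skew_hermitian" "conj_by g W = ad base_pt Y"
    using ex[OF V] ex[OF W] by blast
  show ?thesis
    unfolding normal_metric_def
  proof (rule the_equality)
    show "\<exists>X\<in>skew_hermitian. \<exists>Y\<in>skew_hermitian. conj_by g V = ad base_pt X \<and> conj_by g W = ad base_pt Y \<and>
        2 * real CARD('n) * (scale_gaps gap_inv V \<bullet> scale_gaps gap_inv W) =
        - Re (kappa (im_part base_pt X) (im_part base_pt Y))"
      using XY part[OF XY(1,2)] part[OF XY(3,4)] val by (intro bexI[of _ X] bexI[of _ Y]) simp_all
  next
    fix r assume "\<exists>X\<in>skew_hermitian. \<exists>Y\<in>skew_hermitian. conj_by g V = ad base_pt X \<and>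
        conj_by g W = ad base_pt Y \<and> r = - Re (kappa (im_part base_pt X) (im_part base_pt Y))"
    then show "r = 2 * real CARD('n) * (scale_gaps gap_inv V \<bullet> scale_gaps gap_inv W)"
      using part val by auto
  qed
qed

text \<open>The defect \<open>y = S x - \<mu> x\<close> satisfies \<open>S y = - \<mu> y\<close>,
  which positivity excludes for positive \<open>\<mu>\<close> unless \<open>y = 0\<close>. For
  \<open>\<mu> = 0\<close>, symmetry turns |S x|^2 into the inner product of x with S (S x) = 0.
  This gives uniqueness of the root without diagonalising \<open>S\<close>.\<close>

lemma psd_sqrt_eigenvector:
  fixes S :: "'a::real_inner \<Rightarrow> 'a"
  assumes S: "linear S" "S ` U \<subseteq> U" and U: "subspace U"
    and sq: "\<And>u. u \<in> U \<Longrightarrow> S (S u) = T u"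
    and sym: "\<And>u v. u \<in> U \<Longrightarrow> v \<in> U \<Longrightarrow> S u \<bullet> v = u \<bullet> S v"
    and psd: "\<And>u. u \<in> U \<Longrightarrow> 0 \<le> u \<bullet> S u"
    and x: "x \<in> U" "T x = (\<mu> * \<mu>) *\<^sub>R x" and \<mu>: "0 \<le> \<mu>"
  shows "S x = \<mu> *\<^sub>R x"
proof (cases "\<mu> = 0")
  case True
  have "S x \<in> U" using S(2) x(1) by blast
  then have "S x \<bullet> S x = 0"
    using sym[OF x(1), of "S x"] sq[OF x(1)] x(2) True by simp
  then show ?thesis using True by simp
next
  case False
  define y where "y = S x - \<mu> *\<^sub>R x"
  have yU: "y \<in> U"
    unfolding y_def using S(2) x(1) by (intro subspace_diff[OF U] subspace_scale[OF U]) auto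
  have "S y = - \<mu> *\<^sub>R y"
    using sq[OF x(1)] x(2)
    by (simp add: y_def linear_diff[OF S(1)] linear_cmul[OF S(1)] scaleR_right_diff_distrib)
  then have "0 \<le> - \<mu> * (y \<bullet> y)"
    using psd[OF yU] by simp
  then have "y \<bullet> y \<le> 0"
    using \<mu> False by (simp add: mult_le_0_iff)
  then have "y = 0"
    using inner_ge_zero[of y] by (simp add: inner_eq_zero_iff antisym)
  then show ?thesis by (simp add: y_def)
qed

lemma psd_sqrt_L:
  assumes X: "X \<in> skew_hermitian"
  shows "psd_sqrt_on skew_hermitian (\<lambda>X. - ad base_pt (ad base_pt X)) (conj_by g X) = conj_by g (scale_gaps gap_abs X)"
  unfolding psd_sqrt_on_def
proof (rule the_equality)
  \<comment> \<open>The absolute value of \<open>ad\<close> in the frame of \<open>g\<close>,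
    extended linearly to all matrices.\<close>
  let ?S = "\<lambda>X. conj_by g (scale_gaps gap_abs (conj_by (ctranspose g) X))"
  have S_conj: "?S (conj_by g Y) = conj_by g (scale_gaps gap_abs Y)" for Y
    by (simp only: conj_by_inverse[OF g])
  have "linear ?S"
    using linear_compose[OF linear_compose[OF linear_conj_by linear_scale_gaps] linear_conj_by]
    by (simp add: o_def)
  moreover have "?S ` skew_hermitian \<subseteq> skew_hermitian"
    using conj_by_skew_hermitian scale_gaps_skew(3) by blast
  moreover have "?S (?S u) = - ad base_pt (ad base_pt u) \<and> (\<forall>v\<in>skew_hermitian. ?S u \<bullet> v = u \<bullet> ?S v) \<and> 0 \<le> u \<bullet> ?S u"
    if u: "u \<in> skew_hermitian" for u
  proof -
    obtain Y where Y: "Y \<in> skew_hermitian" "u = conj_by g Y"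
      using skew_hermitian_conj_by_cases[OF g u] by blast
    have "complex_of_real \<bar>x\<bar> * complex_of_real \<bar>x\<bar> = - (gap x * gap x)" for x
      by (simp add: complex_eq_iff)
    then have "scale_gaps gap_abs (scale_gaps gap_abs Y) = - scale_gaps gap (scale_gaps gap Y)"
      by (simp add: vec_eq_iff scale_gaps_nth mult.assoc[symmetric])
    then have 1: "?S (?S u) = - ad base_pt (ad base_pt u)"
      by (simp add: Y(2) S_conj ad_L conj_by_minus)
    have sym: "scale_gaps gap_abs A \<bullet> B = A \<bullet> scale_gaps gap_abs B" for A B
      by (simp add: inner_cmat scale_gaps_nth mult_ac)
    have 2: "?S u \<bullet> v = u \<bullet> ?S v" if v: "v \<in> skew_hermitian" for v
    proof -
      obtain Z where "v = conj_by g Z"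
        using skew_hermitian_conj_by_cases[OF g v] by blast
      then show ?thesis
        by (simp only: Y(2) S_conj inner_conj_by[OF g] sym)
    qed
    have "0 \<le> Y \<bullet> scale_gaps gap_abs Y"
      unfolding inner_cmat
    proof (intro sum_nonneg)
      fix j k
      have "Re (Y $ j $ k * cnj (scale_gaps gap_abs Y $ j $ k)) =
          \<bar>lam $ j - lam $ k\<bar> * (cmod (Y $ j $ k))\<^sup>2"
        unfolding cmod_power2 scale_gaps_nth by (simp add: power2_eq_square algebra_simps)
      then show "0 \<le> Re (Y $ j $ k * cnj (scale_gaps gap_abs Y $ j $ k))" by simp
    qed
    then have 3: "0 \<le> u \<bullet> ?S u"
      by (simp only: Y(2) S_conj inner_conj_by[OF g])
    show ?thesis using 1 2 3 by blast
  qed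
  ultimately show "\<exists>S. linear S \<and> S ` skew_hermitian \<subseteq> skew_hermitian \<and>
      (\<forall>u\<in>skew_hermitian. S (S u) = - ad base_pt (ad base_pt u)) \<and>
      (\<forall>u\<in>skew_hermitian. \<forall>v\<in>skew_hermitian. S u \<bullet> v = u \<bullet> S v) \<and>
      (\<forall>u\<in>skew_hermitian. 0 \<le> u \<bullet> S u) \<and> conj_by g (scale_gaps gap_abs X) = S (conj_by g X)"
    by (intro exI[of _ ?S]) (simp only: S_conj, blast)
next
  fix y assume "\<exists>S. linear S \<and> S ` skew_hermitian \<subseteq> skew_hermitian \<and>
      (\<forall>u\<in>skew_hermitian. S (S u) = - ad base_pt (ad base_pt u)) \<and>
      (\<forall>u\<in>skew_hermitian. \<forall>v\<in>skew_hermitian. S u \<bullet> v = u \<bullet> S v) \<and>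
      (\<forall>u\<in>skew_hermitian. 0 \<le> u \<bullet> S u) \<and> y = S (conj_by g X)"
  then obtain S where S: "linear S" "S ` skew_hermitian \<subseteq> skew_hermitian"
    "\<And>u. u \<in> skew_hermitian \<Longrightarrow> S (S u) = - ad base_pt (ad base_pt u)"
    "\<And>u v. u \<in> skew_hermitian \<Longrightarrow> v \<in> skew_hermitian \<Longrightarrow> S u \<bullet> v = u \<bullet> S v"
    "\<And>u. u \<in> skew_hermitian \<Longrightarrow> 0 \<le> u \<bullet> S u" and y: "y = S (conj_by g X)"
    by blast
  \<comment> \<open>\<open>E\<close> is the finite set of absolute gaps and
    \<open>comp \<mu>\<close> the part of \<open>X\<close> supported on gaps of size
    \<open>\<mu>\<close>, an eigenvector of -ad^2 for \<mu>^2. On each part the competing root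
    \<open>S\<close> is already determined.\<close>
  define E where "E = range (\<lambda>(j, k). \<bar>lam $ j - lam $ k\<bar>)"
  define comp where "comp \<mu> = scale_gaps (\<lambda>x. if \<bar>x\<bar> = \<mu> then 1 else 0) X" for \<mu>
  have E: "finite E" "\<And>j k. \<bar>lam $ j - lam $ k\<bar> \<in> E" "\<And>\<mu>. \<mu> \<in> E \<Longrightarrow> 0 \<le> \<mu>"
    by (auto simp: E_def image_iff)
  have comp_skew: "comp \<mu> \<in> skew_hermitian" for \<mu>
    unfolding comp_def by (rule scale_gaps_skew_hermitian[OF _ X]) simp
  have "- ad base_pt (ad base_pt (conj_by g (comp \<mu>))) = (\<mu> * \<mu>) *\<^sub>R conj_by g (comp \<mu>)" for \<mu>
  proof -
    have "- scale_gaps gap (scale_gaps gap (comp \<mu>)) = (\<mu> * \<mu>) *\<^sub>R comp \<mu>"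
    proof -
      have "- (gap x * (gap x * ((if \<bar>x\<bar> = \<mu> then 1 else 0) * z))) =
          (\<mu> * \<mu>) *\<^sub>R ((if \<bar>x\<bar> = \<mu> then 1 else 0) * z)" for x z
        by (auto simp: complex_eq_iff)
      then show ?thesis
        by (simp only: vec_eq_iff vector_uminus_component vector_scaleR_component scale_gaps_nth comp_def simp_thms)
    qed
    then show ?thesis
      by (simp only: ad_L conj_by_minus[symmetric] conj_by_scaleR[symmetric])
  qed
  then have eig: "S (conj_by g (comp \<mu>)) = \<mu> *\<^sub>R conj_by g (comp \<mu>)" if "\<mu> \<in> E" for \<mu>
    by (intro psd_sqrt_eigenvector[OF S(1,2) subspace_skew_hermitian S(3,4,5)]
        conj_by_skew_hermitian comp_skew E(3) that) auto
  have delta: "(if b then 1 else 0) * z = (if b then z else 0)" for b and z :: complex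
    by simp
  have X_sum: "X = (\<Sum>\<mu>\<in>E. comp \<mu>)"
    unfolding vec_eq_iff sum_component comp_def scale_gaps_nth delta using E by simp
  have "S (conj_by g X) = (\<Sum>\<mu>\<in>E. S (conj_by g (comp \<mu>)))"
    unfolding X_sum linear_sum[OF linear_conj_by] linear_sum[OF S(1)] ..
  also have "\<dots> = conj_by g (\<Sum>\<mu>\<in>E. \<mu> *\<^sub>R comp \<mu>)"
    by (simp add: eig linear_sum[OF linear_conj_by] conj_by_scaleR)
  also have "(\<Sum>\<mu>\<in>E. \<mu> *\<^sub>R comp \<mu>) = scale_gaps gap_abs X"
    unfolding vec_eq_iff sum_component vector_scaleR_component comp_def scale_gaps_nth delta using E
    by (simp add: if_distrib[of "\<lambda>u. _ * u"] scaleR_conv_of_real cong: if_cong)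
  finally show "y = conj_by g (scale_gaps gap_abs X)"
    by (simp only: y)
qed

lemma kahler_metric_L:
  assumes V: "V \<in> tangent0" and W: "W \<in> tangent0"
  shows "kahler_metric base_pt (conj_by g V) (conj_by g W) =
    2 * real CARD('n) * (scale_gaps gap_inv (scale_gaps gap_abs V) \<bullet> scale_gaps gap_inv W)"
proof -
  have "scale_gaps gap_abs V = scale_gaps gap_off (scale_gaps gap_abs V)"
    unfolding scale_gaps_scale_gaps by (rule scale_gaps_cong) simp
  then have "scale_gaps gap_abs V \<in> tangent0"
    unfolding tangent0_def using scale_gaps_skew(3)[OF tangent0_skew[OF V]] by (rule image_eqI)
  then show ?thesis
    unfolding kahler_metric_def psd_sqrt_L[OF tangent0_skew[OF V]] using W by (rule normal_metric_L)
qed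

lemma trace_conj_by_skew:
  assumes "N \<in> skew_hermitian" "V \<in> tangent0"
  shows "Re (trace (conj_by g V ** conj_by g N)) = - (scale_gaps gap_off V \<bullet> N)"
proof -
  have "trace (V ** ctranspose N) = - trace (V ** N)"
    using assms(1) by (simp add: skew_hermitian_def matrix_minus_right trace_def sum_negf)
  then show ?thesis
    by (simp add: conj_by_mult[OF g] trace_conj_by[OF g] inner_cmat_trace tangent0_off[OF assms(2)])
qed

lemma frechet_derivative_trace:
  "frechet_derivative (\<lambda>L. Re (trace (L ** N))) (at x) V = Re (trace (V ** N))" for N :: "'n cmat"
proof -
  have "linear (\<lambda>L :: 'n cmat. Re (trace (L ** N)))"
    by (rule linearI) (simp_all add: trace_def matrix_mult_add_left matrix_scaleR_left sum.distrib
        scaleR_sum_right sum_distrib_left)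
  then have deriv: "((\<lambda>L :: 'n cmat. Re (trace (L ** N))) has_derivative (\<lambda>V. Re (trace (V ** N)))) (at x)"
    by (intro bounded_linear_imp_has_derivative) (simp add: linear_conv_bounded_linear)
  then show ?thesis
    using fun_cong[OF frechet_derivative_at[OF deriv], of V] by simp
qed

lemma kahler_grad_L:
  assumes N: "N \<in> skew_hermitian"
  shows "kahler_grad (\<lambda>L. Re (trace (L ** conj_by g N))) base_pt =
    conj_by g ((- 1 / (2 * real CARD('n))) *\<^sub>R scale_gaps gap_abs N)"
proof -
  \<comment> \<open>The metric has weight 2 n / |x| at a gap x and \<open>gap_abs\<close>
    contributes |x|, so the pairing leaves 2 n times this constant. It has to equal -1, the sign in
    \<open>trace_conj_by_skew\<close>.\<close>
  let ?r = "- 1 / (2 * real CARD('n))"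
  let ?G = "?r *\<^sub>R scale_gaps gap_abs N"
  have "?G = scale_gaps gap_off ?G"
    by (auto simp: vec_eq_iff scale_gaps_nth)
  moreover have "?G \<in> skew_hermitian"
    by (intro subspace_scale[OF subspace_skew_hermitian] scale_gaps_skew N)
  ultimately have G: "?G \<in> tangent0"
    unfolding tangent0_def by (rule image_eqI)
  have metric_G: "kahler_metric base_pt (conj_by g ?G) (conj_by g V) = Re (trace (conj_by g V ** conj_by g N))"
    if V: "V \<in> tangent0" for V
  proof -
    have "scale_gaps gap_inv (scale_gaps gap_abs (scale_gaps gap_abs N)) \<bullet> scale_gaps gap_inv V =
        scale_gaps gap_off V \<bullet> N"
      unfolding inner_cmat
    proof (intro sum.cong refl)
      fix j k
      show "Re (scale_gaps gap_inv (scale_gaps gap_abs (scale_gaps gap_abs N)) $ j $ k *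
          cnj (scale_gaps gap_inv V $ j $ k)) = Re (scale_gaps gap_off V $ j $ k * cnj (N $ j $ k))"
      proof (cases "lam $ j = lam $ k")
        case False
        define x where "x = lam $ j - lam $ k"
        have x: "x \<noteq> 0" using False by (simp add: x_def)
        have "- \<i> / complex_of_real x * (complex_of_real \<bar>x\<bar> * (complex_of_real \<bar>x\<bar> * n)) *
            cnj (- \<i> / complex_of_real x * v) = n * cnj v" for n v
        proof -
          have "complex_of_real \<bar>x\<bar> * complex_of_real \<bar>x\<bar> = complex_of_real x * complex_of_real x"
            by (simp flip: of_real_mult)
          then show ?thesis
            using x by (simp add: field_simps)
        qed
        from this[of "N $ j $ k" "V $ j $ k"] show ?thesis
          unfolding scale_gaps_nth x_def[symmetric] using x by simp
      qed (simp add: scale_gaps_nth)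
    qed
    then have "kahler_metric base_pt (conj_by g ?G) (conj_by g V) =
        2 * real CARD('n) * ?r * (scale_gaps gap_off V \<bullet> N)"
      unfolding kahler_metric_L[OF G V] linear_cmul[OF linear_scale_gaps] inner_scaleR_left by simp
    then show ?thesis
      by (simp add: trace_conj_by_skew[OF N V])
  qed
  show ?thesis
    unfolding kahler_grad_def frechet_derivative_trace
  proof (rule the_equality)
    show "conj_by g ?G \<in> tangent_space base_pt \<and> (\<forall>V\<in>tangent_space base_pt.
        kahler_metric base_pt (conj_by g ?G) V = Re (trace (V ** conj_by g N)))"
      unfolding tangent_space_L using G metric_G by blast
  next
    fix F assume F: "F \<in> tangent_space base_pt \<and> (\<forall>V\<in>tangent_space base_pt.
        kahler_metric base_pt F V = Re (trace (V ** conj_by g N)))"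
    then obtain F0 where F0: "F0 \<in> tangent0" "F = conj_by g F0"
      unfolding tangent_space_L by blast
    \<comment> \<open>With this test vector the two arguments of the metric coincide after
      weighting, so the difference of the two gradient candidates is measured by a square.\<close>
    define D where "D = scale_gaps gap_abs (F0 - ?G)"
    have "D \<in> skew_hermitian"
      unfolding D_def using F0(1) G tangent0_skew
      by (intro scale_gaps_skew subspace_diff[OF subspace_skew_hermitian]) auto
    moreover have "D = scale_gaps gap_off D"
      unfolding D_def scale_gaps_scale_gaps by (rule scale_gaps_cong) simp
    ultimately have D: "D \<in> tangent0"
      unfolding tangent0_def by (metis imageI)
    have "kahler_metric base_pt (conj_by g F0) (conj_by g D) = kahler_metric base_pt (conj_by g ?G) (conj_by g D)"
    proof -
      have "conj_by g D \<in> tangent_space base_pt"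
        unfolding tangent_space_L using D by (rule imageI)
      from bspec[OF conjunct2[OF F] this] show ?thesis
        by (simp only: metric_G[OF D] F0(2))
    qed
    then have "scale_gaps gap_inv (scale_gaps gap_abs F0) \<bullet> scale_gaps gap_inv D =
        scale_gaps gap_inv (scale_gaps gap_abs ?G) \<bullet> scale_gaps gap_inv D"
      unfolding kahler_metric_L[OF F0(1) D] kahler_metric_L[OF G D] by simp
    then have "scale_gaps gap_inv D \<bullet> scale_gaps gap_inv D = 0"
      unfolding D_def linear_diff[OF linear_scale_gaps] inner_diff_left by simp
    then have "scale_gaps gap_inv D = 0" by simp
    then have "scale_gaps gap_off (F0 - ?G) = 0"
      unfolding D_def scale_gaps_sgn[symmetric] by (simp add: linear_0[OF linear_scale_gaps])
    then have "F0 = ?G"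
      unfolding linear_diff[OF linear_scale_gaps] tangent0_off[OF F0(1)] tangent0_off[OF G]
      by (simp only: right_minus_eq)
    then show "F = conj_by g ?G"
      by (simp only: F0(2))
  qed
qed

end

end

subsection \<open>Gradient curves are moving flags\<close>

text \<open>On traceless matrices \<open>kappa\<close> is \<open>2 n\<close> times the trace form; this slows the flow of
  \<open>exp (t A)\<close> down by the factor \<open>1 / (2 n)\<close>.\<close>

definition speed :: "'n::finite itself \<Rightarrow> real" where
  "speed _ = 1 / (2 * real CARD('n))"

abbreviation i_times :: "'n::finite cmat \<Rightarrow> 'n cmat" where
  "i_times N \<equiv> map_matrix (\<lambda>z. \<i> * z) N"

lemma i_times_nth: "i_times N $ j $ k = \<i> * N $ j $ k"
  by (simp add: map_matrix_def)

lemma i_times_conj_by: "i_times (conj_by g N) = conj_by g (i_times N)"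
  by (simp add: vec_eq_iff i_times_nth conj_by_def matrix_mult_nth sum_distrib_left sum_distrib_right mult_ac)

lemma i_times_skew_hermitian:
  "N \<in> skew_hermitian \<Longrightarrow> cnj (i_times N $ k $ j) = i_times N $ j $ k"
  by (simp add: skew_hermitian_iff i_times_nth)

lemma kahler_grad_orbit_point:
  fixes N :: "'n::finite cmat"
  assumes g: "g \<in> unitary_group" and N: "N \<in> skew_hermitian"
  shows "kahler_grad (\<lambda>L. Re (trace (L ** N))) (orbit_point lam g) =
    conj_by g ((- speed TYPE('n)) *\<^sub>R scale_gaps lam gap_abs (conj_by (ctranspose g) N))"
  using kahler_grad_L[OF g conj_by_skew_hermitian[OF N, of "ctranspose g"], of lam]
  by (simp add: conj_by_inverse[OF g] orbit_point_conj_by[OF g] speed_def)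

text \<open>A commutator form of the gradient: unlike the formula with \<open>gap_abs\<close>, it
  passes to polynomials in \<open>L\<close>. The generator is \<open>A\<close> with its entries
  weighted by the sign of the gap.\<close>

lemma kahler_grad_commutator:
  fixes N :: "'n::finite cmat"
  assumes g: "g \<in> unitary_group" and N: "N \<in> skew_hermitian"
  shows "kahler_grad (\<lambda>L. Re (trace (L ** N))) (orbit_point lam g) =
    ad (conj_by g (scale_gaps lam (\<lambda>x. - complex_of_real (speed TYPE('n) * sgn x)) (conj_by (ctranspose g) (i_times N))))
      (orbit_point lam g)"
proof -
  have "ad (scale_gaps lam (\<lambda>x. - complex_of_real (speed TYPE('n) * sgn x)) (i_times M)) (i_diag lam) =
      (- speed TYPE('n)) *\<^sub>R scale_gaps lam gap_abs M" for M :: "'n cmat"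
  proof -
    have "- complex_of_real (s * sgn x) * (\<i> * m) * (\<i> * complex_of_real (- x)) =
        (- s) *\<^sub>R (complex_of_real \<bar>x\<bar> * m)" for s x m
    proof -
      have "\<bar>x\<bar> = sgn x * x" by (simp add: abs_sgn mult.commute)
      then show ?thesis by (simp add: complex_eq_iff algebra_simps)
    qed
    note eq = this
    show ?thesis
      unfolding vec_eq_iff
    proof (intro allI)
      fix j k
      show "ad (scale_gaps lam (\<lambda>x. - complex_of_real (speed TYPE('n) * sgn x)) (i_times M)) (i_diag lam) $ j $ k =
          ((- speed TYPE('n)) *\<^sub>R scale_gaps lam gap_abs M) $ j $ k"
        using eq[of "speed TYPE('n)" "lam $ j - lam $ k" "M $ j $ k"]
        by (simp add: ad_def matrix_mult_i_diag i_diag_matrix_mult scale_gaps_nth i_times_nth algebra_simps)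
    qed
  qed
  then show ?thesis
    unfolding kahler_grad_orbit_point[OF g N]
    unfolding orbit_point_conj_by[OF g] i_times_conj_by[symmetric] ad_conj_by[OF g]
    by (simp only:)
qed

text \<open>For unitary \<open>b\<close> the conjugate transpose is the inverse, hence also block
  upper, so \<open>b\<close> mixes only indices with equal eigenvalue.\<close>

lemma block_upper_unitary_commute:
  fixes b :: "'n::finite cmat" and lam :: "real^'n"
  assumes b: "b \<in> unitary_group" "block_upper (\<lambda>i. lam $ i) b"
  shows "conj_by b (i_diag lam) = i_diag lam"
proof -
  have "block_upper (\<lambda>i. lam $ i) (ctranspose b)"
    by (rule block_upper_inverse[OF b(2)]) (simp add: unitary_groupD[OF b(1)])
  then have "lam $ j \<noteq> lam $ i \<Longrightarrow> b $ i $ j = 0" for i j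
    using b(2) unfolding block_upper_def by (metis complex_cnj_zero_iff ctranspose_nth linorder_neqE_linordered_idom)
  then have "b $ i $ j * lam $ j = b $ i $ j * lam $ i" for i j
    by (metis mult_zero_left)
  then have "b ** i_diag lam = i_diag lam ** b"
    by (simp add: vec_eq_iff matrix_mult_i_diag i_diag_matrix_mult mult_ac)
  then show ?thesis
    by (simp add: conj_by_def matrix_mul_assoc[symmetric] unitary_groupD[OF b(1)])
qed

text \<open>Points of the orbit are flags: two frames give the same point exactly when their
  quotient stabilises the standard flag, and only one triangular half has to be checked.\<close>

lemma orbit_point_eq_iff:
  fixes g h :: "'n::finite cmat"
  assumes g: "g \<in> unitary_group" and h: "h \<in> unitary_group"
  shows "orbit_point lam g = orbit_point lam h \<longleftrightarrow> block_upper (\<lambda>i. lam $ i) (ctranspose g ** h)"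
proof
  assume "orbit_point lam g = orbit_point lam h"
  then have "g ** i_diag lam ** ctranspose g = h ** i_diag lam ** ctranspose h"
    by (simp add: orbit_point_unitary g h)
  then have "ctranspose g ** (g ** i_diag lam ** ctranspose g) ** h =
      ctranspose g ** (h ** i_diag lam ** ctranspose h) ** h"
    by simp
  then have *: "i_diag lam ** (ctranspose g ** h) = (ctranspose g ** h) ** i_diag lam"
    by (simp add: matrix_mul_assoc[symmetric] unitary_groupD[OF g] unitary_groupD[OF h])
  show "block_upper (\<lambda>i. lam $ i) (ctranspose g ** h)"
    unfolding block_upper_def
  proof (intro allI impI)
    fix i j assume "lam $ i < lam $ j"
    moreover have "(i_diag lam ** (ctranspose g ** h)) $ i $ j = ((ctranspose g ** h) ** i_diag lam) $ i $ j"
      using * by simp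
    ultimately show "(ctranspose g ** h) $ i $ j = 0"
      by (simp add: matrix_mult_i_diag i_diag_matrix_mult)
  qed
next
  assume "block_upper (\<lambda>i. lam $ i) (ctranspose g ** h)"
  then have "conj_by (ctranspose g ** h) (i_diag lam) = i_diag lam"
    by (intro block_upper_unitary_commute unitary_group_mult unitary_group_ctranspose g h)
  then have "conj_by g (conj_by (ctranspose g ** h) (i_diag lam)) = conj_by g (i_diag lam)"
    by simp
  moreover have "conj_by g (conj_by (ctranspose g ** h) X) = conj_by h X" for X
    by (simp add: conj_by_def ctranspose_mult matrix_mul_assoc[symmetric] unitary_groupD[OF g])
  ultimately show "orbit_point lam g = orbit_point lam h"
    by (simp add: orbit_point_conj_by g h)
qed

lemma upper_tri_block_upper_lam:
  assumes "\<forall>i j. i \<le> j \<longrightarrow> lam $ j \<le> lam $ i" "upper_tri c"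
  shows "block_upper (\<lambda>i. lam $ i) c"
  unfolding block_upper_def
proof (intro allI impI)
  fix i j assume "lam $ i < lam $ j"
  then have "j < i" using assms(1) by (meson leD not_le_imp_less)
  then show "c $ i $ j = 0" using assms(2) by (simp add: upper_tri_def)
qed

section \<open>Explicit gradient curves from the matrix exponential\<close>

definition flow_matrix :: "'n::finite cmat \<Rightarrow> real \<Rightarrow> 'n cmat" where
  "flow_matrix N t = matexp (i_times N) (speed TYPE('n) * t)"

lemma flow_matrix_0 [simp]: "flow_matrix N 0 = mat 1"
  by (simp add: flow_matrix_def)

lemma flow_matrix_deriv:
  fixes N :: "'n::finite cmat"
  shows "((\<lambda>t. flow_matrix N t ** w) has_vector_derivative
    (speed TYPE('n) *\<^sub>R i_times N) ** (flow_matrix N t ** w)) (at t)"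
proof -
  have "((\<lambda>t. flow_matrix N t ** w) has_vector_derivative
      flow_matrix N t ** 0 + speed TYPE('n) *\<^sub>R (i_times N ** flow_matrix N t) ** w) (at t)"
    unfolding flow_matrix_def by (intro has_vector_derivative_matrix_mult matexp_deriv_scaled has_vector_derivative_const)
  then show ?thesis by (simp add: matrix_algebra)
qed

lemma flow_matrix_inverse: "flow_matrix N (- t) ** flow_matrix N t = mat 1"
  by (simp add: flow_matrix_def matexp_minus)

lemma continuous_on_flow_matrix: "continuous_on S (flow_matrix N)"
  unfolding flow_matrix_def[abs_def]
  by (intro continuous_on_compose2[OF continuous_on_matexp[of UNIV]] continuous_intros) auto

text \<open>For the unitary QR factor \<open>G\<close>, the velocity
  \<open>K = ctranspose G ** G'\<close> is the rescaled \<open>A\<close> in the moving frame plus an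
  upper triangular matrix, and it is skew-Hermitian. So \<open>A\<close> prescribes \<open>K\<close>
  below the diagonal and skewness prescribes it above; the diagonal drops out of the commutator with
  \<open>i_diag lam\<close>.\<close>

lemma kahler_gradient_curve_exists:
  fixes lam :: "real^'n::{finite,linorder}" and N :: "'n cmat"
  assumes lam: "\<forall>i j. i \<le> j \<longrightarrow> lam $ j \<le> lam $ i" and N: "N \<in> skew_hermitian"
    and w: "w \<in> unitary_group"
  shows "\<exists>c. (\<forall>t. upper_tri (c t)) \<and> (\<forall>t j. c t $ j $ j \<in> \<real> \<and> 0 < Re (c t $ j $ j)) \<and>
    (\<forall>t. flow_matrix N t ** w ** c t \<in> unitary_group) \<and>
    kahler_gradient_curve lam (\<lambda>L. Re (trace (L ** N))) (\<lambda>t. orbit_point lam (flow_matrix N t ** w ** c t)) \<and>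
    orbit_point lam (flow_matrix N 0 ** w ** c 0) = orbit_point lam w"
proof -
  define s where "s = speed TYPE('n)"
  define A where "A = i_times N"
  define M where "M t = flow_matrix N t ** w" for t
  have M_deriv: "(M has_vector_derivative (s *\<^sub>R A) ** M t) (at t)" for t
    unfolding M_def[abs_def] s_def A_def by (rule flow_matrix_deriv)
  have M_inv: "(ctranspose w ** flow_matrix N (- t)) ** M t = mat 1" for t
  proof -
    have "(ctranspose w ** flow_matrix N (- t)) ** M t =
        ctranspose w ** ((flow_matrix N (- t) ** flow_matrix N t) ** w)"
      by (simp only: M_def matrix_mul_assoc)
    then show ?thesis
      by (simp only: flow_matrix_inverse matrix_mul_lid unitary_groupD[OF w])
  qed
  obtain c c' where c_deriv: "\<And>t. (c has_vector_derivative c' t) (at t)" and c_tri: "\<And>t. upper_tri (c t)"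
    and c_pos: "\<And>t j. c t $ j $ j \<in> \<real> \<and> 0 < Re (c t $ j $ j)" and G_uni: "\<And>t. M t ** c t \<in> unitary_group"
    using smooth_qr[OF M_deriv M_inv] by blast
  define G where "G t = M t ** c t" for t
  have G: "G t \<in> unitary_group" for t
    unfolding G_def by (rule G_uni)
  have c'_tri: "upper_tri (c' t)" for t
    unfolding upper_tri_def
  proof (intro allI impI)
    fix i j :: 'n assume "j < i"
    then have "((\<lambda>t. c t $ i $ j) has_vector_derivative 0) (at t)"
      using c_tri by (simp add: upper_tri_def)
    then show "c' t $ i $ j = 0"
      using has_vector_derivative_vec_nth[OF has_vector_derivative_vec_nth[OF c_deriv[of t]]]
        vector_derivative_unique_at by metis
  qed
  have "kahler_grad (\<lambda>L. Re (trace (L ** N))) (orbit_point lam (G t)) = kg \<Longrightarrow>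
      ((\<lambda>t. orbit_point lam (G t)) has_vector_derivative kg) (at t)" for t kg
  proof -
    assume kg: "kahler_grad (\<lambda>L. Re (trace (L ** N))) (orbit_point lam (G t)) = kg"
    define X where "X = ctranspose (G t) ** M t ** c' t"
    define G' where "G' = (s *\<^sub>R A) ** G t + M t ** c' t"
    define K where "K = ctranspose (G t) ** G'"
    define A0 where "A0 = conj_by (ctranspose (G t)) A"
    have G_deriv: "(G has_vector_derivative G') (at t)"
      using has_vector_derivative_matrix_mult[OF M_deriv c_deriv]
      unfolding G_def[abs_def] G'_def by (simp add: matrix_mul_assoc add.commute)
    have G'K: "G' = G t ** K"
      by (simp add: K_def unitary_groupD[OF G])
    have "(ctranspose (G t) ** M t) ** c t = mat 1"
      using unitary_groupD(2)[OF G[of t]] by (simp add: G_def matrix_mul_assoc)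
    then have "upper_tri (ctranspose (G t) ** M t)"
      by (rule upper_tri_inverse[OF c_tri])
    then have X_tri: "upper_tri X"
      unfolding X_def by (rule upper_tri_mult[OF _ c'_tri])
    have K_eq: "K = s *\<^sub>R A0 + X"
      by (simp add: K_def G'_def A0_def X_def conj_by_def matrix_algebra)
    have ct_deriv: "((\<lambda>t. ctranspose (G t)) has_vector_derivative ctranspose G') (at t)"
      by (rule bounded_linear.has_vector_derivative[OF bounded_linear_ctranspose G_deriv])
    have "((\<lambda>t. ctranspose (G t) ** G t) has_vector_derivative
        ctranspose (G t) ** G' + ctranspose G' ** G t) (at t)"
      by (rule has_vector_derivative_matrix_mult[OF ct_deriv G_deriv])
    then have "((\<lambda>t. mat 1 :: 'n cmat) has_vector_derivative
        ctranspose (G t) ** G' + ctranspose G' ** G t) (at t)"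
      by (simp add: unitary_groupD(2)[OF G])
    then have "ctranspose (G t) ** G' + ctranspose G' ** G t = 0"
      by (rule vector_derivative_unique_at[OF _ has_vector_derivative_const])
    then have K_skew: "K + ctranspose K = 0"
      by (simp add: K_def ctranspose_mult)
    then have K_skew': "K $ j $ k = - cnj (K $ k $ j)" for j k
      by (simp add: vec_eq_iff eq_neg_iff_add_eq_0)
    have "((\<lambda>t. G t ** i_diag lam ** ctranspose (G t)) has_vector_derivative
        G t ** i_diag lam ** ctranspose G' + (G t ** 0 + G' ** i_diag lam) ** ctranspose (G t)) (at t)"
      by (intro has_vector_derivative_matrix_mult ct_deriv G_deriv has_vector_derivative_const)
    moreover have "G t ** i_diag lam ** ctranspose G' + (G t ** 0 + G' ** i_diag lam) ** ctranspose (G t) =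
        conj_by (G t) (ad K (i_diag lam))"
    proof -
      have "ctranspose K = - K" using K_skew by (simp add: eq_neg_iff_add_eq_0 add.commute)
      then show ?thesis
        by (simp add: G'K ad_def conj_by_def ctranspose_mult matrix_algebra)
    qed
    moreover have "ad K (i_diag lam) = (- s) *\<^sub>R scale_gaps lam gap_abs (conj_by (ctranspose (G t)) N)"
    proof -
      have A0: "A0 = i_times (conj_by (ctranspose (G t)) N)"
        by (simp add: A0_def A_def i_times_conj_by)
      define N0 where "N0 = conj_by (ctranspose (G t)) N"
      have N0: "N0 \<in> skew_hermitian"
        unfolding N0_def by (rule conj_by_skew_hermitian[OF N])
      have below: "K $ j $ k = s * (\<i> * N0 $ j $ k)" if "k < j" for j k
        using X_tri that by (simp add: K_eq upper_tri_def A0 i_times_nth N0_def scaleR_conv_of_real[where 'a=complex])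
      have above: "K $ j $ k = - (s * (\<i> * N0 $ j $ k))" if "j < k" for j k
        using below[OF that] N0 unfolding K_skew'[of j k] by (simp add: skew_hermitian_iff)
      \<comment> \<open>As \<open>lam\<close> decreases, the sign of the gap is the sign that
        \<open>K\<close> carries on that side of the diagonal; together they form the absolute value
        in the gradient.\<close>
      have "K $ j $ k * (\<i> * complex_of_real (lam $ k - lam $ j)) =
          - s * (complex_of_real \<bar>lam $ j - lam $ k\<bar> * N0 $ j $ k)" for j k
      proof (cases j k rule: linorder_cases)
        case less
        then have "\<bar>lam $ j - lam $ k\<bar> = lam $ j - lam $ k" using lam by simp
        then show ?thesis by (simp add: above[OF less] algebra_simps)
      next
        case greater
        then have "\<bar>lam $ j - lam $ k\<bar> = lam $ k - lam $ j" using lam by simp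
        then show ?thesis by (simp add: below[OF greater] algebra_simps)
      qed simp
      then show ?thesis
        unfolding N0_def[symmetric]
        by (simp add: vec_eq_iff ad_def matrix_mult_i_diag i_diag_matrix_mult scale_gaps_nth scaleR_conv_of_real[where 'a=complex]
            algebra_simps)
    qed
    ultimately show ?thesis
      unfolding kg[symmetric] kahler_grad_orbit_point[OF G N]
      unfolding orbit_point_unitary[OF G] s_def[symmetric]
      by (simp only:)
  qed
  then have curve: "kahler_gradient_curve lam (\<lambda>L. Re (trace (L ** N))) (\<lambda>t. orbit_point lam (G t))"
    unfolding kahler_gradient_curve_def orbit_def using G by blast
  have c0: "orbit_point lam (G 0) = orbit_point lam w"
  proof -
    have "ctranspose w ** G 0 = c 0"
      by (simp add: G_def M_def unitary_groupD[OF w])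
    then show ?thesis
      using orbit_point_eq_iff[OF w G, of lam 0] upper_tri_block_upper_lam[OF lam c_tri] by simp
  qed
  show ?thesis
    by (intro exI[of _ c] conjI allI c_tri c_pos[THEN conjunct1] c_pos[THEN conjunct2]
        G[unfolded G_def M_def] curve[unfolded G_def M_def] c0[unfolded G_def M_def])
qed

section \<open>Spectral projections and uniqueness of the moving flag\<close>

text \<open>Evaluates the real polynomial with coefficient list \<open>as\<close> at the Hermitian matrix \<open>- \<i> X\<close>.\<close>

primrec matpoly :: "real list \<Rightarrow> 'n::finite cmat \<Rightarrow> 'n cmat" where
  "matpoly [] X = 0"
| "matpoly (a # as) X = a *\<^sub>R mat 1 + (\<chi> j k. - \<i> * (X ** matpoly as X) $ j $ k)"

lemma real_poly_interpolation:
  fixes f :: "real \<Rightarrow> real"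
  assumes "finite S" shows "\<exists>p. \<forall>x\<in>S. poly p x = f x"
  using assms
proof (induction S rule: finite_induct)
  case (insert a S)
  then obtain p where p: "\<forall>x\<in>S. poly p x = f x" by blast
  define q where "q = (\<Prod>s\<in>S. [:- s, 1:])"
  have q0: "poly q x = 0" if "x \<in> S" for x
    using that insert.hyps(1) by (auto simp: q_def poly_prod)
  have qa: "poly q a \<noteq> 0"
    using insert.hyps by (auto simp: q_def poly_prod)
  have "poly (p + smult ((f a - poly p a) / poly q a) q) x = f x" if "x \<in> insert a S" for x
    using that p q0[of x] qa by auto
  then show ?case by blast
qed simp

definition real_diag :: "('n::finite \<Rightarrow> real) \<Rightarrow> 'n cmat" where
  "real_diag d = (\<chi> j k. if j = k then of_real (d j) else 0)"

lemma real_diag_mult: "(real_diag d ** X) $ j $ k = of_real (d j) * X $ j $ k"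
  by (simp add: real_diag_def matrix_mult_nth if_distrib if_distribR cong: if_cong)

lemma mult_real_diag: "(X ** real_diag d) $ j $ k = of_real (d k) * X $ j $ k"
  by (simp add: real_diag_def matrix_mult_nth if_distrib cong: if_cong)

lemma matpoly_conj_by:
  fixes g :: "'n::finite cmat"
  assumes g: "g \<in> unitary_group"
  shows "matpoly as (conj_by g (i_diag lam)) = conj_by g (real_diag (\<lambda>j. poly (Poly as) (lam $ j)))"
proof (induction as)
  case Nil
  have "real_diag (\<lambda>j. 0) = (0 :: 'n cmat)" by (simp add: real_diag_def vec_eq_iff)
  then show ?case by (simp add: linear_0[OF linear_conj_by])
next
  case (Cons a as)
  let ?D = "real_diag (\<lambda>j. poly (Poly as) (lam $ j))"
  have "conj_by g (\<chi> j k. - \<i> * Y $ j $ k) = (\<chi> j k. - \<i> * conj_by g Y $ j $ k)" for Y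
    by (simp add: vec_eq_iff conj_by_def matrix_mult_nth sum_distrib_left sum_distrib_right mult_ac sum_negf)
  then have "matpoly (a # as) (conj_by g (i_diag lam)) =
      a *\<^sub>R mat 1 + conj_by g (\<chi> j k. - \<i> * (i_diag lam ** ?D) $ j $ k)"
    by (simp add: Cons conj_by_mult[OF g])
  also have "a *\<^sub>R mat 1 = conj_by g (a *\<^sub>R mat 1)"
    by (simp add: conj_by_def matrix_algebra unitary_groupD[OF g])
  also have "\<dots> + conj_by g (\<chi> j k. - \<i> * (i_diag lam ** ?D) $ j $ k) =
      conj_by g (a *\<^sub>R mat 1 + (\<chi> j k. - \<i> * (i_diag lam ** ?D) $ j $ k))"
    by (simp only: conj_by_add)
  also have "a *\<^sub>R mat 1 + (\<chi> j k. - \<i> * (i_diag lam ** ?D) $ j $ k) =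
      real_diag (\<lambda>j. poly (Poly (a # as)) (lam $ j))"
    by (simp add: vec_eq_iff i_diag_matrix_mult real_diag_def mat_def scaleR_conv_of_real[where 'a=complex])
      (simp add: complex_eq_iff)
  finally show ?case .
qed

text \<open>\<open>ad K\<close> is a derivation of the matrix product, so the commutator equation is
  inherited by polynomials. Interpolation makes a spectral projection one of these, which avoids
  differentiating eigenvectors.\<close>

lemma matpoly_commutator_deriv:
  assumes X: "(X has_vector_derivative ad K (X t)) (at t)"
  shows "((\<lambda>t. matpoly as (X t)) has_vector_derivative ad K (matpoly as (X t))) (at t)"
proof (induction as)
  case Nil
  then show ?case by (simp add: ad_def matrix_algebra)
next
  case (Cons a as)
  let ?Y = "\<lambda>t. matpoly as (X t)"
  have lin: "bounded_linear (\<lambda>Y :: 'a cmat. (\<chi> j k. - \<i> * Y $ j $ k) :: 'a cmat)"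
    by (intro linear_conv_bounded_linear[THEN iffD1] linearI) (simp_all add: vec_eq_iff algebra_simps)
  have i_mult: "K ** (\<chi> j k. - \<i> * Z $ j $ k) = (\<chi> j k. - \<i> * (K ** Z) $ j $ k)"
    "(\<chi> j k. - \<i> * Z $ j $ k) ** K = (\<chi> j k. - \<i> * (Z ** K) $ j $ k)" for Z
    by (simp_all add: vec_eq_iff matrix_mult_nth sum_distrib_left mult_ac sum_negf)
  have "((\<lambda>t. X t ** ?Y t) has_vector_derivative X t ** ad K (?Y t) + ad K (X t) ** ?Y t) (at t)"
    by (rule has_vector_derivative_matrix_mult[OF X Cons])
  also have "X t ** ad K (?Y t) + ad K (X t) ** ?Y t = ad K (X t ** ?Y t)"
    by (simp add: ad_def matrix_algebra)
  finally have "((\<lambda>t. a *\<^sub>R mat 1 + (\<chi> j k. - \<i> * (X t ** ?Y t) $ j $ k)) has_vector_derivative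
      0 + (\<chi> j k. - \<i> * ad K (X t ** ?Y t) $ j $ k)) (at t)"
    by (intro has_vector_derivative_add has_vector_derivative_const bounded_linear.has_vector_derivative[OF lin])
  moreover have "0 + (\<chi> j k. - \<i> * ad K (X t ** ?Y t) $ j $ k) = ad K (matpoly (a # as) (X t))"
    unfolding ad_def matpoly.simps matrix_mult_add_left matrix_mult_add_right i_mult
    by (simp add: vec_eq_iff matrix_algebra algebra_simps)
  ultimately show ?case by simp
qed

text \<open>A Gronwall argument: the growth rate of |Z|^2 is at most \<open>c\<close>, by
  Cauchy-Schwarz and the constant \<open>K\<close> of matrix multiplication, so damping by exp (- c
  s) makes it nonincreasing.\<close>

lemma linear_matrix_ode_zero:
  fixes Z B :: "real \<Rightarrow> 'n::finite cmat"
  assumes Z: "\<And>t. (Z has_vector_derivative B t ** Z t) (at t)" and B: "\<And>t. norm (B t) \<le> C"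
    and Z0: "Z 0 = 0" and t: "0 \<le> t"
  shows "Z t = 0"
proof -
  obtain K where K: "0 < K" "\<And>(a :: 'n cmat) (b :: 'n cmat). norm (a ** b) \<le> norm a * norm b * K"
    using bounded_bilinear.pos_bounded[OF bounded_bilinear_matrix_mult] by blast
  define c where "c = 2 * (C * K)"
  define \<phi> where "\<phi> s = exp (- c * s) * (Z s \<bullet> Z s)" for s
  have C0: "0 \<le> C" using B[of 0] norm_ge_zero order_trans by blast
  have "\<phi> t \<le> \<phi> 0"
  proof (rule DERIV_nonpos_imp_nonincreasing[OF t])
    fix s
    have "((\<lambda>s. Z s \<bullet> Z s) has_vector_derivative Z s \<bullet> (B s ** Z s) + (B s ** Z s) \<bullet> Z s) (at s)"
      by (rule bounded_bilinear.has_vector_derivative[OF bounded_bilinear_inner Z Z])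
    then have "((\<lambda>s. Z s \<bullet> Z s) has_real_derivative 2 * (Z s \<bullet> (B s ** Z s))) (at s)"
      by (simp add: has_real_derivative_iff_has_vector_derivative inner_commute)
    then have "(\<phi> has_real_derivative exp (- c * s) * (2 * (Z s \<bullet> (B s ** Z s)) - c * (Z s \<bullet> Z s))) (at s)"
      unfolding \<phi>_def[abs_def] by (auto intro!: derivative_eq_intros simp: algebra_simps)
    moreover have "2 * (Z s \<bullet> (B s ** Z s)) \<le> c * (Z s \<bullet> Z s)"
    proof -
      have "Z s \<bullet> (B s ** Z s) \<le> norm (Z s) * norm (B s ** Z s)"
        by (rule norm_cauchy_schwarz)
      also have "\<dots> \<le> norm (Z s) * (norm (B s) * norm (Z s) * K)"
        by (intro mult_left_mono[OF K(2)]) auto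
      also have "\<dots> \<le> norm (Z s) * (C * norm (Z s) * K)"
        using B K(1) by (intro mult_left_mono mult_right_mono) auto
      also have "\<dots> = C * K * (Z s \<bullet> Z s)"
        by (simp add: dot_square_norm power2_eq_square)
      finally show ?thesis by (simp add: c_def)
    qed
    then have "exp (- c * s) * (2 * (Z s \<bullet> (B s ** Z s)) - c * (Z s \<bullet> Z s)) \<le> 0"
      by (simp add: mult_le_0_iff)
    ultimately show "\<exists>y. (\<phi> has_real_derivative y) (at s) \<and> y \<le> 0" by blast
  qed
  then have "exp (- c * t) * (Z t \<bullet> Z t) \<le> 0"
    by (simp add: \<phi>_def Z0)
  then have "Z t \<bullet> Z t \<le> 0" by (simp add: mult_le_0_iff)
  then show ?thesis by (metis inner_eq_zero_iff inner_ge_zero order_antisym)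
qed

text \<open>The spectral projection \<open>P\<close> of a gradient curve satisfies
  \<open>P' = (1 - P) A P + P A (1 - P)\<close> up to the speed, so \<open>(1 - P(t)) exp(t A) P(0)\<close> solves a linear
  equation and vanishes identically.\<close>

lemma kahler_gradient_curve_flag:
  fixes lam :: "real^'n::finite" and N :: "'n cmat"
  assumes curve: "kahler_gradient_curve lam (\<lambda>L. Re (trace (L ** N))) L" and N: "N \<in> skew_hermitian"
    and w: "w \<in> unitary_group" "L 0 = orbit_point lam w"
    and g: "g \<in> unitary_group" "L t = orbit_point lam g" and t: "0 \<le> t"
  shows "block_upper (\<lambda>i. lam $ i) (ctranspose g ** flow_matrix N t ** w)"
  unfolding block_upper_def
proof (intro allI impI)
  fix i j assume ij: "lam $ i < lam $ j"
  define s where "s = speed TYPE('n)"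
  define A where "A = i_times N"
  \<comment> \<open>The indicator of the eigenvalues that are at least \<open>lam $ j\<close>.
    \<open>D\<close> and \<open>P t\<close> project onto the corresponding eigenspaces of the
    diagonal point and of \<open>L t\<close>, and the entry in question lies in the block cut out by
    \<open>mat 1 - D\<close> and \<open>D\<close>.\<close>
  define d where "d i = (if lam $ j \<le> lam $ i then 1 else 0 :: real)" for i
  define D where "D = real_diag d"
  obtain p where p: "\<forall>x\<in>range (\<lambda>i. lam $ i). poly p x = (if lam $ j \<le> x then 1 else 0)"
    using real_poly_interpolation[of "range (\<lambda>i. lam $ i)" "\<lambda>x. if lam $ j \<le> x then 1 else 0"] by auto
  have D_poly: "real_diag (\<lambda>i. poly (Poly (coeffs p)) (lam $ i)) = D"
    using p by (simp add: D_def real_diag_def d_def cong: if_cong)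
  define P where "P t = matpoly (coeffs p) (L t)" for t
  have P_conj: "P t = conj_by h D" if "h \<in> unitary_group" "L t = orbit_point lam h" for h t
    unfolding P_def that(2) orbit_point_conj_by[OF that(1)] matpoly_conj_by[OF that(1)] D_poly ..
  have "\<forall>t. \<exists>h. h \<in> unitary_group \<and> L t = orbit_point lam h"
    using curve by (auto simp: kahler_gradient_curve_def orbit_def)
  from choice[OF this] obtain h where "\<forall>t. h t \<in> unitary_group \<and> L t = orbit_point lam (h t)"
    by (elim exE)
  then have h: "\<And>t. h t \<in> unitary_group" "\<And>t. L t = orbit_point lam (h t)" by blast+
  have DD: "D ** D = D"
    by (auto simp: vec_eq_iff real_diag_mult D_def) (auto simp: real_diag_def d_def)
  have P_idem: "P t ** P t = P t" for t
    by (simp add: P_conj[OF h] conj_by_mult[OF h(1)] DD)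
  have P_deriv: "(P has_vector_derivative s *\<^sub>R ((mat 1 - P t) ** A ** P t + P t ** A ** (mat 1 - P t))) (at t)" for t
  proof -
    define A0 where "A0 = conj_by (ctranspose (h t)) A"
    define K0 where "K0 = scale_gaps lam (\<lambda>x. - complex_of_real (s * sgn x)) A0"
    have grad: "kahler_grad (\<lambda>L. Re (trace (L ** N))) (L t) = ad (conj_by (h t) K0) (L t)"
      unfolding K0_def s_def A0_def A_def h(2)[of t] by (rule kahler_grad_commutator[OF h(1) N])
    have "(L has_vector_derivative ad (conj_by (h t) K0) (L t)) (at t)"
      using curve unfolding kahler_gradient_curve_def grad[symmetric] by (elim allE conjE)
    from matpoly_commutator_deriv[OF this, of "coeffs p"]
    have "(P has_vector_derivative ad (conj_by (h t) K0) (P t)) (at t)"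
      by (simp add: P_def[abs_def])
    moreover have "ad (conj_by (h t) K0) (P t) = conj_by (h t) (ad K0 D)"
      by (simp add: P_conj[OF h] ad_conj_by[OF h(1)])
    moreover have "ad K0 D = s *\<^sub>R ((mat 1 - D) ** A0 ** D + D ** A0 ** (mat 1 - D))"
    proof -
      \<comment> \<open>If \<open>d a\<close> and \<open>d b\<close> differ, the threshold separates
        the two eigenvalues, so the sign of the gap is known and cancels the sign of
        \<open>d b - d a\<close>.\<close>
      have "K0 $ a $ b * of_real (d b - d a) = of_real (s * ((1 - d a) * d b + d a * (1 - d b))) * A0 $ a $ b" for a b
        by (auto simp: K0_def scale_gaps_nth d_def)
      moreover have "((mat 1 - D) ** A0 ** D + D ** A0 ** (mat 1 - D)) $ a $ b =
          of_real ((1 - d a) * d b + d a * (1 - d b)) * A0 $ a $ b" for a b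
        by (simp add: matrix_diff_ldistrib matrix_diff_rdistrib D_def mult_real_diag real_diag_mult algebra_simps)
      moreover have "ad K0 D $ a $ b = K0 $ a $ b * of_real (d b - d a)" for a b
        by (simp add: ad_def D_def mult_real_diag real_diag_mult algebra_simps)
      ultimately show ?thesis
        by (simp add: vec_eq_iff scaleR_conv_of_real[where 'a=complex])
    qed
    moreover have "conj_by (h t) (s *\<^sub>R ((mat 1 - D) ** A0 ** D + D ** A0 ** (mat 1 - D))) =
        s *\<^sub>R ((mat 1 - P t) ** A ** P t + P t ** A ** (mat 1 - P t))"
    proof -
      have A_conj: "A = conj_by (h t) A0" by (simp add: A0_def conj_by_inverse[OF h(1)])
      have one: "mat 1 - P t = conj_by (h t) (mat 1 - D)"
        by (simp add: P_conj[OF h] conj_by_diff) (simp add: conj_by_def unitary_groupD[OF h(1)])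
      show ?thesis
        unfolding one by (simp only: P_conj[OF h] A_conj conj_by_mult[OF h(1)] conj_by_add conj_by_scaleR)
    qed
    ultimately show ?thesis by simp
  qed
  define E where "E t = flow_matrix N t ** P 0" for t
  define Z where "Z t = (mat 1 - P t) ** E t" for t
  \<comment> \<open>Idempotence of \<open>P\<close> allows the factor \<open>mat 1 - P t\<close> to
    be split off the derivative of \<open>Z\<close>; this is the remaining coefficient.\<close>
  define B where "B t = s *\<^sub>R ((mat 1 - P t) ** A - P t ** A)" for t
  have E_deriv: "(E has_vector_derivative (s *\<^sub>R A) ** E t) (at t)" for t
    unfolding E_def[abs_def] s_def A_def by (rule flow_matrix_deriv)
  have Z_deriv: "(Z has_vector_derivative B t ** Z t) (at t)" for t
  proof -
    have "(Z has_vector_derivative (mat 1 - P t) ** ((s *\<^sub>R A) ** E t) +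
        (0 - s *\<^sub>R ((mat 1 - P t) ** A ** P t + P t ** A ** (mat 1 - P t))) ** E t) (at t)"
      unfolding Z_def[abs_def]
      by (intro has_vector_derivative_matrix_mult has_vector_derivative_diff has_vector_derivative_const
          P_deriv E_deriv)
    moreover have "P t ** (P t ** X) = P t ** X" for X
      by (simp add: matrix_mul_assoc P_idem)
    then have "(mat 1 - P t) ** ((s *\<^sub>R A) ** E t) +
        (0 - s *\<^sub>R ((mat 1 - P t) ** A ** P t + P t ** A ** (mat 1 - P t))) ** E t = B t ** Z t"
      by (simp only: B_def Z_def matrix_algebra matrix_mul_lid matrix_mul_rid)
        (simp add: algebra_simps)
    ultimately show ?thesis by simp
  qed
  \<comment> \<open>\<open>B\<close> depends on time only through a unitary frame, so compactness of
    the unitary group gives the uniform bound for the Gronwall estimate.\<close>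
  have "bounded (range B)"
  proof -
    have "continuous_on unitary_group (\<lambda>h. s *\<^sub>R ((mat 1 - conj_by h D) ** A - conj_by h D ** A))"
      unfolding conj_by_def
      by (intro continuous_intros bounded_linear.continuous_on[OF bounded_linear_ctranspose])
    then have "bounded ((\<lambda>h. s *\<^sub>R ((mat 1 - conj_by h D) ** A - conj_by h D ** A)) ` unitary_group)"
      by (intro compact_imp_bounded compact_continuous_image compact_unitary_group)
    moreover have "range B \<subseteq> (\<lambda>h. s *\<^sub>R ((mat 1 - conj_by h D) ** A - conj_by h D ** A)) ` unitary_group"
      using h(1) P_conj[OF h] by (auto simp: B_def)
    ultimately show ?thesis by (rule bounded_subset)
  qed
  then obtain C where C: "\<And>t. norm (B t) \<le> C"
    unfolding bounded_iff by auto
  have "Z 0 = 0"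
    by (simp add: Z_def E_def matrix_algebra P_idem)
  then have "Z t = 0"
    by (rule linear_matrix_ode_zero[OF Z_deriv C _ t])
  moreover have "Z t = g ** ((mat 1 - D) ** (ctranspose g ** flow_matrix N t ** w) ** D) ** ctranspose w"
    using unitary_groupD(1)[OF g(1)]
    by (simp add: Z_def E_def P_conj[OF g] P_conj[OF w] conj_by_def matrix_algebra unitary_groupD[OF g(1)])
  ultimately have "ctranspose g ** (g ** ((mat 1 - D) ** (ctranspose g ** flow_matrix N t ** w) ** D) ** ctranspose w) ** w = 0"
    by (simp add: matrix_zero_left matrix_zero_right)
  then have "(mat 1 - D) ** (ctranspose g ** flow_matrix N t ** w) ** D = 0"
    by (simp only: matrix_mul_assoc[symmetric] unitary_groupD[OF g(1)] unitary_groupD[OF w(1)] matrix_mul_rid)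
  then have "((mat 1 - D) ** (ctranspose g ** flow_matrix N t ** w) ** D) $ i $ j = 0"
    by simp
  then show "(ctranspose g ** flow_matrix N t ** w) $ i $ j = 0"
    using ij by (simp add: D_def mult_real_diag real_diag_mult matrix_diff_rdistrib d_def)
qed

subsection \<open>Nonnegative representatives and the sufficient condition\<close>

definition unitary_nonneg :: "'n::{finite,linorder} cmat set" where
  "unitary_nonneg = {g \<in> unitary_group. \<forall>I. left_minor g I \<in> \<real> \<and> 0 \<le> Re (left_minor g I)}"

lemma compact_unitary_nonneg: "compact (unitary_nonneg :: 'n::{finite,linorder} cmat set)"
proof -
  have closed: "closed {g :: 'n cmat. \<forall>I. Im (left_minor g I) = 0 \<and> 0 \<le> Re (left_minor g I)}"
    by (intro closed_Collect_all closed_Collect_conj closed_Collect_eq closed_Collect_le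
        continuous_intros continuous_on_left_minor)
  have eq: "unitary_nonneg =
      unitary_group \<inter> {g :: 'n cmat. \<forall>I. Im (left_minor g I) = 0 \<and> 0 \<le> Re (left_minor g I)}"
    by (auto simp: unitary_nonneg_def complex_is_Real_iff)
  show ?thesis
    unfolding eq by (rule compact_Int_closed[OF compact_unitary_group closed])
qed

lemma continuous_on_orbit_point: "continuous_on unitary_group (orbit_point lam)"
proof -
  have "continuous_on unitary_group (\<lambda>g. g ** i_diag lam ** ctranspose g)"
    by (intro continuous_intros bounded_linear.continuous_on[OF bounded_linear_ctranspose])
  then show ?thesis
    by (rule continuous_on_eq) (simp add: orbit_point_unitary)
qed

text \<open>The image of the compact set \<open>unitary_nonneg\<close> is closed and contains
  \<open>orbit_pos\<close>. The converse inclusion needs a flow and follows in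
  \<open>orbit_point_nonneg\<close>.\<close>

lemma orbit_nonneg_subset: "orbit_nonneg lam \<subseteq> orbit_point lam ` unitary_nonneg"
  unfolding orbit_nonneg_def
proof (rule closure_minimal)
  show "orbit_pos lam \<subseteq> orbit_point lam ` unitary_nonneg"
    unfolding orbit_pos_def by (rule image_mono) (auto simp: unitary_pos_def unitary_nonneg_def less_imp_le)
  have "unitary_nonneg \<subseteq> (unitary_group :: 'a cmat set)"
    by (auto simp: unitary_nonneg_def)
  then show "closed (orbit_point lam ` unitary_nonneg)"
    by (intro compact_imp_closed compact_continuous_image compact_unitary_nonneg
        continuous_on_subset[OF continuous_on_orbit_point])
qed

lemma flow_unitary_pos:
  fixes N :: "'n::{finite,linorder} cmat"
  assumes tri: "tri_positive (i_times N)" and w: "w \<in> unitary_nonneg" and t: "0 < t"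
    and c: "upper_tri c" "\<And>j. c $ j $ j \<in> \<real> \<and> 0 < Re (c $ j $ j)"
    and uni: "flow_matrix N t ** w ** c \<in> unitary_group"
  shows "flow_matrix N t ** w ** c \<in> unitary_pos"
proof -
  have s: "0 < speed TYPE('n)" by (simp add: speed_def)
  have tri': "tri_positive (speed TYPE('n) *\<^sub>R i_times N)"
    using tri s by (simp add: tri_positive_def real_tridiagonal_def scaleR_conv_of_real[where 'a=complex] mult_pos_neg)
  have wu: "w \<in> unitary_group" using w by (simp add: unitary_nonneg_def)
  have pos: "left_minor (flow_matrix N t ** w) I \<in> \<real> \<and> 0 < Re (left_minor (flow_matrix N t ** w) I)" for I
    by (rule left_minor_flow_positive[OF flow_matrix_deriv tri', of w "ctranspose w"])
      (use w t wu in \<open>simp_all add: unitary_nonneg_def unitary_groupD\<close>)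
  have "left_minor (flow_matrix N t ** w ** c) I \<in> \<real> \<and> 0 < Re (left_minor (flow_matrix N t ** w ** c) I)" for I
  proof -
    have "(\<Prod>b<k. c $ col_of b $ col_of b) \<in> \<real> \<and> 0 < Re (\<Prod>b<k. c $ col_of b $ col_of b)" for k
      using c(2) by (induction k) (auto simp: complex_is_Real_iff)
    then show ?thesis
      unfolding left_minor_mult_upper_tri[OF c(1)] using pos[of I] by (auto simp: complex_is_Real_iff)
  qed
  then show ?thesis
    using uni by (simp add: unitary_pos_def)
qed

text \<open>An arbitrary gradient curve has at time \<open>t\<close> the same flag as the
  exponential flow, hence equals the point given by the QR factor, which is a positive
  matrix.\<close>

lemma tri_positive_preserves_positivity:
  fixes lam :: "real^'n::{finite,linorder}" and N :: "'n cmat"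
  assumes lam: "\<forall>i j. i \<le> j \<longrightarrow> lam $ j \<le> lam $ i" and N: "N \<in> skew_hermitian"
    and tri: "tri_positive (i_times N)"
  shows "kahler_flow_strictly_preserves_positivity lam (\<lambda>L. Re (trace (L ** N)))"
  unfolding kahler_flow_strictly_preserves_positivity_def
proof (intro allI impI, elim conjE)
  fix L and t :: real
  assume curve: "kahler_gradient_curve lam (\<lambda>L. Re (trace (L ** N))) L" and L0: "L 0 \<in> orbit_nonneg lam"
    and t: "0 < t"
  obtain w where w: "w \<in> unitary_nonneg" "L 0 = orbit_point lam w"
    using L0 orbit_nonneg_subset by blast
  have wu: "w \<in> unitary_group" using w by (simp add: unitary_nonneg_def)
  obtain c where c: "\<forall>t. upper_tri (c t)" "\<forall>t j. c t $ j $ j \<in> \<real> \<and> 0 < Re (c t $ j $ j)"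
    "\<forall>t. flow_matrix N t ** w ** c t \<in> unitary_group"
    and curve_c: "kahler_gradient_curve lam (\<lambda>L. Re (trace (L ** N))) (\<lambda>t. orbit_point lam (flow_matrix N t ** w ** c t))"
    and c0: "orbit_point lam (flow_matrix N 0 ** w ** c 0) = orbit_point lam w"
    using kahler_gradient_curve_exists[OF lam N wu] by (elim exE conjE)
  note c = c(1)[rule_format] c(2)[rule_format] c(3)[rule_format]
  obtain g where g: "g \<in> unitary_group" "L t = orbit_point lam g"
    using curve by (auto simp: kahler_gradient_curve_def orbit_def)
  have "block_upper (\<lambda>i. lam $ i) (ctranspose g ** flow_matrix N t ** w)"
    by (rule kahler_gradient_curve_flag[OF curve N wu w(2) g]) (use t in simp)
  then have "block_upper (\<lambda>i. lam $ i) (ctranspose g ** flow_matrix N t ** w ** c t)"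
    by (rule block_upper_mult[OF _ upper_tri_block_upper_lam[OF lam c(1)]])
  then have "orbit_point lam g = orbit_point lam (flow_matrix N t ** w ** c t)"
    unfolding orbit_point_eq_iff[OF g(1) c(3)] by (simp only: matrix_mul_assoc)
  moreover have "flow_matrix N t ** w ** c t \<in> unitary_pos"
    by (rule flow_unitary_pos[OF tri w(1) t c(1) c(2) c(3)])
  ultimately show "L t \<in> orbit_pos lam"
    unfolding orbit_pos_def g(2) by simp
qed

text \<open>The flow of one fixed tridiagonal matrix moves a nonnegative representative into the positive
  part, so that nonnegative representatives are limits of positive ones.\<close>

lemma orbit_point_nonneg:
  fixes lam :: "real^'n::{finite,linorder}"
  assumes lam: "\<forall>i j. i \<le> j \<longrightarrow> lam $ j \<le> lam $ i" and w: "w \<in> unitary_nonneg"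
  shows "orbit_point lam w \<in> orbit_nonneg lam"
proof -
  \<comment> \<open>Chosen so that \<open>i_times N\<close> has ones next to the diagonal and zeros
    elsewhere.\<close>
  define N :: "'n cmat" where "N = (\<chi> j k. if adjacent j k then - \<i> else 0)"
  have N: "N \<in> skew_hermitian"
    by (simp add: skew_hermitian_iff N_def adjacent_commute)
  have tri: "tri_positive (i_times N)"
    by (simp add: tri_positive_def real_tridiagonal_def i_times_nth N_def)
  have wu: "w \<in> unitary_group" using w by (simp add: unitary_nonneg_def)
  obtain c where c: "\<forall>t. upper_tri (c t)" "\<forall>t j. c t $ j $ j \<in> \<real> \<and> 0 < Re (c t $ j $ j)"
    "\<forall>t. flow_matrix N t ** w ** c t \<in> unitary_group"
    and curve: "kahler_gradient_curve lam (\<lambda>L. Re (trace (L ** N))) (\<lambda>t. orbit_point lam (flow_matrix N t ** w ** c t))"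
    and c0: "orbit_point lam (flow_matrix N 0 ** w ** c 0) = orbit_point lam w"
    using kahler_gradient_curve_exists[OF lam N wu] by (elim exE conjE)
  note c = c(1)[rule_format] c(2)[rule_format] c(3)[rule_format]
  define L where "L t = orbit_point lam (flow_matrix N t ** w ** c t)" for t
  \<comment> \<open>Continuity at 0 comes with differentiability of the gradient curve.\<close>
  have "isCont L 0"
    using curve unfolding kahler_gradient_curve_def L_def[abs_def]
    by (intro has_derivative_continuous) (auto simp: has_vector_derivative_def)
  moreover have "(\<lambda>n. inverse (real (Suc n))) \<longlonglongrightarrow> 0"
    by (rule LIMSEQ_inverse_real_of_nat)
  ultimately have "(\<lambda>n. L (inverse (real (Suc n)))) \<longlonglongrightarrow> L 0"
    by (rule isCont_tendsto_compose)
  moreover have "L (inverse (real (Suc n))) \<in> orbit_pos lam" for n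
    unfolding L_def orbit_pos_def
    by (intro imageI flow_unitary_pos[OF tri w _ c(1) c(2) c(3)]) simp
  ultimately have "L 0 \<in> closure (orbit_pos lam)"
    unfolding closure_sequential by (intro exI[of _ "\<lambda>n. L (inverse (real (Suc n)))"] conjI allI)
  then show ?thesis
    by (simp add: orbit_nonneg_def L_def c0[simplified])
qed

subsection \<open>Positive representatives along the flow\<close>

text \<open>The explicit curve starting at \<open>w\<close> makes the hypothesis applicable. Its
  flag condition is pulled back by \<open>flow_matrix N (- t)\<close>, so that it compares with the
  fixed frame \<open>w\<close>.\<close>

lemma positive_flow_representative:
  fixes lam :: "real^'n::{finite,linorder}" and N :: "'n cmat"
  assumes lam: "\<forall>i j. i \<le> j \<longrightarrow> lam $ j \<le> lam $ i" and N: "N \<in> skew_hermitian"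
    and pres: "kahler_flow_strictly_preserves_positivity lam (\<lambda>L. Re (trace (L ** N)))"
    and w: "w \<in> unitary_nonneg" and t: "0 < t"
  obtains g where "g \<in> unitary_pos"
    "block_upper (\<lambda>i. lam $ i) (ctranspose w ** (flow_matrix N (- t) ** g))"
proof -
  have wu: "w \<in> unitary_group" using w by (simp add: unitary_nonneg_def)
  obtain c where c: "\<forall>t. upper_tri (c t)" "\<forall>t j. c t $ j $ j \<in> \<real> \<and> 0 < Re (c t $ j $ j)"
    "\<forall>t. flow_matrix N t ** w ** c t \<in> unitary_group"
    and curve: "kahler_gradient_curve lam (\<lambda>L. Re (trace (L ** N))) (\<lambda>t. orbit_point lam (flow_matrix N t ** w ** c t))"
    and c0: "orbit_point lam (flow_matrix N 0 ** w ** c 0) = orbit_point lam w"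
    using kahler_gradient_curve_exists[OF lam N wu] by (elim exE conjE)
  note c = c(1)[rule_format] c(2)[rule_format] c(3)[rule_format]
  let ?G = "flow_matrix N t ** w ** c t"
  have "orbit_point lam (flow_matrix N 0 ** w ** c 0) \<in> orbit_nonneg lam"
    unfolding c0 by (rule orbit_point_nonneg[OF lam w])
  then have "orbit_point lam ?G \<in> orbit_pos lam"
    using pres curve t unfolding kahler_flow_strictly_preserves_positivity_def by blast
  then obtain g where g: "g \<in> unitary_pos" "orbit_point lam ?G = orbit_point lam g"
    by (auto simp: orbit_pos_def)
  have gu: "g \<in> unitary_group" using g by (simp add: unitary_pos_def)
  have "ctranspose ?G ** ?G = mat 1"
    by (rule unitary_groupD[OF c(3)])
  then have "(ctranspose ?G ** flow_matrix N t ** w) ** c t = mat 1"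
    by (simp only: matrix_mul_assoc)
  then have inv: "c t ** (ctranspose ?G ** flow_matrix N t ** w) = mat 1"
    using matrix_left_right_inverse by blast
  have "block_upper (\<lambda>i. lam $ i) (ctranspose ?G ** g)"
    using g(2) orbit_point_eq_iff[OF c(3) gu] by blast
  then have "block_upper (\<lambda>i. lam $ i) (c t ** (ctranspose ?G ** g))"
    by (rule block_upper_mult[OF upper_tri_block_upper_lam[OF lam c(1)]])
  moreover have "c t ** (ctranspose ?G ** g) = ctranspose w ** (flow_matrix N (- t) ** g)"
  proof -
    have ff: "flow_matrix N t ** flow_matrix N (- t) = mat 1"
      using flow_matrix_inverse[of N "- t"] by simp
    have "flow_matrix N t ** w ** (ctranspose w ** (flow_matrix N (- t) ** g)) =
        flow_matrix N t ** (w ** ctranspose w) ** flow_matrix N (- t) ** g"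
      by (simp only: matrix_mul_assoc)
    also have "\<dots> = g"
      by (simp only: unitary_groupD(1)[OF wu] matrix_mul_rid ff matrix_mul_lid)
    finally have "c t ** (ctranspose ?G ** g) =
        c t ** (ctranspose ?G ** (flow_matrix N t ** w ** (ctranspose w ** (flow_matrix N (- t) ** g))))"
      by simp
    also have "\<dots> = (c t ** (ctranspose ?G ** flow_matrix N t ** w)) ** (ctranspose w ** (flow_matrix N (- t) ** g))"
      by (simp only: matrix_mul_assoc)
    finally show ?thesis by (simp only: inv matrix_mul_lid)
  qed
  ultimately show ?thesis
    using that[OF g(1)] by simp
qed

subsection \<open>Coordinate flags\<close>

text \<open>Minors address columns by position, eigenvalue blocks are sets of indices; for initial
  segments the two descriptions agree.\<close>

lemma col_of_down_closed:
  fixes D :: "'n::{finite,linorder} set"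
  assumes D: "\<And>y z. y \<in> D \<Longrightarrow> z < y \<Longrightarrow> z \<in> D" and b: "b < CARD('n)"
  shows "col_of b \<in> D \<longleftrightarrow> b < card D"
proof -
  define B where "B = {b. b < CARD('n) \<and> (col_of b :: 'n) \<in> D}"
  have "bij_betw col_of B D"
    unfolding bij_betw_def
  proof
    show "inj_on (col_of :: nat \<Rightarrow> 'n) B"
      by (rule inj_onI) (auto simp: B_def col_of_eq_iff)
    have "\<exists>b. b < CARD('n) \<and> col_of b = y" for y :: 'n
      using bij_betw_imp_surj_on[OF col_of_bij[where 'n='n]] by (metis UNIV_I image_iff lessThan_iff)
    then show "col_of ` B = D"
      by (auto simp: B_def image_iff) metis
  qed
  then have cardB: "card B = card D" by (rule bij_betw_same_card)
  have down: "b' \<in> B" if "b \<in> B" "b' < b" for b b'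
    using that D[of "col_of b" "col_of b'"] col_of_less[where 'n='n, of b' b] by (auto simp: B_def)
  have finB: "finite B" by (simp add: B_def)
  show ?thesis
  proof
    assume "col_of b \<in> D"
    then have "{..b} \<subseteq> B"
      using down[of b] b by (auto simp: B_def le_less)
    from card_mono[OF finB this] show "b < card D" by (simp add: cardB)
  next
    assume less: "b < card D"
    show "col_of b \<in> D"
    proof (rule ccontr)
      assume "col_of b \<notin> D"
      then have "b \<notin> B" by (simp add: B_def)
      then have "B \<subseteq> {..<b}" using down by (metis lessThan_iff linorder_neqE_nat subsetI)
      from card_mono[OF _ this] show False using less by (simp add: cardB)
    qed
  qed
qed

lemma card_lessThan_col_of:
  assumes "b < CARD('n)" shows "card {..<(col_of b :: 'n::{finite,linorder})} = b"
proof -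
  have "bij_betw (col_of :: nat \<Rightarrow> 'n) {..<b} {..<col_of b}"
    unfolding bij_betw_def
  proof
    show "inj_on (col_of :: nat \<Rightarrow> 'n) {..<b}"
      by (rule inj_onI) (use assms in \<open>auto simp: col_of_eq_iff\<close>)
    show "col_of ` {..<b} = {..<col_of b :: 'n}"
    proof (intro equalityI subsetI)
      fix y assume y: "y \<in> {..<col_of b :: 'n}"
      obtain a where a: "a < CARD('n)" "col_of a = y"
        using bij_betw_imp_surj_on[OF col_of_bij[where 'n='n]] by (metis UNIV_I image_iff lessThan_iff)
      then have "a < b" using y assms col_of_less_iff[where 'n='n, of a b] by simp
      then show "y \<in> col_of ` {..<b}" using a by blast
    qed (use assms col_of_less in auto)
  qed
  from bij_betw_same_card[OF this] show ?thesis by simp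
qed

definition monomial :: "('n \<Rightarrow> 'n) \<Rightarrow> 'n::finite cmat \<Rightarrow> bool" where
  "monomial \<sigma> w \<longleftrightarrow> (\<forall>x y. x \<noteq> \<sigma> y \<longrightarrow> w $ x $ y = 0)"

text \<open>A permutation matrix has exactly one nonzero left-justified minor of each size, so its columns
  can be given signs that make all of these minors positive.\<close>

lemma signed_permutation:
  fixes \<sigma> :: "'n::{finite,linorder} \<Rightarrow> 'n"
  assumes \<sigma>: "inj \<sigma>"
  obtains w where "w \<in> unitary_nonneg" "monomial \<sigma> w"
proof -
  define p :: "'n cmat" where "p = (\<chi> x y. if x = \<sigma> y then 1 else 0)"
  have p: "p \<in> unitary_group"
  proof (rule unitary_groupI)
    have "(\<Sum>x\<in>UNIV. cnj (p $ x $ y) * p $ x $ z) = (if y = z then 1 else 0)" for y z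
    proof -
      have "(\<Sum>x\<in>UNIV. cnj (p $ x $ y) * p $ x $ z) = (\<Sum>x\<in>UNIV. if x = \<sigma> y then (if x = \<sigma> z then 1 else 0) else 0)"
        by (intro sum.cong refl) (simp add: p_def)
      also have "\<dots> = (if \<sigma> y = \<sigma> z then 1 else 0)" by simp
      finally show ?thesis using injD[OF \<sigma>] by auto
    qed
    then show "ctranspose p ** p = mat 1"
      by (simp add: vec_eq_iff matrix_mult_nth mat_def)
  qed
  \<comment> \<open>The rows occupied by the first \<open>k\<close> columns; only this row set gives
    a nonzero minor of size \<open>k\<close>.\<close>
  define I where "I k = \<sigma> ` col_of ` {..<k}" for k
  have cardI: "card (I k) = k" if "k \<le> CARD('n)" for k
  proof -
    have "inj_on (col_of :: nat \<Rightarrow> 'n) {..<k}"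
      by (rule inj_onI) (use that in \<open>auto simp: col_of_eq_iff\<close>)
    then show ?thesis
      unfolding I_def using \<sigma> by (simp add: card_image inj_on_subset)
  qed
  have only: "J = I (card J)" if J: "left_minor p J \<noteq> 0" for J
  proof (rule card_subset_eq)
    show "J \<subseteq> I (card J)"
    proof
      fix x assume x: "x \<in> J"
      show "x \<in> I (card J)"
      proof (rule ccontr)
        assume "x \<notin> I (card J)"
        then have "p $ x $ col_of b = 0" if "b < card J" for b
          using that by (auto simp: p_def I_def)
        then have "left_minor p J = 0"
          unfolding left_minor_row_minor using x by (intro row_minor_eq_0_row[of x]) auto
        then show False using J by simp
      qed
    qed
    show "card J = card (I (card J))"
      using cardI[of "card J"] card_mono[of UNIV J] by simp
  qed simp
  define \<delta> where "\<delta> k = Re (left_minor p (I k))" for k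
  have real: "left_minor p J = of_real (Re (left_minor p J))" for J
  proof -
    have "left_minor p J \<in> \<real>"
      unfolding left_minor_row_minor by (rule row_minor_Reals) (simp add: p_def)
    then show ?thesis by simp
  qed
  have \<delta>: "\<delta> k \<noteq> 0" if k: "k \<le> CARD('n)" for k
  proof -
    obtain S where "card S = k" "left_minor p S \<noteq> 0"
      using left_minor_nonzero_exists[OF unitary_groupD(1)[OF p] k] by blast
    then have "left_minor p (I k) \<noteq> 0" using only by metis
    then show ?thesis using real[of "I k"] by (auto simp: \<delta>_def)
  qed
  define e where "e k = sgn (\<delta> k)" for k
  have e: "e k * e k = 1" if "k \<le> CARD('n)" for k
    using \<delta>[OF that] by (simp add: e_def sgn_if)
  have e0: "e 0 = 1"
    by (simp add: e_def \<delta>_def I_def left_minor_row_minor row_minor_leibniz)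
  \<comment> \<open>The product over the first \<open>k\<close> columns telescopes to
    \<open>e k\<close>, the sign of the nonzero minor of size \<open>k\<close>, so this rescaling
    makes all of them positive.\<close>
  define \<epsilon> where "\<epsilon> y = e (Suc (card {..<y})) * e (card {..<y})" for y :: 'n
  have prod_\<epsilon>: "(\<Prod>b<k. \<epsilon> (col_of b)) = e k" if "k \<le> CARD('n)" for k
    using that
  proof (induction k)
    case (Suc k)
    then have "(\<Prod>b<Suc k. \<epsilon> (col_of b)) = e k * (e (Suc k) * e k)"
      by (simp add: \<epsilon>_def card_lessThan_col_of)
    also have "\<dots> = e (Suc k) * (e k * e k)" by simp
    finally show ?case using e[of k] Suc by simp
  qed (simp add: e0)
  have \<epsilon>: "\<epsilon> y * \<epsilon> y = 1" for y
  proof -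
    have "card {..<y} < card (UNIV :: 'n set)"
      by (intro psubset_card_mono) auto
    then have "e (Suc (card {..<y})) * e (Suc (card {..<y})) * (e (card {..<y}) * e (card {..<y})) = 1"
      using e by simp
    then show ?thesis by (simp add: \<epsilon>_def mult_ac)
  qed
  define w where "w = p ** real_diag \<epsilon>"
  have "real_diag \<epsilon> \<in> unitary_group"
  proof (rule unitary_groupI)
    have ct: "ctranspose (real_diag \<epsilon>) = real_diag \<epsilon>"
      by (simp add: vec_eq_iff real_diag_def)
    show "ctranspose (real_diag \<epsilon>) ** real_diag \<epsilon> = mat 1"
      unfolding ct using \<epsilon> by (simp add: vec_eq_iff real_diag_mult) (simp add: real_diag_def mat_def flip: of_real_mult)
  qed
  then have "w \<in> unitary_group"
    unfolding w_def by (rule unitary_group_mult[OF p])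
  moreover have "left_minor w J \<in> \<real> \<and> 0 \<le> Re (left_minor w J)" for J
  proof -
    have cJ: "card J \<le> CARD('n)" using card_mono[of UNIV J] by simp
    have "upper_tri (real_diag \<epsilon>)" by (auto simp: upper_tri_def real_diag_def)
    then have "left_minor w J = left_minor p J * of_real (\<Prod>b<card J. \<epsilon> (col_of b))"
      unfolding w_def by (simp add: left_minor_mult_upper_tri real_diag_def)
    then have eq: "left_minor w J = of_real (Re (left_minor p J) * e (card J))"
      using real[of J] prod_\<epsilon>[OF cJ] by (metis of_real_mult)
    have "0 \<le> Re (left_minor p J) * e (card J)"
    proof (cases "left_minor p J = 0")
      case False
      then have "Re (left_minor p J) = \<delta> (card J)" using only by (metis \<delta>_def)
      then show ?thesis by (simp add: e_def sgn_if)
    qed simp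
    then show ?thesis unfolding eq by simp
  qed
  moreover have "monomial \<sigma> w"
    by (auto simp: monomial_def w_def mult_real_diag p_def)
  ultimately show ?thesis
    by (intro that[of w]) (simp_all add: unitary_nonneg_def)
qed

lemma permutation_of_three:
  fixes a b c x y z :: 'a
  assumes abc: "a \<noteq> b" "a \<noteq> c" "b \<noteq> c" and xyz: "x \<noteq> y" "x \<noteq> z" "y \<noteq> z"
  shows "\<exists>\<sigma>. inj \<sigma> \<and> \<sigma> a = x \<and> \<sigma> b = y \<and> \<sigma> c = z"
proof -
  define f where "f = Transposition.transpose a x"
  define g where "g = Transposition.transpose (f b) y \<circ> f"
  define h where "h = Transposition.transpose (g c) z \<circ> g"
  have inj: "inj f" "inj g" "inj h"
    by (auto simp: f_def g_def h_def intro!: bij_is_inj bij_comp)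
  have fa: "f a = x" by (simp add: f_def)
  have "f b \<noteq> x" using inj(1) fa abc(1) by (metis injD)
  then have ga: "g a = x" "g b = y"
    using fa xyz(1) by (auto simp: g_def Transposition.transpose_def)
  have "g c \<noteq> x" "g c \<noteq> y" using inj(2) ga abc(2,3) by (metis injD)+
  then have "h a = x" "h b = y" "h c = z"
    using ga xyz(2,3) by (auto simp: h_def Transposition.transpose_def)
  then show ?thesis using inj(3) by blast
qed

text \<open>\<open>\<beta>\<close> preserves the span of the coordinates with eigenvalue at least v,
  so as many leading columns of \<open>w ** \<beta>\<close> as there are such coordinates are
  supported on their images under \<open>\<sigma>\<close>. With \<open>v2\<close> this confines all
  rows of a nonzero minor; with \<open>v1\<close> it forces the image of \<open>D1\<close> to be
  among them.\<close>

lemma monomial_block_upper_minor: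
  fixes lam :: "real^'n::{finite,linorder}" and w :: "'n cmat"
  assumes lam: "\<forall>i j. i \<le> j \<longrightarrow> lam $ j \<le> lam $ i" and \<sigma>: "inj \<sigma>" and w: "monomial \<sigma> w"
    and \<beta>: "block_upper (\<lambda>i. lam $ i) \<beta>"
    and D: "D1 = {y. v1 \<le> lam $ y}" "D2 = {y. v2 \<le> lam $ y}"
    and ys: "distinct ys" "card D1 \<le> length ys" "length ys \<le> card D2"
    and nz: "row_minor (w ** \<beta>) ys \<noteq> 0"
  shows "\<sigma> ` D1 \<subseteq> set ys" "set ys \<subseteq> \<sigma> ` D2"
proof -
  have zero: "(w ** \<beta>) $ x $ col_of b = 0"
    if "x \<notin> \<sigma> ` {y. v \<le> lam $ y}" "b < card {y. v \<le> lam $ y}" for x b v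
  proof -
    have bn: "b < CARD('n)"
      using that(2) card_mono[of UNIV "{y. v \<le> lam $ y}"] by simp
    have "z \<in> {y. v \<le> lam $ y}" if "y \<in> {y. v \<le> lam $ y}" "z < y" for y z
      using that lam by (auto intro: order_trans less_imp_le)
    then have "col_of b \<in> {y. v \<le> lam $ y}"
      using col_of_down_closed[OF _ bn, of "{y. v \<le> lam $ y}"] that(2) by blast
    then have "w $ x $ z * \<beta> $ z $ col_of b = 0" for z
    proof (cases "v \<le> lam $ z")
      case True
      then have "x \<noteq> \<sigma> z" using that(1) by auto
      then show ?thesis using w by (simp add: monomial_def)
    next
      case False
      then have "lam $ z < lam $ col_of b" using \<open>col_of b \<in> {y. v \<le> lam $ y}\<close> by simp
      then show ?thesis using \<beta> by (simp add: block_upper_def)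
    qed
    then show ?thesis
      unfolding matrix_mult_nth by (intro sum.neutral ballI)
  qed
  show "set ys \<subseteq> \<sigma> ` D2"
  proof
    fix x assume x: "x \<in> set ys"
    show "x \<in> \<sigma> ` D2"
    proof (rule ccontr)
      assume "x \<notin> \<sigma> ` D2"
      then have "row_minor (w ** \<beta>) ys = 0"
        using zero[of x v2] ys(3) D(2) by (intro row_minor_eq_0_row[OF x]) auto
      then show False using nz by simp
    qed
  qed
  show "\<sigma> ` D1 \<subseteq> set ys"
  proof (rule ccontr)
    assume "\<not> \<sigma> ` D1 \<subseteq> set ys"
    then have "card (\<sigma> ` D1 \<inter> set ys) < card (\<sigma> ` D1)"
      by (intro psubset_card_mono) auto
    also have "card (\<sigma> ` D1) = card D1"
      using \<sigma> by (simp add: card_image inj_on_subset)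
    finally have "row_minor (w ** \<beta>) ys = 0"
      using zero[of _ v1] D(1) by (intro row_minor_eq_0_cols[OF ys(1) ys(2)]) auto
    then show False using nz by simp
  qed
qed

subsection \<open>First order expansion of the minors at a coordinate flag\<close>

text \<open>The minor vanishes at \<open>h r\<close> and is positive at \<open>gs r\<close>, so the
  mean value theorem gives a time at which its derivative, of the form \<open>F\<close>, has
  positive real part; the weak inequality survives in the limit. The imaginary part needs its own
  intermediate time, because the theorem is one for real functions.\<close>

lemma first_order_limit:
  fixes N :: "'n::{finite,linorder} cmat" and gs :: "nat \<Rightarrow> 'n cmat"
  assumes t: "\<And>r. 0 < t r" "t \<longlonglongrightarrow> 0" and h: "\<And>r. gs r = flow_matrix N (t r) ** h r" "h \<longlonglongrightarrow> g"
    and zero: "\<And>r. row_minor (h r) xs = 0"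
    and pos: "\<And>r. row_minor (gs r) xs \<in> \<real> \<and> 0 < Re (row_minor (gs r) xs)"
  defines "F \<equiv> \<lambda>Y. \<Sum>a<length xs. \<Sum>y\<in>UNIV. (speed TYPE('n) *\<^sub>R i_times N) $ (xs ! a) $ y * row_minor Y (xs[a := y])"
  shows "F g \<in> \<real> \<and> 0 \<le> Re (F g)"
proof -
  have deriv: "((\<lambda>u. row_minor (flow_matrix N u ** h r) xs) has_vector_derivative F (flow_matrix N u ** h r)) (at u)" for u r
    unfolding F_def by (rule row_minor_deriv[OF flow_matrix_deriv])
  have deriv_Re: "((\<lambda>u. Re (row_minor (flow_matrix N u ** h r) xs)) has_real_derivative Re (F (flow_matrix N u ** h r))) (at u)" for u r
    using bounded_linear.has_vector_derivative[OF bounded_linear_Re deriv]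
    by (simp add: has_real_derivative_iff_has_vector_derivative)
  have deriv_Im: "((\<lambda>u. Im (row_minor (flow_matrix N u ** h r) xs)) has_real_derivative Im (F (flow_matrix N u ** h r))) (at u)" for u r
    using bounded_linear.has_vector_derivative[OF bounded_linear_Im deriv]
    by (simp add: has_real_derivative_iff_has_vector_derivative)
  have lim: "(\<lambda>r. F (flow_matrix N (\<theta> r) ** h r)) \<longlonglongrightarrow> F g" if \<theta>: "\<And>r. 0 < \<theta> r \<and> \<theta> r < t r" for \<theta>
  proof -
    have "\<theta> \<longlonglongrightarrow> 0"
      by (rule tendsto_sandwich[OF _ _ tendsto_const t(2)]) (use \<theta> in \<open>auto intro!: always_eventually less_imp_le\<close>)
    then have "(\<lambda>r. flow_matrix N (\<theta> r)) \<longlonglongrightarrow> flow_matrix N 0"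
      by (rule continuous_on_tendsto_compose[OF continuous_on_flow_matrix[of UNIV N]]) auto
    then have "(\<lambda>r. flow_matrix N (\<theta> r) ** h r) \<longlonglongrightarrow> flow_matrix N 0 ** g"
      by (rule tendsto_matrix_mult[OF _ h(2)])
    moreover have "continuous_on UNIV F"
      unfolding F_def by (intro continuous_intros continuous_on_row_minor)
    ultimately show ?thesis
      using continuous_on_tendsto_compose[of UNIV F] by simp
  qed
  have "\<exists>\<theta>. 0 < \<theta> \<and> \<theta> < t r \<and> 0 < Re (F (flow_matrix N \<theta> ** h r))" for r
  proof -
    obtain \<theta> where \<theta>: "0 < \<theta>" "\<theta> < t r"
      "Re (row_minor (flow_matrix N (t r) ** h r) xs) - Re (row_minor (flow_matrix N 0 ** h r) xs) =
        (t r - 0) * Re (F (flow_matrix N \<theta> ** h r))"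
      using MVT2[OF t(1)[of r] deriv_Re[of r]] by blast
    then have "0 < t r * Re (F (flow_matrix N \<theta> ** h r))"
      using pos[of r] zero[of r] by (simp add: h(1)[symmetric])
    then show ?thesis using \<theta> t(1)[of r] by (auto simp: zero_less_mult_iff)
  qed
  then have "\<forall>r. \<exists>\<theta>. 0 < \<theta> \<and> \<theta> < t r \<and> 0 < Re (F (flow_matrix N \<theta> ** h r))" by blast
  from choice[OF this] obtain \<theta> where
    \<theta>: "\<forall>r. 0 < \<theta> r \<and> \<theta> r < t r \<and> 0 < Re (F (flow_matrix N (\<theta> r) ** h r))" by (elim exE)
  have "(\<lambda>r. Re (F (flow_matrix N (\<theta> r) ** h r))) \<longlonglongrightarrow> Re (F g)"
    by (intro tendsto_Re lim) (use \<theta> in blast)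
  then have 1: "0 \<le> Re (F g)"
    by (rule LIMSEQ_le_const) (use \<theta> in \<open>auto intro: less_imp_le\<close>)
  have "\<exists>\<eta>. 0 < \<eta> \<and> \<eta> < t r \<and> Im (F (flow_matrix N \<eta> ** h r)) = 0" for r
  proof -
    obtain \<eta> where \<eta>: "0 < \<eta>" "\<eta> < t r"
      "Im (row_minor (flow_matrix N (t r) ** h r) xs) - Im (row_minor (flow_matrix N 0 ** h r) xs) =
        (t r - 0) * Im (F (flow_matrix N \<eta> ** h r))"
      using MVT2[OF t(1)[of r] deriv_Im[of r]] by blast
    then have "t r * Im (F (flow_matrix N \<eta> ** h r)) = 0"
      using pos[of r] zero[of r] by (simp add: h(1)[symmetric] complex_is_Real_iff)
    then show ?thesis using \<eta> t(1)[of r] by auto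
  qed
  then have "\<forall>r. \<exists>\<eta>. 0 < \<eta> \<and> \<eta> < t r \<and> Im (F (flow_matrix N \<eta> ** h r)) = 0" by blast
  from choice[OF this] obtain \<eta> where
    \<eta>: "\<forall>r. 0 < \<eta> r \<and> \<eta> r < t r \<and> Im (F (flow_matrix N (\<eta> r) ** h r)) = 0" by (elim exE)
  have "(\<lambda>r. Im (F (flow_matrix N (\<eta> r) ** h r))) \<longlonglongrightarrow> Im (F g)"
    by (intro tendsto_Im lim) (use \<eta> in blast)
  then have "Im (F g) = 0"
    using \<eta> by (simp add: LIMSEQ_const_iff)
  then show ?thesis
    using 1 by (simp add: complex_is_Real_iff)
qed

text \<open>The positive representatives at small times are arbitrary choices without continuity in
  time, so only a subsequence converges, by compactness of \<open>unitary_nonneg\<close>. The flag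
  condition is closed and passes to the limit.\<close>

lemma limit_representative:
  fixes lam :: "real^'n::{finite,linorder}" and N :: "'n cmat"
  assumes lam: "\<forall>i j. i \<le> j \<longrightarrow> lam $ j \<le> lam $ i" and N: "N \<in> skew_hermitian"
    and pres: "kahler_flow_strictly_preserves_positivity lam (\<lambda>L. Re (trace (L ** N)))"
    and w: "w \<in> unitary_nonneg"
  shows "\<exists>t gs g. (\<forall>r. 0 < t r) \<and> t \<longlonglongrightarrow> 0 \<and> (\<forall>r. gs r \<in> unitary_pos) \<and>
    (\<forall>r. block_upper (\<lambda>i. lam $ i) (ctranspose w ** (flow_matrix N (- t r) ** gs r))) \<and>
    (\<lambda>r :: nat. flow_matrix N (- t r) ** gs r) \<longlonglongrightarrow> g \<and> g \<in> unitary_nonneg \<and>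
    block_upper (\<lambda>i. lam $ i) (ctranspose w ** g)"
proof -
  define u where "u r = inverse (real (Suc r))" for r
  have u: "0 < u r" for r by (simp add: u_def)
  have u_lim: "u \<longlonglongrightarrow> 0" unfolding u_def by (rule LIMSEQ_inverse_real_of_nat)
  have "\<forall>r. \<exists>g. g \<in> unitary_pos \<and> block_upper (\<lambda>i. lam $ i) (ctranspose w ** (flow_matrix N (- u r) ** g))"
    using positive_flow_representative[OF lam N pres w u] by metis
  from choice[OF this] obtain f where
    f: "\<forall>r. f r \<in> unitary_pos \<and> block_upper (\<lambda>i. lam $ i) (ctranspose w ** (flow_matrix N (- u r) ** f r))"
    by (elim exE)
  have "\<forall>r. f r \<in> unitary_nonneg"
    using f by (auto simp: unitary_pos_def unitary_nonneg_def less_imp_le)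
  then obtain g \<phi> where g: "g \<in> unitary_nonneg" "strict_mono \<phi>" "(f \<circ> \<phi>) \<longlonglongrightarrow> g"
    using compact_unitary_nonneg unfolding compact_def by blast
  define t where "t = u \<circ> \<phi>"
  define gs where "gs = f \<circ> \<phi>"
  have t_lim: "t \<longlonglongrightarrow> 0"
    unfolding t_def by (rule LIMSEQ_subseq_LIMSEQ[OF u_lim g(2)])
  then have "(\<lambda>r. - t r) \<longlonglongrightarrow> 0"
    using tendsto_minus[OF t_lim] by simp
  then have "(\<lambda>r. flow_matrix N (- t r)) \<longlonglongrightarrow> flow_matrix N 0"
    by (rule continuous_on_tendsto_compose[OF continuous_on_flow_matrix[of UNIV N]]) auto
  from tendsto_matrix_mult[OF this g(3)] have lim: "(\<lambda>r. flow_matrix N (- t r) ** gs r) \<longlonglongrightarrow> g"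
    by (simp add: gs_def)
  have block: "block_upper (\<lambda>i. lam $ i) (ctranspose w ** (flow_matrix N (- t r) ** gs r))" for r
    using f by (simp add: t_def gs_def)
  have "block_upper (\<lambda>i. lam $ i) (ctranspose w ** g)"
    unfolding block_upper_def
  proof (intro allI impI)
    fix i j assume "lam $ i < lam $ j"
    then have "(ctranspose w ** (flow_matrix N (- t r) ** gs r)) $ i $ j = 0" for r
      using block[of r] by (simp add: block_upper_def)
    moreover have "(\<lambda>r. (ctranspose w ** (flow_matrix N (- t r) ** gs r)) $ i $ j) \<longlonglongrightarrow> (ctranspose w ** g) $ i $ j"
      by (intro tendsto_vec_nth tendsto_matrix_mult tendsto_const lim)
    ultimately show "(ctranspose w ** g) $ i $ j = 0"
      by (simp add: LIMSEQ_const_iff)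
  qed
  then show ?thesis
    using u t_lim f lim g(1) block
    by (intro exI[of _ t] exI[of _ gs] exI[of _ g]) (auto simp: t_def gs_def)
qed

subsection \<open>The necessary condition\<close>

text \<open>One \<open>g\<close> has to serve for all \<open>S\<close>, because the parity argument
  compares several minors of the same matrix. The sizes between \<open>card D1\<close> and
  \<open>card D2\<close> are those for which a nonzero minor must contain the row \<open>i\<close>
  and avoid the row \<open>j\<close>.\<close>

lemma entry_sign:
  fixes lam :: "real^'n::{finite,linorder}" and N :: "'n cmat"
  assumes lam: "\<forall>i j. i \<le> j \<longrightarrow> lam $ j \<le> lam $ i" and N: "N \<in> skew_hermitian"
    and pres: "kahler_flow_strictly_preserves_positivity lam (\<lambda>L. Re (trace (L ** N)))"
    and \<sigma>: "inj \<sigma>" and D: "D1 = {y. v1 \<le> lam $ y}" "D2 = {y. v2 \<le> lam $ y}"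
    and i: "i \<in> \<sigma> ` D1" and j: "j \<notin> \<sigma> ` D2" and ij: "i < j"
  shows "\<exists>g\<in>unitary_group. \<forall>S. card D1 \<le> card S \<longrightarrow> card S \<le> card D2 \<longrightarrow> left_minor g S \<noteq> 0 \<longrightarrow>
    \<sigma> ` D1 \<subseteq> S \<and> S \<subseteq> \<sigma> ` D2 \<and>
    (- 1) ^ card {x \<in> S. i < x \<and> x < j} * i_times N $ j $ i \<in> \<real> \<and>
    0 \<le> Re ((- 1) ^ card {x \<in> S. i < x \<and> x < j} * i_times N $ j $ i)"
proof -
  obtain w where w: "w \<in> unitary_nonneg" "monomial \<sigma> w"
    by (rule signed_permutation[OF \<sigma>])
  have wu: "w \<in> unitary_group" using w(1) by (simp add: unitary_nonneg_def)
  obtain t gs g where t: "\<forall>r. 0 < t r" "t \<longlonglongrightarrow> 0" and gs: "\<forall>r. gs r \<in> unitary_pos"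
    and block: "\<forall>r. block_upper (\<lambda>i. lam $ i) (ctranspose w ** (flow_matrix N (- t r) ** gs r))"
    and lim: "(\<lambda>r :: nat. flow_matrix N (- t r) ** gs r) \<longlonglongrightarrow> g" and g: "g \<in> unitary_nonneg"
    and block_g: "block_upper (\<lambda>i. lam $ i) (ctranspose w ** g)"
    using limit_representative[OF lam N pres w(1)] by (elim exE conjE)
  define h where "h r = flow_matrix N (- t r) ** gs r" for r
  have flow_h: "gs r = flow_matrix N (t r) ** h r" for r
    using flow_matrix_inverse[of N "- t r"] by (simp add: h_def matrix_mul_assoc)
  have vanish: "\<sigma> ` D1 \<subseteq> set ys \<and> set ys \<subseteq> \<sigma> ` D2"
    if "block_upper (\<lambda>i. lam $ i) (ctranspose w ** Y)" "row_minor Y ys \<noteq> 0"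
      "distinct ys" "card D1 \<le> length ys" "length ys \<le> card D2" for Y ys
  proof -
    have "w ** (ctranspose w ** Y) = Y" by (rule unitary_groupD(6)[OF wu])
    then show ?thesis
      using monomial_block_upper_minor[OF lam \<sigma> w(2) that(1) D that(3,4,5)] that(2) by simp
  qed
  have "\<sigma> ` D1 \<subseteq> S \<and> S \<subseteq> \<sigma> ` D2 \<and>
      (- 1) ^ card {x \<in> S. i < x \<and> x < j} * i_times N $ j $ i \<in> \<real> \<and>
      0 \<le> Re ((- 1) ^ card {x \<in> S. i < x \<and> x < j} * i_times N $ j $ i)"
    if S: "card D1 \<le> card S" "card S \<le> card D2" "left_minor g S \<noteq> 0" for S
  proof -
    have K: "\<sigma> ` D1 \<subseteq> S" "S \<subseteq> \<sigma> ` D2"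
      using vanish[OF block_g, of "sorted_list_of_set S"] S by (auto simp: left_minor_row_minor)
    have iS: "i \<in> S" and jS: "j \<notin> S" using i j K by auto
    define X where "X = sorted_list_of_set {x \<in> S. x < i}"
    define Y where "Y = sorted_list_of_set {x \<in> S. i < x \<and> x < j}"
    define Z where "Z = sorted_list_of_set {x \<in> S. j < x}"
    define T where "T = insert j (S - {i})"
    define xs where "xs = X @ Y @ j # Z"
    have sets: "set X = {x \<in> S. x < i}" "set Y = {x \<in> S. i < x \<and> x < j}" "set Z = {x \<in> S. j < x}"
      by (simp_all add: X_def Y_def Z_def)
    have srt: "sorted_wrt (<) X" "sorted_wrt (<) Y" "sorted_wrt (<) Z"
      by (simp_all add: X_def Y_def Z_def strict_sorted_list_of_set)
    have xs: "sorted_list_of_set T = xs"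
    proof (rule sorted_list_of_set_eqI)
      show "sorted_wrt (<) xs"
        unfolding xs_def sorted_wrt_append sorted_wrt.simps set_append list.set sets
        using srt ij by (auto intro: less_trans)
      show "set xs = T"
        unfolding xs_def set_append list.set sets T_def using jS ij by (auto simp: not_less le_less)
    qed
    have Slist: "sorted_list_of_set S = X @ i # Y @ Z"
    proof (rule sorted_list_of_set_eqI)
      show "sorted_wrt (<) (X @ i # Y @ Z)"
        unfolding sorted_wrt_append sorted_wrt.simps set_append list.set sets
        using srt ij by (auto intro: less_trans)
      show "set (X @ i # Y @ Z) = S"
        unfolding set_append list.set sets using iS jS ij by (auto simp: not_less le_less)
    qed
    define a0 where "a0 = length (X @ Y)"
    have a0: "a0 < length xs" "xs ! a0 = j" "xs[a0 := i] = X @ Y @ i # Z"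
      by (simp_all add: a0_def xs_def nth_append list_update_append)
    have len: "length xs = card S"
      using arg_cong[OF Slist, of length] by (simp add: xs_def)
    have set_xs: "set xs = T" and dist: "distinct xs"
      using xs by (metis finite set_sorted_list_of_set) (metis xs distinct_sorted_list_of_set)
    \<comment> \<open>The row \<open>i\<close>, missing from \<open>xs\<close>, belongs to every
      nonzero minor of this size.\<close>
    have zero: "row_minor (h r) xs = 0" for r
    proof (rule ccontr)
      assume "row_minor (h r) xs \<noteq> 0"
      then have "i \<in> set xs"
        using vanish[of "h r" xs] block dist S len i by (auto simp: h_def)
      then show False using ij by (simp add: set_xs T_def)
    qed
    have pos: "row_minor (gs r) xs \<in> \<real> \<and> 0 < Re (row_minor (gs r) xs)" for r
      using gs unfolding unitary_pos_def by (auto simp: left_minor_row_minor simp flip: xs)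
    define F where "F = (\<Sum>a<length xs. \<Sum>y\<in>UNIV. (speed TYPE('n) *\<^sub>R i_times N) $ (xs ! a) $ y * row_minor g (xs[a := y]))"
    have F: "F \<in> \<real> \<and> 0 \<le> Re F"
      unfolding F_def by (rule first_order_limit[OF spec[OF t(1)] t(2) flow_h lim[folded h_def] zero pos])
    \<comment> \<open>One replacement has to restore \<open>i\<close> and remove \<open>j\<close> at
      the same time, so it can only put \<open>i\<close> in the place of \<open>j\<close>.\<close>
    have only: "row_minor g (xs[a := y]) = 0" if a: "a < length xs" and ay: "\<not> (a = a0 \<and> y = i)" for a y
    proof (rule ccontr)
      assume nz: "row_minor g (xs[a := y]) \<noteq> 0"
      then have d: "distinct (xs[a := y])" using row_minor_not_distinct by blast
      have "\<sigma> ` D1 \<subseteq> set (xs[a := y]) \<and> set (xs[a := y]) \<subseteq> \<sigma> ` D2"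
        by (rule vanish[OF block_g nz d]) (use S len in simp_all)
      then have in_out: "i \<in> set (xs[a := y])" "j \<notin> set (xs[a := y])" using i j by auto
      have "set (xs[a := y]) = insert y (T - {xs ! a})"
        using set_update_distinct[OF dist a] set_xs by simp
      then have "y = i" "xs ! a = j" using in_out ij by (auto simp: T_def)
      then have "a = a0"
        using a0 a nth_eq_iff_index_eq[OF dist a, of a0] by simp
      then show False using ay \<open>y = i\<close> by simp
    qed
    have "F = (\<Sum>a<length xs. \<Sum>y\<in>UNIV. if a = a0 then (if y = i then
        (speed TYPE('n) *\<^sub>R i_times N) $ j $ i * row_minor g (X @ Y @ i # Z) else 0) else 0)"
      unfolding F_def
    proof (intro sum.cong refl)
      fix a y assume "a \<in> {..<length xs}"
      then show "(speed TYPE('n) *\<^sub>R i_times N) $ (xs ! a) $ y * row_minor g (xs[a := y]) =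
          (if a = a0 then (if y = i then (speed TYPE('n) *\<^sub>R i_times N) $ j $ i * row_minor g (X @ Y @ i # Z) else 0) else 0)"
        using only[of a y] a0 by auto
    qed
    also have "\<dots> = (\<Sum>a<length xs. if a = a0 then
        (speed TYPE('n) *\<^sub>R i_times N) $ j $ i * row_minor g (X @ Y @ i # Z) else 0)"
      by (intro sum.cong refl) auto
    also have "\<dots> = (speed TYPE('n) *\<^sub>R i_times N) $ j $ i * row_minor g (X @ Y @ i # Z)"
      using a0(1) by simp
    \<comment> \<open>In the place of \<open>j\<close>, the row \<open>i\<close> stands behind
      \<open>Y\<close>; sorting moves it past every row of \<open>S\<close> between \<open>i\<close>
      and \<open>j\<close>.\<close>
    also have "row_minor g (X @ Y @ i # Z) = (- 1) ^ card {x \<in> S. i < x \<and> x < j} * left_minor g S"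
      unfolding row_minor_move left_minor_row_minor Slist by (simp add: Y_def)
    finally have F_eq: "F = of_real (speed TYPE('n)) * left_minor g S *
        ((- 1) ^ card {x \<in> S. i < x \<and> x < j} * i_times N $ j $ i)"
      by (simp add: scaleR_conv_of_real[where 'a=complex] mult_ac)
    define q where "q = speed TYPE('n) * Re (left_minor g S)"
    have "left_minor g S = of_real (Re (left_minor g S))" "0 \<le> Re (left_minor g S)"
      using g by (auto simp: unitary_nonneg_def)
    then have q: "0 < q" "of_real (speed TYPE('n)) * left_minor g S = of_real q"
      using S(3) by (auto simp: q_def speed_def le_less)
    define z where "z = (- 1) ^ card {x \<in> S. i < x \<and> x < j} * i_times N $ j $ i"
    have "Re F = q * Re z" "Im F = q * Im z"
      unfolding F_eq q(2) z_def[symmetric] by simp_all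
    then have "z \<in> \<real>" "0 \<le> Re z"
      using F q(1) by (auto simp: complex_is_Real_iff zero_le_mult_iff)
    then show ?thesis using K unfolding z_def by blast
  qed
  then show ?thesis
    using g unfolding unitary_nonneg_def by (intro bexI[of _ g]) auto
qed

text \<open>The permutation puts \<open>i\<close> into the smaller subspace, \<open>m\<close> only
  into the larger one, and \<open>j\<close> outside both. For adjacent \<open>i\<close> and
  \<open>j\<close>, any third index \<open>m\<close> will do, and a single minor without
  intermediate rows gives the sign.\<close>

lemma offdiagonal_necessary:
  fixes lam :: "real^'n::{finite,linorder}" and N :: "'n cmat"
  assumes lam: "\<forall>i j. i \<le> j \<longrightarrow> lam $ j \<le> lam $ i" and N: "N \<in> skew_hermitian"
    and pres: "kahler_flow_strictly_preserves_positivity lam (\<lambda>L. Re (trace (L ** N)))"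
    and abc: "lam $ b < lam $ a" "lam $ c < lam $ b"
    and ij: "i < j" and m: "m \<noteq> i" "m \<noteq> j"
  shows "i < m \<Longrightarrow> m < j \<Longrightarrow> i_times N $ j $ i = 0"
    and "adjacent i j \<Longrightarrow> i_times N $ j $ i \<in> \<real> \<and> 0 \<le> Re (i_times N $ j $ i)"
proof -
  have ne: "a \<noteq> b" "a \<noteq> c" "b \<noteq> c" "i \<noteq> m" "i \<noteq> j" "m \<noteq> j"
    using abc ij m by auto
  obtain \<sigma> where \<sigma>: "inj \<sigma>" "\<sigma> a = i" "\<sigma> b = m" "\<sigma> c = j"
    using permutation_of_three[OF ne] by (elim exE conjE)
  define D1 where "D1 = {y. lam $ a \<le> lam $ y}"
  define D2 where "D2 = {y. lam $ b \<le> lam $ y}"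
  have D12: "D1 \<subseteq> D2" using abc by (auto simp: D1_def D2_def)
  have i: "i \<in> \<sigma> ` D1"
    unfolding \<sigma>(2)[symmetric] inj_image_mem_iff[OF \<sigma>(1)] by (simp add: D1_def)
  have j: "j \<notin> \<sigma> ` D2"
    unfolding \<sigma>(4)[symmetric] inj_image_mem_iff[OF \<sigma>(1)] using abc by (simp add: D2_def)
  have m_in: "m \<in> \<sigma> ` D2" "m \<notin> \<sigma> ` D1"
    unfolding \<sigma>(3)[symmetric] inj_image_mem_iff[OF \<sigma>(1)] using abc by (simp_all add: D1_def D2_def)
  have card_img: "card (\<sigma> ` D1) = card D1" "card (\<sigma> ` D2) = card D2"
    using \<sigma>(1) by (simp_all add: card_image inj_on_subset)
  define bt where "bt S = card {x \<in> S. i < x \<and> x < j}" for S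
  obtain g where g: "g \<in> unitary_group"
    and sign: "\<forall>S. card D1 \<le> card S \<longrightarrow> card S \<le> card D2 \<longrightarrow> left_minor g S \<noteq> 0 \<longrightarrow>
      \<sigma> ` D1 \<subseteq> S \<and> S \<subseteq> \<sigma> ` D2 \<and> (- 1) ^ bt S * i_times N $ j $ i \<in> \<real> \<and>
      0 \<le> Re ((- 1) ^ bt S * i_times N $ j $ i)"
    using entry_sign[OF lam N pres \<sigma>(1) D1_def D2_def i j ij] unfolding bt_def by (elim bexE)
  have sub: "\<sigma> ` D1 \<subseteq> S" "S \<subseteq> \<sigma> ` D2"
    and sgn: "(- 1) ^ bt S * i_times N $ j $ i \<in> \<real>" "0 \<le> Re ((- 1) ^ bt S * i_times N $ j $ i)"
    if "card D1 \<le> card S" "card S \<le> card D2" "left_minor g S \<noteq> 0" for S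
    using sign[rule_format, OF that] by blast+
  have D2_n: "card D2 \<le> CARD('n)" using card_mono[of UNIV D2] by simp
  obtain S where S: "card S = card D2" "left_minor g S \<noteq> 0"
    using left_minor_nonzero_exists[OF unitary_groupD(1)[OF g] D2_n] by blast
  have D12_card: "card D1 \<le> card D2" by (rule card_mono[OF _ D12]) simp
  have S_sign: "S \<subseteq> \<sigma> ` D2" "(- 1) ^ bt S * i_times N $ j $ i \<in> \<real>"
    "0 \<le> Re ((- 1) ^ bt S * i_times N $ j $ i)"
    using sub(2)[of S] sgn[of S] S D12_card by simp_all
  have S_eq: "S = \<sigma> ` D2"
    by (rule card_subset_eq[OF _ S_sign(1)]) (use S card_img in simp_all)
  show "i_times N $ j $ i \<in> \<real> \<and> 0 \<le> Re (i_times N $ j $ i)" if "adjacent i j"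
  proof -
    have "{x \<in> S. i < x \<and> x < j} = {}"
      using that ij by (auto simp: adjacent_def)
    then have "bt S = 0" by (simp add: bt_def)
    then show ?thesis using S_sign by simp
  qed
  show "i_times N $ j $ i = 0" if between: "i < m" "m < j"
  proof (rule ccontr)
    assume nz: "i_times N $ j $ i \<noteq> 0"
    have chain: "\<exists>S. card S = k \<and> left_minor g S \<noteq> 0 \<and> bt S = bt (\<sigma> ` D2)"
      if "k \<le> card D2" "card D1 \<le> k" for k
      using that
    proof (induction rule: inc_induct)
      case base
      then show ?case using S S_eq by blast
    next
      case (step k)
      obtain S where S: "card S = Suc k" "left_minor g S \<noteq> 0" "bt S = bt (\<sigma> ` D2)"
        using step.IH[OF le_SucI[OF step.prems]] by (elim exE conjE)
      have cards: "card D1 \<le> card S" "card S \<le> card D2"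
        using step.prems step.hyps S(1) by simp_all
      have "S \<noteq> {}" using S(1) by auto
      then obtain p where p: "p \<in> S" "left_minor g (S - {p}) \<noteq> 0"
        using left_minor_remove[OF S(2)] by blast
      have card_p: "card (S - {p}) = k" using S(1) p(1) by simp
      \<comment> \<open>Were \<open>p\<close> between \<open>i\<close> and \<open>j\<close>, the
        parity of \<open>bt\<close> would flip, and the sign conditions for \<open>S\<close> and
        \<open>S - {p}\<close> would make the real entry both nonnegative and nonpositive.\<close>
      have "bt (S - {p}) = bt S"
      proof (rule ccontr)
        assume neq: "bt (S - {p}) \<noteq> bt S"
        let ?B = "{x \<in> S. i < x \<and> x < j}"
        have B: "{x \<in> S - {p}. i < x \<and> x < j} = ?B - {p}" by blast
        have "p \<in> ?B"
        proof (rule ccontr)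
          assume "p \<notin> ?B"
          then have "?B - {p} = ?B" by blast
          then show False using neq unfolding bt_def B by simp
        qed
        from card.remove[OF finite this] have bt_Suc: "bt S = Suc (bt (S - {p}))"
          unfolding bt_def B .
        define z where "z = (- 1) ^ bt (S - {p}) * i_times N $ j $ i"
        have p_cards: "card D1 \<le> card (S - {p})" "card (S - {p}) \<le> card D2"
          using step.prems step.hyps card_p by simp_all
        have z: "z \<in> \<real>" "0 \<le> Re z"
          unfolding z_def by (rule sgn[OF p_cards p(2)])+
        have "(- 1) ^ bt S * i_times N $ j $ i = - z" by (simp add: z_def bt_Suc)
        then have "0 \<le> Re (- z)"
          using sgn(2)[OF cards S(2)] by (simp only:)
        then have "z = 0"
          using z by (simp add: complex_eq_iff complex_is_Real_iff)
        then show False using nz by (simp add: z_def)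
      qed
      then show ?case
        by (intro exI[of _ "S - {p}"] conjI card_p p(2)) (simp only: S(3))
    qed
    obtain S' where S': "card S' = card D1" "left_minor g S' \<noteq> 0" "bt S' = bt (\<sigma> ` D2)"
      using chain[OF D12_card order_refl] by (elim exE conjE)
    have "\<sigma> ` D1 \<subseteq> S'"
      by (rule sub(1)) (use S' D12_card in simp_all)
    then have "S' = \<sigma> ` D1"
      using card_subset_eq[of S' "\<sigma> ` D1"] S'(1) card_img by simp
    \<comment> \<open>The index \<open>m\<close> is counted only on the right, which contradicts the
      constancy of \<open>bt\<close> along the chain.\<close>
    moreover have "bt (\<sigma> ` D1) < bt (\<sigma> ` D2)"
      unfolding bt_def
    proof (rule psubset_card_mono)
      show "{x \<in> \<sigma> ` D1. i < x \<and> x < j} \<subset> {x \<in> \<sigma> ` D2. i < x \<and> x < j}"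
        using D12 m_in between by blast
    qed simp
    ultimately show False using S'(3) by simp
  qed
qed

text \<open>If an entry next to the diagonal vanishes, the flow respects the corresponding block
  decomposition and some minor stays zero.\<close>

lemma adjacent_entry_nonzero:
  fixes lam :: "real^'n::{finite,linorder}" and N :: "'n cmat"
  assumes lam: "\<forall>i j. i \<le> j \<longrightarrow> lam $ j \<le> lam $ i" and N: "N \<in> skew_hermitian"
    and pres: "kahler_flow_strictly_preserves_positivity lam (\<lambda>L. Re (trace (L ** N)))"
    and tri: "real_tridiagonal (i_times N)"
    and abc: "lam $ b < lam $ a" "lam $ c < lam $ b"
    and ij: "i < j" "adjacent i j" and m: "m \<noteq> i" "m \<noteq> j"
  shows "i_times N $ j $ i \<noteq> 0"
proof
  assume z: "i_times N $ j $ i = 0"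
  then have z': "i_times N $ i $ j = 0"
    using i_times_skew_hermitian[OF N, of i j] by simp
  have ne: "a \<noteq> b" "a \<noteq> c" "b \<noteq> c" "i \<noteq> m" "i \<noteq> j" "m \<noteq> j"
    using abc ij m by auto
  obtain \<sigma> where \<sigma>: "inj \<sigma>" "\<sigma> a = i" "\<sigma> b = m" "\<sigma> c = j"
    using permutation_of_three[OF ne] by (elim exE conjE)
  define D where "D = {y. lam $ a \<le> lam $ y}"
  define K where "K = \<sigma> ` D"
  have i: "i \<in> K"
    unfolding K_def \<sigma>(2)[symmetric] inj_image_mem_iff[OF \<sigma>(1)] by (simp add: D_def)
  have j: "j \<notin> K"
    unfolding K_def \<sigma>(4)[symmetric] inj_image_mem_iff[OF \<sigma>(1)] using abc by (simp add: D_def)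
  have card_K: "card K = card D"
    unfolding K_def using \<sigma>(1) by (simp add: card_image inj_on_subset)
  obtain w where w: "w \<in> unitary_nonneg" "monomial \<sigma> w"
    by (rule signed_permutation[OF \<sigma>(1)])
  have wu: "w \<in> unitary_group" using w(1) by (simp add: unitary_nonneg_def)
  obtain g where g: "g \<in> unitary_pos"
    and block: "block_upper (\<lambda>i. lam $ i) (ctranspose w ** (flow_matrix N (- 1) ** g))"
    using positive_flow_representative[OF lam N pres w(1), of 1] by auto
  define h where "h = flow_matrix N (- 1) ** g"
  define A where "A = speed TYPE('n) *\<^sub>R i_times N"
  have A: "real_tridiagonal A"
    using tri by (simp add: A_def real_tridiagonal_def scaleR_conv_of_real[where 'a=complex])
  have A0: "A $ i $ j = 0" "A $ j $ i = 0" using z z' by (simp_all add: A_def)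
  \<comment> \<open>The vanishing entry decouples the indices up to \<open>i\<close> from the rest,
    so the number of rows up to \<open>i\<close> is conserved. \<open>\<S>\<close> collects the row
    sets whose number differs from that of \<open>K\<close>, the only set of this size with a
    nonzero initial minor.\<close>
  define \<S> where "\<S> = {I. card I = card D \<and> card (I \<inter> {..i}) \<noteq> card (K \<inter> {..i})}"
  have "Re (left_minor (flow_matrix N 1 ** h) (insert j (K - {i}))) = 0"
  proof (rule zero_linear_ode[of "\<lambda>t I. Re (left_minor (flow_matrix N t ** h) I)" "compound_gen A" \<S>])
    show "((\<lambda>t. Re (left_minor (flow_matrix N t ** h) I)) has_real_derivative
        (\<Sum>J\<in>UNIV. compound_gen A I J * Re (left_minor (flow_matrix N t ** h) J))) (at t)" for t I
      by (rule left_minor_deriv_Re_Im(1)[OF _ A]) (unfold A_def, rule flow_matrix_deriv)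
    show "compound_gen A I J = 0" if I: "I \<in> \<S>" and J: "J \<notin> \<S>" for I J
      unfolding compound_gen_def
    proof (intro sum.neutral ballI)
      fix x y assume x: "x \<in> I" and y: "y \<in> - (I - {x})"
      show "(if J = insert y (I - {x}) then Re (A $ x $ y) else 0) = 0"
      proof (rule ccontr)
        assume "(if J = insert y (I - {x}) then Re (A $ x $ y) else 0) \<noteq> 0"
        then have J_eq: "J = insert y (I - {x})" and Axy: "Re (A $ x $ y) \<noteq> 0"
          by (auto split: if_splits)
        have "x \<noteq> y" using I J J_eq x by (auto simp: insert_absorb)
        then have yI: "y \<notin> I" using y by auto
        have "A $ x $ y \<noteq> 0" using Axy by auto
        then have adj: "adjacent x y"
          using A \<open>x \<noteq> y\<close> unfolding real_tridiagonal_def by blast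
        \<comment> \<open>\<open>j\<close> is the successor of \<open>i\<close>, so adjacent indices
          on different sides of the cut must be \<open>i\<close> and \<open>j\<close> themselves,
          where \<open>A\<close> vanishes.\<close>
        have same: "x \<le> i \<longleftrightarrow> y \<le> i"
        proof (rule ccontr)
          assume "\<not> (x \<le> i \<longleftrightarrow> y \<le> i)"
          then have "x = i \<and> y = j \<or> x = j \<and> y = i"
            using adjacent_order(1)[OF adj, of i] adjacent_order(1)[OF ij(2), of x]
              adjacent_order(1)[OF ij(2), of y] adjacent_order(2)[OF adj, of i] adjacent_order(2)[OF ij(2), of x]
              adjacent_order(2)[OF ij(2), of y] adjacent_order(1)[OF adj, of j] adjacent_order(2)[OF adj, of j] ij(1)
            by (metis less_le_not_le linorder_not_le order_less_le)
          then show False using A0 Axy by auto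
        qed
        have "card J = card I"
          using x yI card_Suc_Diff1[OF finite x] unfolding J_eq by (subst card_insert_disjoint) auto
        moreover have "card (J \<inter> {..i}) = card (I \<inter> {..i})"
        proof (cases "x \<le> i")
          case True
          then have "J \<inter> {..i} = insert y (I \<inter> {..i} - {x})" using same J_eq by auto
          moreover have "card (insert y (I \<inter> {..i} - {x})) = card (I \<inter> {..i})"
            using x yI True card_Suc_Diff1[of "I \<inter> {..i}" x] by (subst card_insert_disjoint) auto
          ultimately show ?thesis by simp
        next
          case False
          then have "J \<inter> {..i} = I \<inter> {..i}" using same J_eq by auto
          then show ?thesis by simp
        qed
        ultimately have "J \<in> \<S>" using I by (simp add: \<S>_def)
        then show False using J by simp
      qed
    qed
    show "Re (left_minor (flow_matrix N 0 ** h) I) = 0" if I: "I \<in> \<S>" for I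
    proof (rule ccontr)
      \<comment> \<open>With both thresholds equal to \<open>lam $ a\<close>, the two inclusions for
        nonzero minors pin the row set down to \<open>K\<close>.\<close>
      assume "Re (left_minor (flow_matrix N 0 ** h) I) \<noteq> 0"
      moreover have "h = w ** (ctranspose w ** h)" by (simp add: unitary_groupD(6)[OF wu])
      ultimately have nz: "row_minor (w ** (ctranspose w ** h)) (sorted_list_of_set I) \<noteq> 0"
        by (auto simp: left_minor_row_minor)
      have "K \<subseteq> I" "I \<subseteq> K"
        using monomial_block_upper_minor[OF lam \<sigma>(1) w(2) block[folded h_def] D_def D_def _ _ _ nz] I
        by (auto simp: K_def \<S>_def)
      then show False using I by (simp add: \<S>_def)
    qed
    show "insert j (K - {i}) \<in> \<S>"
    proof -
      have "card (insert j (K - {i})) = card D"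
        using i j card_K card_Suc_Diff1[OF finite i] by (subst card_insert_disjoint) auto
      moreover have "insert j (K - {i}) \<inter> {..i} \<subset> K \<inter> {..i}" using i ij(1) by auto
      then have "card (insert j (K - {i}) \<inter> {..i}) < card (K \<inter> {..i})"
        by (intro psubset_card_mono) auto
      ultimately show ?thesis by (simp add: \<S>_def)
    qed
  qed
  moreover have "flow_matrix N 1 ** h = g"
    using flow_matrix_inverse[of N "- 1"] by (simp add: h_def matrix_mul_assoc)
  ultimately show False
    using g by (simp add: unitary_pos_def) (metis less_irrefl)
qed

lemma three_values:
  fixes lam :: "real^'n::finite"
  assumes "card (range (\<lambda>i. lam $ i)) \<ge> 3"
  obtains a b c where "lam $ b < lam $ a" "lam $ c < lam $ b"
proof -
  let ?R = "range (\<lambda>i. lam $ i)"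
  have "card {Min ?R, Max ?R} \<le> 2" by (simp add: card_insert_if)
  then have "\<not> ?R \<subseteq> {Min ?R, Max ?R}"
    using assms card_mono[of "{Min ?R, Max ?R}" ?R] by auto
  then obtain b where b: "lam $ b \<noteq> Min ?R" "lam $ b \<noteq> Max ?R" by auto
  have "Min ?R \<in> ?R" "Max ?R \<in> ?R" by (intro Min_in Max_in; simp)+
  then obtain a c where ac: "lam $ a = Max ?R" "lam $ c = Min ?R" by (metis imageE)
  have "lam $ b \<le> Max ?R" "Min ?R \<le> lam $ b" by simp_all
  then have "lam $ b < lam $ a" "lam $ c < lam $ b"
    using ac b by linarith+
  then show ?thesis by (rule that)
qed

lemma preserves_positivity_tri_positive:
  fixes lam :: "real^'n::{finite,linorder}" and N :: "'n cmat"
  assumes lam: "\<forall>i j. i \<le> j \<longrightarrow> lam $ j \<le> lam $ i" and N: "N \<in> skew_hermitian"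
    and three: "card (range (\<lambda>i. lam $ i)) \<ge> 3"
    and pres: "kahler_flow_strictly_preserves_positivity lam (\<lambda>L. Re (trace (L ** N)))"
  shows "tri_positive (i_times N)"
proof -
  obtain a b c where abc: "lam $ b < lam $ a" "lam $ c < lam $ b"
    by (rule three_values[OF three])
  have "card (range (\<lambda>i. lam $ i)) \<le> CARD('n)" by (rule card_image_le) simp
  then have n: "3 \<le> CARD('n)" using three by simp
  \<comment> \<open>Three distinct eigenvalues force at least three indices; for adjacent
    \<open>i\<close> and \<open>j\<close> this supplies the third index to be placed between the two
    subspaces.\<close>
  have third: "\<exists>m. m \<noteq> i \<and> m \<noteq> j" for i j :: 'n
  proof -
    have "card {i, j} < CARD('n)" using n by (simp add: card_insert_if)
    then have "{i, j} \<noteq> UNIV" by auto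
    then show ?thesis by blast
  qed
  have lower: "(\<not> adjacent i j \<longrightarrow> i_times N $ j $ i = 0) \<and>
      i_times N $ j $ i \<in> \<real> \<and> (adjacent i j \<longrightarrow> 0 \<le> Re (i_times N $ j $ i))" if ij: "i < j" for i j
  proof (cases "adjacent i j")
    case True
    obtain m where "m \<noteq> i" "m \<noteq> j" using third by blast
    then show ?thesis using offdiagonal_necessary(2)[OF lam N pres abc ij _ _ True] True by blast
  next
    case False
    then obtain m where "i < m" "m < j" using ij by (auto simp: adjacent_def)
    then have "i_times N $ j $ i = 0"
      using offdiagonal_necessary(1)[OF lam N pres abc ij, of m] by auto
    then show ?thesis using False by simp
  qed
  have herm: "i_times N $ i $ j = cnj (i_times N $ j $ i)" for i j
    using i_times_skew_hermitian[OF N, of j i] by simp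
  have real: "i_times N $ i $ j \<in> \<real>" for i j
  proof (cases i j rule: linorder_cases)
    case less
    then show ?thesis using lower[OF less] herm[of i j] by (simp add: complex_is_Real_iff)
  next
    case equal
    then show ?thesis using arg_cong[OF herm[of i i], of Im] by (simp add: complex_is_Real_iff)
  next
    case greater
    then show ?thesis using lower[OF greater] by blast
  qed
  have zero: "i_times N $ i $ j = 0" if "i \<noteq> j" "\<not> adjacent i j" for i j
    using that lower[of i j] lower[of j i] herm[of i j] adjacent_commute[of i j]
    by (cases i j rule: linorder_cases) auto
  have tri: "real_tridiagonal (i_times N)"
    using real zero by (simp add: real_tridiagonal_def)
  have pos: "0 < Re (i_times N $ j $ i)" if ij: "i < j" "adjacent i j" for i j
  proof -
    obtain m where m: "m \<noteq> i" "m \<noteq> j" using third by blast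
    have "i_times N $ j $ i \<noteq> 0"
      by (rule adjacent_entry_nonzero[OF lam N pres tri abc ij m])
    then show ?thesis
      using lower[OF ij(1)] ij(2) by (auto simp: complex_is_Real_iff complex_eq_iff le_less)
  qed
  have "0 < Re (i_times N $ i $ j)" if "adjacent i j" for i j
  proof (cases i j rule: linorder_cases)
    case less
    then show ?thesis using pos[OF less that] herm[of i j] by simp
  next
    case equal
    then show ?thesis using that by (simp add: adjacent_def)
  next
    case greater
    then show ?thesis using pos[OF greater] that adjacent_commute[of i j] by simp
  qed
  then show ?thesis
    using tri by (simp add: tri_positive_def)
qed

theorem theorem1p4:
  fixes lam :: "real^'n::{finite,linorder}" and N :: "'n cmat"
  assumes "\<forall>i j. i \<le> j \<longrightarrow> lam $ j \<le> lam $ i"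
    and "card (range (\<lambda>i. lam $ i)) \<ge> 3"
    and "N \<in> skew_hermitian"
  shows "kahler_flow_strictly_preserves_positivity lam (\<lambda>L. Re (trace (L ** N))) \<longleftrightarrow>
    real_tridiagonal (map_matrix (\<lambda>z. \<i> * z) N) \<and>
    (\<forall>i j. adjacent i j \<longrightarrow> 0 < Re (map_matrix (\<lambda>z. \<i> * z) N $ i $ j))"
  using tri_positive_preserves_positivity[OF assms(1,3)]
    preserves_positivity_tri_positive[OF assms(1,3,2)]
  unfolding tri_positive_def by blast

end
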